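(* Let $Z_F(s)=\sum_{n\ge1}F_n^{-s}$ for $\operatorname{Re}s>0$, and for $\sigma>0$ let $H(\sigma)=Z_F(\sigma)-4-2\cdot144^{-\sigma}$. There is a unique $\sigma_F\in(0.7,0.75)$ with $H(\sigma_F)=0$. It satisfies $\sigma_F=0.743163398726901648\ldots$. Moreover: (i) $Z_F(s)\neq0$ for $\operatorname{Re}s\ge\sigma_F$; (ii) if $\mathcal R_F:=\{\operatorname{Re}\rho: Z_F(\rho)=0,\ \operatorname{Re}\rho>0\}$, then $\overline{\mathcal R_F}=[0,\sigma_F]$; (iii) for $0<\varepsilon<\sigma_F-1/2$, put $$T_F(\varepsilon):=\min\bigl\{|\operatorname{Im}\rho|: Z_F(\rho)=0,\ \sigma_F-\varepsilon<\operatorname{Re}\rho<\sigma_F\bigr\}.$$ Then for every $\eta>0$, $T_F(\varepsilon)\gg_\eta\varepsilon^{-1/(15.232+\eta)}$ as $\varepsilon\downarrow0$. In particular, $\sup\mathcal R_F=\sigma_F$, but no zero of $Z_F$ lies on the line $\operatorname{Re}s=\sigma_F$.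
   Context: $F_1=F_2=1$, $F_{n+2}=F_{n+1}+F_n$ are the Fibonacci numbers; the series $Z_F(s)$ converges absolutely for $\operatorname{Re}s>0$. The overline denotes closure in $\mathbb R$. The notation $T_F(\varepsilon)\gg_\eta g(\varepsilon)$ as $\varepsilon\downarrow0$ means that there are constants $c_\eta>0$ and $\varepsilon_\eta>0$, depending only on $\eta$, with $T_F(\varepsilon)\ge c_\eta\, g(\varepsilon)$ for $0<\varepsilon<\varepsilon_\eta$. *)

theory Defs
  imports "HOL-Analysis.Analysis" "HOL-Number_Theory.Fib"
begin

(* The Fibonacci zeta function, meaningful for Re s > 0, where the series converges absolutely.
   The library has fib 0 = 0 and fib 1 = fib 2 = 1, so the index is shifted to start at F_1. *)
definition Z_F :: "complex \<Rightarrow> complex" where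
  "Z_F s = (\<Sum>n. of_nat (fib (Suc n)) powr (- s))"

(* Complex-valued only because Z_F is; it takes real values for real \<sigma> > 0. *)
definition H_F :: "real \<Rightarrow> complex" where
  "H_F \<sigma> = Z_F (of_real \<sigma>) - 4 - 2 * 144 powr (- of_real \<sigma>)"

(* Unique existence is part of the theorem. *)
definition sigma_F :: real where
  "sigma_F = (THE \<sigma>. \<sigma> \<in> {0.7<..<0.75} \<and> H_F \<sigma> = 0)"

definition R_F :: "real set" where
  "R_F = {Re \<rho> | \<rho>. Z_F \<rho> = 0 \<and> Re \<rho> > 0}"

definition zero_heights :: "real \<Rightarrow> real set" where
  "zero_heights \<epsilon> =
     {\<bar>Im \<rho>\<bar> | \<rho>. Z_F \<rho> = 0 \<and> sigma_F - \<epsilon> < Re \<rho> \<and> Re \<rho> < sigma_F}"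

(* The minimum of a possibly infinite set, hence LEAST rather than Min (which is for finite sets).
   That the minimum exists for 0 < \<epsilon> < sigma_F - 1/2 is part of the theorem. *)
definition T_F :: "real \<Rightarrow> real" where
  "T_F \<epsilon> = (LEAST t. t \<in> zero_heights \<epsilon>)"

end

theory Submission
  imports Defs "HOL-Complex_Analysis.Complex_Analysis" "HOL-Number_Theory.Totient"
begin

text \<open>Apart from \<open>F\<^sub>1, F\<^sub>2, F\<^sub>6 = 2\<^sup>3, F\<^sub>1\<^sub>2 = 2\<^sup>4 3\<^sup>2\<close> every Fibonacci number has a primitive prime divisor
  (Carmichael), so the logarithms of the others are linearly independent over the rationals. On a vertical line the
  extreme configuration is therefore \<open>F\<^sub>n powr (- it) = - 1\<close> for all \<open>n\<close> except \<open>1, 2, 12\<close>, which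
  gives the equation for \<open>\<sigma>\<^sub>F\<close>; exact alignment would force \<open>ln 3 / ln 2\<close> to be rational. To the left of
  \<open>\<sigma>\<^sub>F\<close> a greedy choice of signs \<open>\<plusminus>1\<close> makes the twisted series vanish, Kronecker's theorem approximates
  the signs by vertical translates, and Hurwitz's theorem produces zeros of \<open>Z_F\<close> itself.

  For the height of zeros near \<open>\<sigma>\<^sub>F\<close> no irrationality measure is needed: all \<open>F\<^sub>n powr (- it)\<close> are close to
  \<open>- 1\<close>, whereas Cassini's identity \<open>F\<^sub>n\<^sub>+\<^sub>1 F\<^sub>n\<^sub>-\<^sub>1 = F\<^sub>n\<^sup>2 \<plusminus> 1\<close> with \<open>F\<^sub>n\<^sup>2\<close> of size
  about \<open>t\<close> keeps \<open>(F\<^sub>n\<^sub>+\<^sub>1 F\<^sub>n\<^sub>-\<^sub>1 / F\<^sub>n\<^sup>2) powr (- it)\<close> away from \<open>1\<close>. This even gives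
  height at least \<open>c / \<epsilon>\<close>.\<close>

section \<open>Prime divisors of Fibonacci numbers\<close>

text \<open>Beyond 1 and 2, the two indices without a primitive prime behave differently.
  \<open>8 = 2^3\<close> has an odd exponent, so its phase is -1 as soon as that of 2 is;
  \<open>144 = 2^4 * 3^2\<close> has even exponents, so phases -1 at 2 and 3 force +1 at 144. The
  critical abscissa is therefore where the sum of F_n^(-sigma) over n other than 1, 2, 12 equals 2 +
  144^(-sigma). Index 12 is the recurring obstacle: it spoils termwise monotonicity of
  \<open>Gsum\<close>, its deviation from +1 at a zero must be paid for by 2 and 3, deleting it
  leaves a gap in the greedy choice of signs, and the use of Cassini's identity has to stay at
  indices from 13 on. Carmichael's theorem comes from measuring Phi_n in two ways. It is at least
  golden^(totient n - 2), while, for n other than 6 and 12, the primes that already divide an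
  earlier Fibonacci number contribute to it at most one prime divisor of n, hence at most totient n
  + 1. Small totients leave a finite list.\<close>

text \<open>With Q the Fibonacci matrix, Q^m = B + A Q, so these are the first terms of the binomial
  expansion of (B + A Q)^(k + 2). The addition formula couples neighbouring entries, so both claims
  go through the induction together; \<open>k + 2\<close> avoids truncated exponents.\<close>

lemma fib_mult_expand:
  fixes m k :: nat
  assumes "m > 0"
  defines "A \<equiv> fib m" and "B \<equiv> fib (m - 1)"
  shows "(\<exists>u. fib (m * (k + 2)) = (k + 2) * A * B ^ (k + 1) + ((k + 2) choose 2) * A ^ 2 * B ^ k + A ^ 3 * u) \<and>
         (\<exists>v. fib (m * (k + 2) + 1) = B ^ (k + 2) + (k + 2) * A * B ^ (k + 1) + A ^ 2 * v)"
proof -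
  have Suc_m: "fib (Suc m) = A + B"
    using assms by (cases m) (auto simp: A_def B_def)
  have step1: "fib (m * k + m) = fib (m * k + 1) * A + fib (m * k) * B" for k
  proof -
    obtain m' where m': "m = Suc m'" using \<open>m > 0\<close> gr0_implies_Suc by blast
    show ?thesis using fib_add[of "m*k" m'] unfolding m' A_def B_def by (simp add: algebra_simps)
  qed
  have step2: "fib (m * k + m + 1) = fib (m * k + 1) * (A + B) + fib (m * k) * A" for k
    using fib_add[of "m*k" m] by (simp add: Suc_m A_def algebra_simps)
  show ?thesis
  proof (induction k)
    case 0
    have 1: "fib (m * 1) = A" "fib (m * 1 + 1) = A + B" by (simp_all add: A_def Suc_m)
    have "fib (m * 2) = (A + B) * A + A * B" using step1[of 1] 1 by (simp add: mult_2_right)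
    hence "fib (m * (0 + 2)) = (0 + 2) * A * B ^ (0 + 1) + ((0 + 2) choose 2) * A ^ 2 * B ^ 0 + A ^ 3 * 0"
      unfolding add_0 binomial_n_n by (simp add: algebra_simps power2_eq_square)
    moreover have "fib (m + m + 1) = (A + B) * (A + B) + A * A" using step2[of 1] 1 by simp
    hence "fib (m * (0 + 2) + 1) = B ^ (0 + 2) + (0 + 2) * A * B ^ (0 + 1) + A ^ 2 * 2"
      by (simp add: algebra_simps power2_eq_square)
    ultimately show ?case by blast
  next
    case (Suc k)
    then obtain u v where u: "fib (m * (k + 2)) = (k + 2) * A * B ^ (k + 1) + ((k + 2) choose 2) * A ^ 2 * B ^ k + A ^ 3 * u"
      and v: "fib (m * (k + 2) + 1) = B ^ (k + 2) + (k + 2) * A * B ^ (k + 1) + A ^ 2 * v" by blast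
    have idx: "m * (Suc k + 2) = m * (k + 2) + m" by simp
    have ch: "(Suc k + 2) choose 2 = (k + 2) + ((k + 2) choose 2)"
      by (simp add: numeral_2_eq_2)
    have "fib (m * (Suc k + 2)) = (Suc k + 2) * A * B ^ (Suc k + 1) + ((Suc k + 2) choose 2) * A ^ 2 * B ^ Suc k + A ^ 3 * (v + u * B)"
      unfolding idx step1 u v ch by (simp add: algebra_simps power2_eq_square power3_eq_cube)
    moreover
    define c where "c = ((k + 2) choose 2)"
    have "fib (m * (Suc k + 2) + 1) = B ^ (Suc k + 2) + (Suc k + 2) * A * B ^ (Suc k + 1) + A ^ 2 * 
       ((k + 2) * B ^ (k + 1) + v * (A + B) + (k+2) * B^(k+1) + c * A * B ^ k + A ^ 2 * u)"
      unfolding idx step2 u v c_def[symmetric] by (simp add: algebra_simps power2_eq_square power3_eq_cube)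
    ultimately show ?case by blast
  qed
qed

lemma coprime_fib_pred: "m > 0 \<Longrightarrow> coprime (fib m) (fib (m - 1))"
  using coprime_fib_Suc_nat[of "m - 1"] by (simp add: coprime_commute)

lemma not_dvd_fib_pred:
  assumes "prime p" "p dvd fib m" "m > 0"
  shows "\<not> p dvd fib (m - 1)"
  using assms coprime_fib_pred[of m] by (meson coprime_common_divisor not_prime_unit)

text \<open>Modulo p the cofactor of \<open>fib m\<close> in \<open>fib (m * q)\<close> is
  \<open>q * fib (m - 1) ^ (q - 1)\<close>, and p divides neither factor.\<close>

lemma multiplicity_fib_mult_other:
  assumes "prime p" "prime q" "p \<noteq> q" "p dvd fib m" "m > 0"
  shows "multiplicity p (fib (m * q)) = multiplicity p (fib m)"
proof -
  obtain k where k: "q = k + 2" using prime_ge_2_nat[OF assms(2)] by (metis add.commute le_Suc_ex)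
  obtain u where u: "fib (m * q) = q * fib m * fib (m - 1) ^ (k + 1) + (q choose 2) * fib m ^ 2 * fib (m - 1) ^ k + fib m ^ 3 * u"
    using fib_mult_expand[OF assms(5), of k] unfolding k by blast
  define R where "R = q * fib (m - 1) ^ (k + 1) + fib m * ((q choose 2) * fib (m - 1) ^ k + fib m * u)"
  have eq: "fib (m * q) = fib m * R"
    unfolding u R_def by (simp add: algebra_simps power2_eq_square power3_eq_cube)
  have "\<not> p dvd q * fib (m - 1) ^ (k + 1)"
    using assms not_dvd_fib_pred[OF assms(1,4,5)]
    by (metis prime_dvd_mult_iff prime_dvd_power primes_dvd_imp_eq)
  hence "\<not> p dvd R" unfolding R_def using assms(4)
    by (metis dvd_add_left_iff dvd_mult2)
  hence "multiplicity p R = 0" by (rule not_dvd_imp_multiplicity_0)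
  moreover have "R \<noteq> 0" using \<open>\<not> p dvd R\<close> by (metis dvd_0_right)
  moreover have "fib m \<noteq> 0" using fib_neq_0_nat[OF assms(5)] by simp
  ultimately show ?thesis
    unfolding eq using assms(1) by (simp add: prime_elem_multiplicity_mult_distrib)
qed

text \<open>The cofactor is p times a number congruent to a power of \<open>fib (m - 1)\<close>
  modulo p, provided p^2 divides \<open>(p choose 2) * fib m\<close>. For odd p both factors are
  multiples of p; for p = 2 the binomial is 1, whence the condition on 4. From
  \<open>fib 3 = 2\<close> to \<open>fib 6 = 8\<close> the exponent does jump by 2.\<close>

lemma multiplicity_fib_mult_self:
  assumes p: "prime p" and dvd: "p dvd fib m" and m: "m > 0" and two: "p = 2 \<Longrightarrow> 4 dvd fib m"
  shows "multiplicity p (fib (m * p)) = multiplicity p (fib m) + 1"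
proof -
  obtain k where k: "p = k + 2" using prime_ge_2_nat[OF p] by (metis add.commute le_Suc_ex)
  obtain u where u: "fib (m * p) = p * fib m * fib (m - 1) ^ (k + 1) + (p choose 2) * fib m ^ 2 * fib (m - 1) ^ k + fib m ^ 3 * u"
    using fib_mult_expand[OF m, of k] unfolding k by blast
  have "p * p dvd (p choose 2) * fib m"
  proof (cases "p = 2")
    case True
    then show ?thesis using two by simp
  next
    case False
    hence "p dvd (p choose 2)"
      using p prime_ge_2_nat[OF p] by (intro dvd_choose_prime) auto
    then show ?thesis using dvd by (rule mult_dvd_mono)
  qed
  then obtain c where c: "(p choose 2) * fib m = p * p * c" by blast
  obtain d where d: "fib m = p * d" using dvd by blast
  define R where "R = fib (m - 1) ^ (k + 1) + p * (c * fib (m - 1) ^ k + d * d * u)"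
  have "fib (m * p) = fib m * (p * fib (m - 1) ^ (k + 1) + ((p choose 2) * fib m) * fib (m - 1) ^ k + (p * d) * (p * d) * u)"
    unfolding u d[symmetric] by (simp add: algebra_simps power2_eq_square power3_eq_cube)
  also have "\<dots> = fib m * (p * R)" unfolding c R_def by (simp add: algebra_simps)
  finally have eq: "fib (m * p) = fib m * (p * R)" .
  have "\<not> p dvd fib (m - 1) ^ (k + 1)"
    using not_dvd_fib_pred[OF p dvd m] p by (metis prime_dvd_power)
  hence "\<not> p dvd R" unfolding R_def by (metis dvd_add_left_iff dvd_triv_left)
  hence "multiplicity p R = 0" by (rule not_dvd_imp_multiplicity_0)
  moreover have "R \<noteq> 0" using \<open>\<not> p dvd R\<close> by (metis dvd_0_right)
  moreover have "fib m \<noteq> 0" using fib_neq_0_nat[OF m] by simp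
  moreover have "p \<noteq> 0" "\<not> is_unit p" using p by auto
  ultimately show ?thesis
    unfolding eq using p by (simp add: prime_elem_multiplicity_mult_distrib)
qed

section \<open>The rank of apparition of a prime\<close>

definition fib_rank :: "nat \<Rightarrow> nat" where
  "fib_rank p = (LEAST k. k > 0 \<and> p dvd fib k)"

lemma fib_rank_props:
  assumes "k > 0" "p dvd fib k"
  shows fib_rank_pos: "fib_rank p > 0" and fib_rank_dvd_fib: "p dvd fib (fib_rank p)"
    and fib_rank_le: "fib_rank p \<le> k"
proof -
  show "fib_rank p > 0" "p dvd fib (fib_rank p)"
    using LeastI[of "\<lambda>k. k > 0 \<and> p dvd fib k" k] assms unfolding fib_rank_def by auto
  show "fib_rank p \<le> k"
    unfolding fib_rank_def by (rule Least_le) (use assms in auto)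
qed

lemma fib_dvd: "m dvd n \<Longrightarrow> fib m dvd fib n"
  by (metis fib_gcd gcd_dvd2 gcd_nat.absorb1)

lemma dvd_fib_iff_rank:
  assumes "k > 0" "p dvd fib k"
  shows "p dvd fib n \<longleftrightarrow> fib_rank p dvd n"
proof
  assume "p dvd fib n"
  hence "p dvd fib (gcd (fib_rank p) n)"
    using fib_rank_dvd_fib[OF assms] by (simp add: fib_gcd)
  moreover have "gcd (fib_rank p) n > 0" using fib_rank_pos[OF assms] by simp
  ultimately have "fib_rank p \<le> gcd (fib_rank p) n" by (rule fib_rank_le[rotated])
  thus "fib_rank p dvd n"
    using fib_rank_pos[OF assms] by (metis gcd_dvd1 gcd_dvd2 dvd_imp_le dual_order.antisym)
next
  assume "fib_rank p dvd n"
  thus "p dvd fib n" using fib_rank_dvd_fib[OF assms] fib_dvd dvd_trans by blast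
qed

text \<open>d'Ocagne's identity: lowering both indices by one flips the sign of the determinant. It
  serves twice, modulo p for the rank bound and over the reals for the convergence of consecutive
  quotients.\<close>

lemma fib_det: "a \<le> b \<Longrightarrow> int (fib (Suc a)) * int (fib b) - int (fib a) * int (fib (Suc b)) = (-1) ^ a * int (fib (b - a))"
proof (induction a arbitrary: b)
  case 0
  then show ?case by simp
next
  case (Suc a)
  then obtain b' where b: "b = Suc b'" "a \<le> b'" by (cases b) auto
  have "int (fib (Suc (Suc a))) * int (fib b) - int (fib (Suc a)) * int (fib (Suc b)) =
        - (int (fib (Suc a)) * int (fib b') - int (fib a) * int (fib (Suc b')))"
    unfolding b by (simp add: algebra_simps)
  then show ?case using Suc.IH[OF b(2)] b by simp
qed

text \<open>The ratios \<open>fib (k + 1) : fib k\<close> live on the projective line over the field with \<open>p\<close> elements,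
  so two of the first \<open>p + 1\<close> finite ones coincide.\<close>
lemma fib_rank_le_Suc:
  assumes p: "prime p"
  shows "\<exists>k. 0 < k \<and> k \<le> p + 1 \<and> p dvd fib k"
proof (rule ccontr)
  assume neg: "\<not> ?thesis"
  have p1: "p > 1" using p prime_gt_1_nat by blast
  have cop: "coprime (int (fib k)) (int p)" if "k \<in> {1..p+1}" for k
    using neg that p by (metis atLeastAtMost_iff coprime_int_iff less_eq_Suc_le One_nat_def prime_imp_coprime coprime_commute)
  have "\<exists>y. [int (fib k) * y = 1] (mod int p)" if "k \<in> {1..p+1}" for k
    using cop[OF that] by (simp add: cong_solve_coprime_int)
  then obtain iv where iv: "\<And>k. k \<in> {1..p+1} \<Longrightarrow> [int (fib k) * iv k = 1] (mod int p)" by metis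
  define r where "r = (\<lambda>k. (int (fib (Suc k)) * iv k) mod int p)"
  have "r ` {1..p+1} \<subseteq> {0..<int p}" using p1 by (auto simp: r_def)
  moreover have "card {0..<int p} < card {1..p+1}" by simp
  ultimately have "\<not> inj_on r {1..p+1}"
    by (metis card_inj_on_le finite_atLeastLessThan_int not_le)
  then obtain a' b' where "a' \<in> {1..p+1}" "b' \<in> {1..p+1}" "r a' = r b'" "a' \<noteq> b'" unfolding inj_on_def by blast
  then obtain a b where ab: "a \<in> {1..p+1}" "b \<in> {1..p+1}" "r a = r b" "a < b"
    by (metis nat_neq_iff)
  have "[int (fib (Suc a)) * iv a = int (fib (Suc b)) * iv b] (mod int p)"
    using ab(3) by (simp add: r_def cong_def)
  hence "[(int (fib (Suc a)) * iv a) * (int (fib a) * int (fib b)) = (int (fib (Suc b)) * iv b) * (int (fib a) * int (fib b))] (mod int p)"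
    by (rule cong_scalar_right)
  hence 1: "[int (fib (Suc a)) * int (fib b) * (int (fib a) * iv a) = int (fib a) * int (fib (Suc b)) * (int (fib b) * iv b)] (mod int p)"
    by (simp add: mult_ac)
  have 2: "[int (fib (Suc a)) * int (fib b) * (int (fib a) * iv a) = int (fib (Suc a)) * int (fib b) * 1] (mod int p)"
    by (intro cong_scalar_left iv ab)
  have 3: "[int (fib a) * int (fib (Suc b)) * (int (fib b) * iv b) = int (fib a) * int (fib (Suc b)) * 1] (mod int p)"
    by (intro cong_scalar_left iv ab)
  have "[int (fib (Suc a)) * int (fib b) = int (fib a) * int (fib (Suc b))] (mod int p)"
    using 1 2 3 by (metis cong_sym cong_trans mult.right_neutral)
  hence "int p dvd (-1) ^ a * int (fib (b - a))"
    using fib_det[of a b] ab(4) by (simp add: cong_iff_dvd_diff)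
  hence "int p dvd int (fib (b - a))"
    by (cases "even a") auto
  hence "p dvd fib (b - a)" by simp
  moreover have "0 < b - a" "b - a \<le> p + 1" using ab by auto
  ultimately show False using neg by blast
qed

lemma fib_rank_props':
  assumes "prime p"
  shows "fib_rank p > 0" "p dvd fib n \<longleftrightarrow> fib_rank p dvd n" "fib_rank p \<le> p + 1"
  using fib_rank_le_Suc[OF assms] fib_rank_pos dvd_fib_iff_rank fib_rank_le
  by (blast, blast, meson le_trans)

text \<open>Inclusion-exclusion over the prime divisors \<open>S\<close> of \<open>n\<close>: for \<open>f = ln \<circ> fib\<close> this is the logarithm of
  the homogeneous cyclotomic value \<open>\<Phi>\<^sub>n\<close> at the two roots of \<open>x\<^sup>2 = x + 1\<close>.\<close>
definition alt_sum :: "(nat \<Rightarrow> real) \<Rightarrow> nat \<Rightarrow> nat set \<Rightarrow> real" where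
  "alt_sum f n S = (\<Sum>T\<in>Pow S. (-1) ^ card T * f (n div \<Prod>T))"

text \<open>Subsets are split according to whether they contain \<open>q\<close>. If dividing the
  index by \<open>q\<close> does not change the values of \<open>f\<close>, the whole sum
  cancels.\<close>

lemma alt_sum_insert:
  assumes "finite S" "q \<notin> S"
  shows "alt_sum f n (insert q S) = alt_sum f n S - alt_sum f (n div q) S"
proof -
  have inj: "inj_on (insert q) (Pow S)" using assms by (auto simp: inj_on_def)
  have "alt_sum f n (insert q S) = alt_sum f n S + (\<Sum>T\<in>insert q ` Pow S. (-1) ^ card T * f (n div \<Prod>T))"
    unfolding alt_sum_def Pow_insert using assms by (subst sum.union_disjoint) auto
  also have "(\<Sum>T\<in>insert q ` Pow S. (-1) ^ card T * f (n div \<Prod>T)) =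
             (\<Sum>T\<in>Pow S. (-1) ^ card (insert q T) * f (n div \<Prod>(insert q T)))"
    using inj by (simp add: sum.reindex)
  also have "\<dots> = (\<Sum>T\<in>Pow S. - ((-1) ^ card T * f (n div q div \<Prod>T)))"
  proof (intro sum.cong refl)
    fix T assume T: "T \<in> Pow S"
    hence "finite T" "q \<notin> T" using assms finite_subset by auto
    thus "(-1) ^ card (insert q T) * f (n div \<Prod>(insert q T)) = - ((-1) ^ card T * f (n div q div \<Prod>T))"
      by (simp add: div_mult2_eq)
  qed
  also have "\<dots> = - alt_sum f (n div q) S" unfolding alt_sum_def by (simp add: sum_negf)
  finally show ?thesis by simp
qed

lemma alt_sum_add: "alt_sum (\<lambda>k. f k + g k) n S = alt_sum f n S + alt_sum g n S"
  unfolding alt_sum_def by (simp add: sum.distrib algebra_simps)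

lemma alt_sum_sum: "alt_sum (\<lambda>k. \<Sum>i\<in>I. c i * g i k) n S = (\<Sum>i\<in>I. c i * alt_sum (g i) n S)"
proof -
  have "alt_sum (\<lambda>k. \<Sum>i\<in>I. c i * g i k) n S = (\<Sum>T\<in>Pow S. \<Sum>i\<in>I. c i * ((-1) ^ card T * g i (n div \<Prod>T)))"
    unfolding alt_sum_def sum_distrib_left by (intro sum.cong refl) (simp add: mult_ac)
  also have "\<dots> = (\<Sum>i\<in>I. c i * alt_sum (g i) n S)"
    unfolding alt_sum_def sum_distrib_left by (rule sum.swap)
  finally show ?thesis .
qed

lemma alt_sum_const:
  assumes "finite S" "S \<noteq> {}"
  shows "alt_sum (\<lambda>_. c) n S = 0"
proof -
  obtain q S' where "S = insert q S'" "q \<notin> S'" using assms(2) by (metis Set.set_insert all_not_in_conv)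
  thus ?thesis using alt_sum_insert[of S' q "\<lambda>_. c" n] assms(1)
    by (simp add: alt_sum_def)
qed

lemma prod_prime_factors_dvd:
  assumes "(n::nat) > 0" "T \<subseteq> prime_factors n"
  shows "\<Prod>T dvd n"
proof -
  have fin: "finite T" using assms(2) finite_subset by blast
  have "\<Prod>T dvd (\<Prod>p\<in>T. p ^ multiplicity p n)"
    using assms by (intro prod_dvd_prod) (auto simp: prime_factors_multiplicity intro!: dvd_power)
  also have "\<dots> dvd (\<Prod>p\<in>prime_factors n. p ^ multiplicity p n)"
    by (intro prod_dvd_prod_subset) (use assms in auto)
  also have "\<dots> = n" using assms(1) by (simp add: prod_prime_factors)
  finally show ?thesis .
qed

text \<open>The product formula for the totient, multiplied out. It evaluates the linear part
  \<open>k * ln golden\<close> of Binet's formula, which is the main term.\<close>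

lemma alt_sum_totient:
  assumes "n > 0"
  shows "alt_sum real n (prime_factors n) = real (totient n)"
proof -
  have "real (totient n) = real n * (\<Prod>p\<in>prime_factors n. 1 - 1 / real p)" by (rule totient_formula2)
  also have "(\<Prod>p\<in>prime_factors n. 1 - 1 / real p) = (\<Sum>T\<in>Pow (prime_factors n). (-1) ^ card T * (\<Prod>p\<in>T. 1 / real p))"
    by (subst prod_diff_conv_sum) simp_all
  also have "real n * \<dots> = alt_sum real n (prime_factors n)"
    unfolding alt_sum_def sum_distrib_left
  proof (intro sum.cong refl)
    fix T assume "T \<in> Pow (prime_factors n)"
    hence "\<Prod>T dvd n" using assms prod_prime_factors_dvd by auto
    hence "real (n div \<Prod>T) = real n / real (\<Prod>T)" by (rule real_of_nat_div)
    thus "real n * ((-1) ^ card T * (\<Prod>p\<in>T. 1 / real p)) = (-1) ^ card T * real (n div \<Prod>T)"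
      by (simp add: prod_dividef)
  qed
  finally show ?thesis by simp
qed

text \<open>The squarefree number \<open>\<Prod>T\<close> has \<open>T\<close> as its set of prime
  factors. Distinct quotients allow the errors in Binet's formula to be summed over a set of
  exponents without repetition.\<close>

lemma inj_on_div_prod_primes:
  assumes "(n::nat) > 0"
  shows "inj_on (\<lambda>T. n div \<Prod>T) (Pow (prime_factors n))"
proof (rule inj_onI)
  fix T U assume T: "T \<in> Pow (prime_factors n)" and U: "U \<in> Pow (prime_factors n)" and eq: "n div \<Prod>T = n div \<Prod>U"
  have dvd: "\<Prod>T dvd n" "\<Prod>U dvd n" using T U assms prod_prime_factors_dvd by auto
  have "\<Prod>T = n div (n div \<Prod>T)" using dvd assms by (simp add: div_div_eq_right)
  also have "\<dots> = \<Prod>U" using dvd assms unfolding eq by (simp add: div_div_eq_right)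
  finally have PP: "\<Prod>T = \<Prod>U" .
  have pf: "prime_factors (\<Prod>V) = V" if "V \<in> Pow (prime_factors n)" for V
  proof -
    have fin: "finite V" using that finite_subset by auto
    have pr: "\<And>p. p \<in> V \<Longrightarrow> prime p" using that by auto
    have "prime_factors (\<Prod>V) = (\<Union>p\<in>V. prime_factors p)"
      using fin pr by (subst prime_factors_prod) (auto, metis not_prime_0)
    also have "\<dots> = (\<Union>p\<in>V. {p})" using pr by (intro SUP_cong) (simp_all add: prime_prime_factors)
    finally show ?thesis by simp
  qed
  show "T = U" using pf[OF T] pf[OF U] unfolding PP by (rule trans[OF sym])
qed

section \<open>Binet's formula and the size of the cyclotomic value\<close>

definition golden :: real where "golden = (1 + sqrt 5) / 2"

lemma golden_sq: "golden ^ 2 = golden + 1"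
  unfolding golden_def by (simp add: power2_eq_square field_simps)

lemma golden_bounds: "8/5 < golden" "golden < 13/8"
proof -
  have "sqrt ((11/5)^2) < sqrt 5" by (subst real_sqrt_less_iff) (simp add: power2_eq_square)
  thus "8/5 < golden" unfolding golden_def by simp
  have "sqrt 5 < sqrt ((9/4)^2)" by (subst real_sqrt_less_iff) (simp add: power2_eq_square)
  thus "golden < 13/8" unfolding golden_def by simp
qed

lemma fib_golden:
  "real (fib k) = golden ^ k * (1 - (- 1 / golden ^ 2) ^ k) / sqrt 5"
proof -
  have g: "golden > 0" using golden_bounds by simp
  have "(1 - sqrt 5) / 2 = - 1 / golden" 
  proof -
    have "golden * ((1 - sqrt 5) / 2) = - 1" unfolding golden_def by (simp add: algebra_simps)
    thus ?thesis using g by (subst eq_divide_eq) (simp add: mult.commute)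
  qed
  hence "((1 - sqrt 5) / 2) ^ k = (- 1 / golden) ^ k" by (rule arg_cong)
  moreover have "(- 1 / golden) ^ k = golden ^ k * (- 1 / golden ^ 2) ^ k"
    using g by (simp add: power2_eq_square flip: power_mult_distrib)
  ultimately show ?thesis
    using fib_closed_form[of k] unfolding golden_def[symmetric] by (simp only: right_diff_distrib mult_1_right)
qed

text \<open>Binet's correction is 1 - y with y = w or y = -w, where w = golden^(-2k). Since (1 +
  w)(1 - w) is at most 1, either sign gives a logarithm of absolute value at most -ln (1 -
  w).\<close>

lemma ln_fib_golden:
  assumes "k > 0"
  shows "ln (real (fib k)) = real k * ln golden + (- ln (sqrt 5)) + ln (1 - (- 1 / golden ^ 2) ^ k)"
    and "ln (1 - (- 1 / golden ^ 2) ^ k) \<le> - ln (1 - (1 / golden ^ 2) ^ k)"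
    and "ln (1 - (1 / golden ^ 2) ^ k) \<le> ln (1 - (- 1 / golden ^ 2) ^ k)"
    and "(1 / golden ^ 2) ^ k < 1"
proof -
  have g: "golden > 1" using golden_bounds by simp
  define w where "w = (1 / golden ^ 2) ^ k"
  have "1 / golden ^ 2 < 1" using g by (simp add: power_less_one_iff)
  hence w: "0 < w" "w < 1" using g assms unfolding w_def by (auto intro!: power_less_one_iff[THEN iffD2] simp del: power_one_over)
  show "(1 / golden ^ 2) ^ k < 1" using w by (simp add: w_def)
  have y: "(- 1 / golden ^ 2) ^ k = w \<or> (- 1 / golden ^ 2) ^ k = - w"
    unfolding w_def by (cases "even k") (auto simp: power_minus_odd power_minus_even simp flip: minus_divide_left)
  define y where "y = (- 1 / golden ^ 2) ^ k"
  have y': "y = w \<or> y = - w" using y by (simp add: y_def)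
  have ypos: "1 - y > 0" using y' w by auto
  show "ln (real (fib k)) = real k * ln golden + (- ln (sqrt 5)) + ln (1 - (- 1 / golden ^ 2) ^ k)"
    using g ypos unfolding fib_golden y_def[symmetric]
    by (simp add: ln_div ln_mult ln_realpow)
  have "(1 - y) * (1 - w) \<le> 1" using y' w by (auto simp: algebra_simps intro: mult_le_one)
  hence "ln ((1 - y) * (1 - w)) \<le> 0" using ypos w by (subst ln_le_zero_iff) auto
  thus "ln (1 - (- 1 / golden ^ 2) ^ k) \<le> - ln (1 - (1 / golden ^ 2) ^ k)"
    unfolding y_def[symmetric] w_def[symmetric] using ypos w by (simp add: ln_mult)
  show "ln (1 - (1 / golden ^ 2) ^ k) \<le> ln (1 - (- 1 / golden ^ 2) ^ k)"
    unfolding y_def[symmetric] w_def[symmetric] using y' w by (subst ln_le_cancel_iff) auto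
qed

text \<open>The constant -ln (sqrt 5) cancels because n has a prime divisor. The exponents in the
  corrections are distinct, so these total at least ln (1 - w - w^2 - ...) = ln (1 - 1/golden) = -2
  ln golden, independently of n.\<close>

lemma alt_sum_ln_fib_ge:
  assumes "n > 1"
  shows "alt_sum (\<lambda>k. ln (real (fib k))) n (prime_factors n) \<ge> (real (totient n) - 2) * ln golden"
proof -
  define S where "S = prime_factors n"
  define w where "w = 1 / golden ^ 2"
  define e where "e = (\<lambda>k. ln (1 - (- 1 / golden ^ 2) ^ k))"
  have g: "golden > 1" using golden_bounds by simp
  have w: "0 < w" "w < 1" using g by (auto simp: w_def power_less_one_iff)
  have fin: "finite S" by (simp add: S_def)
  have S0: "S \<noteq> {}" using assms by (auto simp: S_def prime_factorization_empty_iff)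
  have pos: "n div \<Prod>T > 0" if "T \<in> Pow S" for T
  proof -
    have "\<Prod>T dvd n" using that assms prod_prime_factors_dvd[of n T] by (auto simp: S_def)
    thus ?thesis using assms by (metis dvd_div_eq_0_iff gr0I not_one_less_zero)
  qed
  have "alt_sum (\<lambda>k. ln (real (fib k))) n S = alt_sum (\<lambda>k. real k * ln golden + (- ln (sqrt 5)) + e k) n S"
    unfolding alt_sum_def e_def using ln_fib_golden(1)[OF pos] by (intro sum.cong refl) simp
  also have "\<dots> = alt_sum (\<lambda>k. real k * ln golden) n S + alt_sum e n S"
    using alt_sum_const[OF fin S0] by (simp only: alt_sum_add)
  also have "alt_sum (\<lambda>k. real k * ln golden) n S = totient n * ln golden"
  proof -
    have "alt_sum (\<lambda>k. real k * ln golden) n S = alt_sum real n S * ln golden"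
      unfolding alt_sum_def sum_distrib_right by (simp only: mult.assoc)
    thus ?thesis using alt_sum_totient[of n] assms by (simp add: S_def)
  qed
  finally have A: "alt_sum (\<lambda>k. ln (real (fib k))) n S = totient n * ln golden + alt_sum e n S" .
  have "alt_sum e n S \<ge> - 2 * ln golden"
  proof -
    define D where "D = (\<lambda>T. n div \<Prod>T) ` Pow S"
    have D: "finite D" "\<And>k. k \<in> D \<Longrightarrow> k > 0" using fin pos by (auto simp: D_def)
    have inj: "inj_on (\<lambda>T. n div \<Prod>T) (Pow S)" using inj_on_div_prod_primes[of n] assms by (simp add: S_def)
    have w1: "w ^ k < 1" if "k > 0" for k using ln_fib_golden(4)[OF that] by (simp add: w_def)
    \<comment> \<open>The sign \<open>(-1) ^ card T\<close> is immaterial, because the correction is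
      bounded in both directions.\<close>
    have "(\<Sum>T\<in>Pow S. ln (1 - w ^ (n div \<Prod>T))) \<le> alt_sum e n S"
      unfolding alt_sum_def
    proof (rule sum_mono)
      fix T assume "T \<in> Pow S"
      from ln_fib_golden(2,3)[OF pos[OF this]]
      show "ln (1 - w ^ (n div \<Prod>T)) \<le> (- 1) ^ card T * e (n div \<Prod>T)"
        by (cases "even (card T)") (auto simp: e_def w_def)
    qed
    also have "(\<Sum>T\<in>Pow S. ln (1 - w ^ (n div \<Prod>T))) = (\<Sum>k\<in>D. ln (1 - w ^ k))"
      unfolding D_def using inj by (simp add: sum.reindex)
    also have "\<dots> = ln (\<Prod>k\<in>D. 1 - w ^ k)"
      using w1 D by (intro ln_prod[symmetric]) (auto simp: less_imp_neq)
    finally have 1: "ln (\<Prod>k\<in>D. 1 - w ^ k) \<le> alt_sum e n S" .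
    have "(\<Sum>k\<in>D. w ^ k) \<le> (\<Sum>k. w ^ (Suc k))"
    proof -
      have "(\<Sum>k\<in>D. w ^ k) = (\<Sum>k\<in>(\<lambda>k. k - 1) ` D. w ^ Suc k)"
      proof (subst sum.reindex)
        show "inj_on (\<lambda>k. k - 1) D" using D(2) by (intro inj_onI) (metis Suc_pred' One_nat_def)
        show "(\<Sum>k\<in>D. w ^ k) = sum ((\<lambda>k. w ^ Suc k) \<circ> (\<lambda>k. k - 1)) D"
          using D(2) by (intro sum.cong refl) (metis Suc_pred' One_nat_def comp_def)
      qed
      also have "\<dots> \<le> (\<Sum>k. w ^ (Suc k))"
        using w D by (intro sum_le_suminf) (auto intro!: summable_mult)
      finally show ?thesis .
    qed
    also have "(\<Sum>k. w ^ (Suc k)) = w / (1 - w)"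
      using w by (simp add: suminf_mult suminf_geometric)
    also have "w / (1 - w) = 1 / (golden ^ 2 - 1)"
      using g unfolding w_def by (simp add: field_simps)
    also have "golden ^ 2 - 1 = golden" by (simp add: golden_sq)
    finally have "1 - 1 / golden \<le> 1 - (\<Sum>k\<in>D. w ^ k)" by simp
    also have "\<dots> \<le> (\<Prod>k\<in>D. 1 - w ^ k)"
      using w w1 D by (intro Weierstrass_prod_ineq) (auto intro: less_imp_le)
    finally have "1 - 1 / golden \<le> (\<Prod>k\<in>D. 1 - w ^ k)" .
    moreover have "1 - 1 / golden = 1 / golden ^ 2"
      using g golden_sq by (simp add: field_simps power2_eq_square)
    ultimately have "ln (1 / golden ^ 2) \<le> ln (\<Prod>k\<in>D. 1 - w ^ k)"
      using g by (intro ln_mono) auto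
    moreover have "ln (1 / golden ^ 2) = - 2 * ln golden" using g by (simp add: ln_div ln_realpow)
    ultimately show ?thesis using 1 by simp
  qed
  thus ?thesis using A by (simp add: S_def algebra_simps)
qed

section \<open>Prime valuations of the cyclotomic value\<close>

lemma alt_sum_cong:
  assumes "\<And>T. T \<subseteq> S \<Longrightarrow> f (n div \<Prod>T) = g (m div \<Prod>T)"
  shows "alt_sum f n S = alt_sum g m S"
  unfolding alt_sum_def using assms by (intro sum.cong refl) auto

lemma prod_primes_coprime:
  assumes "finite T" "\<And>q. q \<in> T \<Longrightarrow> prime (q::nat)" "prime p" "p \<notin> T"
  shows "coprime p (\<Prod>T)"
  using assms by (intro prod_coprime_right) (metis primes_coprime)

text \<open>The valuation at p of Phi_n for a non-primitive p. Write n = z * m with z the rank of p.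
  A prime q other than p in m makes the sum cancel in pairs, since multiplying the index by q
  preserves the valuation. If m is a power of p, only \<open>v (fib n) - v (fib (n div p))\<close>
  survives, which is 1; the pair p = 2, n = 6, where it is 2, is excluded.\<close>

lemma alt_sum_multiplicity_fib:
  assumes n: "n > 0" and p: "prime p" and dvd: "p dvd fib n" and lt: "fib_rank p < n"
    and six: "\<not> (p = 2 \<and> n = 6)"
  shows "alt_sum (\<lambda>k. real (multiplicity p (fib k))) n (prime_factors n) =
         (if \<exists>j>0. n = fib_rank p * p ^ j then 1 else 0)"
proof -
  define z where "z = fib_rank p"
  define f where "f = (\<lambda>k. real (multiplicity p (fib k)))"
  define S where "S = prime_factors n"
  have z: "z > 0" "\<And>k. p dvd fib k \<longleftrightarrow> z dvd k" unfolding z_def using fib_rank_props'[OF p] by auto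
  have zn: "z dvd n" using z dvd by simp
  then obtain m where m: "n = z * m" by blast
  have m1: "m > 1" using lt n unfolding z_def[symmetric] m by (cases "m = 0"; cases "m = 1") auto
  have finS: "finite S" by (simp add: S_def)
  show ?thesis
  proof (cases "\<exists>q. prime q \<and> q dvd m \<and> q \<noteq> p")
    case True
    then obtain q where q: "prime q" "q dvd m" "q \<noteq> p" by blast
    have "q \<in> S" using q m n by (auto simp: S_def in_prime_factors_iff)
    define S' where "S' = S - {q}"
    have S: "S = insert q S'" "q \<notin> S'" "finite S'" using \<open>q \<in> S\<close> finS by (auto simp: S'_def)
    have "alt_sum f n S' = alt_sum f (n div q) S'"
    proof (rule alt_sum_cong)
      fix T assume T: "T \<subseteq> S'"
      have "finite T" using T S(3) by (rule finite_subset)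
      moreover have "\<And>r. r \<in> T \<Longrightarrow> prime r" using T by (auto simp: S_def S'_def)
      ultimately have cop: "coprime q (\<Prod>T)" using T S(2) q(1) by (intro prod_primes_coprime) auto
      have "\<Prod>(insert q T) dvd n"
        using T S n by (intro prod_prime_factors_dvd) (auto simp: S_def)
      hence "q * \<Prod>T dvd n" using T S \<open>finite T\<close> by (subst (asm) prod.insert) auto
      then obtain k where k: "n = q * \<Prod>T * k" by blast
      have k0: "k > 0" using n k by (cases k) auto
      have T0: "\<Prod>T > 0" using n k by (metis gr0I mult_eq_0_iff less_irrefl)
      have q0: "q > 0" using q prime_gt_0_nat by blast
      have 1: "n div \<Prod>T = k * q" using T0 unfolding k by (simp add: mult_ac)
      have 2: "n div q div \<Prod>T = k" using T0 q0 unfolding k by simp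
      \<comment> \<open>As q divides m = n / z, also z divides \<open>k * \<Prod>T\<close>;
        coprimality of q and \<open>\<Prod>T\<close> then brings z down to k.\<close>
      have iff: "z dvd k * q \<longleftrightarrow> z dvd k"
      proof
        assume a: "z dvd k * q"
        obtain m' where "m = q * m'" using q by blast
        hence "q * (\<Prod>T * k) = q * (z * m')" using k m by (simp only: mult_ac)
        hence "z dvd k * \<Prod>T" using q0 by (metis dvd_triv_left mult.commute nat_mult_eq_cancel1)
        hence "z dvd gcd (k * q) (k * \<Prod>T)" using a by simp
        also have "gcd (k * q) (k * \<Prod>T) = k" using cop by (simp add: gcd_mult_distrib_nat[symmetric])
        finally show "z dvd k" .
      qed simp
      show "f (n div \<Prod>T) = f (n div q div \<Prod>T)"
      proof (cases "z dvd k")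
        case True
        thus ?thesis unfolding 1 2 f_def using multiplicity_fib_mult_other[OF p q(1), of k] q(3) z k0 by auto
      next
        case False
        thus ?thesis unfolding 1 2 f_def using z iff by (simp add: not_dvd_imp_multiplicity_0)
      qed
    qed
    hence "alt_sum f n S = 0" unfolding S(1) using alt_sum_insert[OF S(3,2)] by simp
    moreover have "\<not> (\<exists>j>0. n = z * p ^ j)"
    proof
      assume "\<exists>j>0. n = z * p ^ j"
      then obtain j where "z * m = z * p ^ j" using m by auto
      hence "m = p ^ j" using z by simp
      thus False using q p by (metis prime_dvd_power primes_dvd_imp_eq)
    qed
    ultimately show ?thesis by (simp add: f_def S_def z_def)
  next
    case False
    have "prime_factors m \<subseteq> {p}" using False by (auto simp: in_prime_factors_iff)
    moreover have "prime_factors m \<noteq> {}" using m1 by (auto simp: prime_factorization_empty_iff)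
    ultimately have pm: "prime_factors m = {p}" by blast
    define j where "j = multiplicity p m"
    have mj: "m = p ^ j" using prod_prime_factors[of m] m1 pm by (simp add: j_def)
    have j: "j > 0" using mj m1 by (cases j) auto
    have "p \<in> S" using p m n mj j by (auto simp: S_def in_prime_factors_iff)
    define S' where "S' = S - {p}"
    have S: "S = insert p S'" "p \<notin> S'" "finite S'" using \<open>p \<in> S\<close> finS by (auto simp: S'_def)
    have p0: "p > 0" using p prime_gt_0_nat by blast
    have "alt_sum f n S = (\<Sum>T\<in>Pow S'. (-1) ^ card T * (f (n div \<Prod>T) - f (n div p div \<Prod>T)))"
      unfolding S(1) alt_sum_insert[OF S(3,2)] by (simp add: alt_sum_def sum_subtractf algebra_simps)
    also have "\<dots> = (\<Sum>T\<in>{{}}. (-1) ^ card T * (f (n div \<Prod>T) - f (n div p div \<Prod>T)))"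
    proof (intro sum.mono_neutral_right)
      show "finite (Pow S')" using S by simp
      show "\<forall>T\<in>Pow S' - {{}}. (-1) ^ card T * (f (n div \<Prod>T) - f (n div p div \<Prod>T)) = 0"
      proof
        fix T assume T: "T \<in> Pow S' - {{}}"
        have TS: "T \<subseteq> S'" using T by simp
        have T': "finite T" "\<And>r. r \<in> T \<Longrightarrow> prime r" using TS S(3) finite_subset[OF TS] by (auto simp: S_def S'_def)
        hence cop: "coprime p (\<Prod>T)" using TS S(2) p by (intro prod_primes_coprime) auto
        have Tn: "\<Prod>T dvd n" using T S n by (intro prod_prime_factors_dvd) (auto simp: S_def)
        have T0: "\<Prod>T \<noteq> 0" using Tn n by (metis dvd_0_left less_irrefl)
        obtain q where q: "q \<in> T" using T by blast
        \<comment> \<open>Otherwise \<open>\<Prod>T\<close> would divide m = p^j, although it is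
          coprime to p and not 1. Every nonempty \<open>T\<close> thus contributes only zero
          valuations.\<close>
        have "\<not> z dvd n div \<Prod>T"
        proof
          assume "z dvd n div \<Prod>T"
          hence "z * \<Prod>T dvd n" by (rule dvd_div_iff_mult[THEN iffD1, OF T0 Tn])
          hence "\<Prod>T dvd p ^ j" using z unfolding m mj by simp
          moreover have "coprime (p ^ j) (\<Prod>T)" using cop by simp
          ultimately have "\<Prod>T dvd 1" by (meson coprime_common_divisor dvd_refl)
          hence "\<Prod>T = 1" by simp
          moreover have "q dvd \<Prod>T" using dvd_prodI[OF T'(1) q, of "\<lambda>x. x"] by simp
          ultimately show False using T'(2)[OF q] by simp
        qed
        moreover have "\<not> z dvd n div p div \<Prod>T"
        proof
          assume a: "z dvd n div p div \<Prod>T"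
          have "n div p div \<Prod>T = n div \<Prod>T div p" by (metis div_mult2_eq mult.commute)
          moreover have "p dvd n div \<Prod>T"
          proof -
            have "p * \<Prod>T dvd n" using cop Tn \<open>p \<in> S\<close> by (intro divides_mult) (auto simp: S_def in_prime_factors_iff)
            thus ?thesis by (rule dvd_div_iff_mult[THEN iffD2, OF T0 Tn])
          qed
          ultimately have "z dvd n div \<Prod>T" using a by (metis dvd_div_mult_self dvd_mult2)
          thus False using \<open>\<not> z dvd n div \<Prod>T\<close> by simp
        qed
        ultimately show "(-1) ^ card T * (f (n div \<Prod>T) - f (n div p div \<Prod>T)) = 0"
          using z by (simp add: f_def not_dvd_imp_multiplicity_0)
      qed
    qed auto
    also have "\<dots> = f n - f (n div p)" by simp
    also have "\<dots> = 1"
    proof -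
      define k where "k = z * p ^ (j - 1)"
      have nk: "n = k * p" using j unfolding m mj k_def by (cases j) auto
      have k0: "k > 0" using nk n by (cases k) auto
      have pk: "p dvd fib k" using z by (simp add: k_def)
      \<comment> \<open>For p = 2 the rank is 3, so n = 3 * 2^j; excluding n = 6 gives j at least 2,
        so 6 divides k and \<open>fib 6 = 8\<close> divides \<open>fib k\<close>.\<close>
      have "4 dvd fib k" if "p = 2"
      proof -
        have "fib_rank 2 = 3"
        proof -
          have f3: "fib 3 = 2" by (simp add: numeral_3_eq_3)
          have "z dvd 3" using z(2)[of 3] that f3 by simp
          moreover have "z \<noteq> 1" using z(2)[of 1] that by auto
          moreover have "z \<le> 3" using \<open>z dvd 3\<close> by (rule dvd_imp_le) simp
          moreover have "z \<noteq> 2" using \<open>z dvd 3\<close> by auto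
          ultimately have "z = 3" using z(1) by linarith
          thus ?thesis using that by (simp add: z_def)
        qed
        hence z3: "z = 3" using that by (simp add: z_def)
        have "j \<noteq> 1" using six that z3 m mj by auto
        then obtain i where "j = Suc (Suc i)" using j by (metis gr0_conv_Suc One_nat_def not0_implies_Suc)
        hence "6 dvd k" using that z3 by (simp add: k_def)
        hence "fib 6 dvd fib k" by (rule fib_dvd)
        moreover have "fib 6 = 8" by (simp add: eval_nat_numeral)
        ultimately have "8 dvd fib k" by simp
        thus ?thesis by (rule dvd_trans[rotated]) simp
      qed
      from multiplicity_fib_mult_self[OF p pk k0 this]
      show ?thesis using p0 by (simp add: f_def nk)
    qed
    finally have "alt_sum f n S = 1" .
    moreover have "\<exists>j>0. n = z * p ^ j" using j m mj by blast
    ultimately show ?thesis by (simp add: f_def S_def z_def)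
  qed
qed

text \<open>The larger prime q divides the rank of p, which is at most p + 1. Hence q = p + 1, so p
  = 2 and q = 3, and 3 * 2^i = 4 * 3^j leaves only 12. This is where 12 becomes exceptional.\<close>

lemma rank_power_unique:
  assumes "prime p" "prime q" "p < q" "i > 0" "j > 0"
    and "n = fib_rank p * p ^ i" "n = fib_rank q * q ^ j"
  shows "n = 12"
proof -
  have "q dvd fib_rank p * p ^ i" using assms by (metis dvd_mult dvd_power)
  hence "q dvd fib_rank p"
    using assms by (metis prime_dvd_mult_iff prime_dvd_power primes_dvd_imp_eq less_irrefl)
  hence "q \<le> fib_rank p" using fib_rank_props'[OF assms(1)] by (simp add: dvd_imp_le)
  hence zp: "fib_rank p = p + 1" and qp: "q = p + 1" using fib_rank_props'(3)[OF assms(1)] assms(3) by auto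
  have p2: "p = 2"
  proof (rule ccontr)
    assume "p \<noteq> 2"
    hence "p > 2" "q > 2" using prime_ge_2_nat[OF assms(1)] qp by auto
    hence "odd p" "odd q" using assms(1,2) prime_odd_nat by auto
    thus False using qp by simp
  qed
  have q3: "q = 3" using qp p2 by simp
  have f4: "fib 4 = 3" by (simp add: eval_nat_numeral)
  have "fib_rank 3 dvd 4" using fib_rank_props'(2)[of 3 4] f4 by simp
  moreover have "\<not> fib_rank 3 dvd 2" using fib_rank_props'(2)[of 3 2] by simp
  moreover have "fib_rank 3 \<le> 4" using \<open>fib_rank 3 dvd 4\<close> by (simp add: dvd_imp_le)
  moreover have "fib_rank 3 \<noteq> 3" using \<open>fib_rank 3 dvd 4\<close> by auto
  moreover have "fib_rank 3 \<noteq> 0" "fib_rank 3 \<noteq> 1" "fib_rank 3 \<noteq> 2"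
    using \<open>fib_rank 3 dvd 4\<close> \<open>\<not> fib_rank 3 dvd 2\<close> by (metis dvd_0_left zero_neq_numeral, metis one_dvd, metis dvd_refl)
  ultimately have z3: "fib_rank 3 = 4" by linarith
  have eq: "3 * 2 ^ i = 4 * (3::nat) ^ j" using assms zp p2 q3 z3 by simp
  obtain j' where j': "j = Suc j'" using assms(5) gr0_implies_Suc by blast
  have eq': "2 ^ i = 4 * (3::nat) ^ j'" using eq unfolding j' by simp
  have "j' = 0"
  proof (rule ccontr)
    assume "j' \<noteq> 0"
    hence "(3::nat) dvd 2 ^ i" unfolding eq' by simp
    hence "(3::nat) dvd 2" using prime_dvd_power[of "3::nat" 2 i] by simp
    thus False by simp
  qed
  thus "n = 12" using assms(7) q3 z3 j' by simp
qed

section \<open>Carmichael's theorem for Fibonacci numbers\<close>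

text \<open>The threshold 7 is sharp: golden^4 is below 7.\<close>

lemma golden_power_gt: "x \<ge> 7 \<Longrightarrow> golden ^ (x - 2) > real x + 1"
proof (induction x rule: dec_induct)
  case base
  have "(8::real) < (8/5) ^ 5" by (simp add: eval_nat_numeral)
  also have "\<dots> < golden ^ 5" using golden_bounds by (intro power_strict_mono) auto
  finally show ?case by simp
next
  case (step x)
  obtain y where y: "x = y + 2" using step(1) le_Suc_ex[of 2 x] by (auto simp: add.commute)
  have "real x + 2 \<le> (8/5) * (real x + 1)" using step by simp
  also have "\<dots> < golden * golden ^ y" using golden_bounds step y by (intro mult_strict_mono) auto
  finally show ?case using y by simp
qed

text \<open>Without a primitive prime, Phi_n is 1 or a single prime p of the form n = rank * p^j.
  Then p divides n, so p is at most totient n + 1, which is less than the lower bound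
  golden^(totient n - 2).\<close>

lemma primitive_prime_if_totient_large:
  assumes tot: "totient n \<ge> 7" and n12: "n \<noteq> 12"
  shows "\<exists>p. prime p \<and> p dvd fib n \<and> (\<forall>m. 0 < m \<and> m < n \<longrightarrow> \<not> p dvd fib m)"
proof (rule ccontr)
  assume neg: "\<not> ?thesis"
  have n7: "n \<ge> 7" using tot totient_le[of n] by simp
  hence n: "n > 0" by simp
  define P where "P = prime_factors (fib n)"
  define S where "S = prime_factors n"
  have finP: "finite P" by (simp add: P_def)
  define sp where "sp = (\<lambda>p. \<exists>j>0. n = fib_rank p * p ^ j)"
  have lt: "fib_rank p < n" if "p \<in> P" for p
    using neg that fib_rank_le fib_rank_props'[of p] unfolding P_def in_prime_factors_iff
    by (metis le_less_trans)
  have "alt_sum (\<lambda>k. ln (real (fib k))) n S = alt_sum (\<lambda>k. \<Sum>p\<in>P. ln (real p) * real (multiplicity p (fib k))) n S"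
  proof (rule alt_sum_cong)
    fix T assume "T \<subseteq> S"
    hence "\<Prod>T dvd n" using n by (intro prod_prime_factors_dvd) (auto simp: S_def)
    then obtain k where k: "n = \<Prod>T * k" by blast
    have T0: "\<Prod>T > 0" using k n by (metis gr0I mult_eq_0_iff less_irrefl)
    have nk: "n div \<Prod>T = k" using T0 k by (simp)
    have k0: "k > 0" using k n by (cases k) auto
    have fk: "fib k dvd fib n" using k by (intro fib_dvd) simp
    have fn0: "fib n > 0" "fib k > 0" using fib_neq_0_nat n k0 by auto
    have "prime_factors (fib k) \<subseteq> P" unfolding P_def using fk fn0 by (intro dvd_prime_factors) auto
    have "real (fib k) = real (\<Prod>p\<in>prime_factors (fib k). p ^ multiplicity p (fib k))"
      using fn0 by (simp add: prod_prime_factors)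
    also have "(\<Prod>p\<in>prime_factors (fib k). p ^ multiplicity p (fib k)) = (\<Prod>p\<in>P. p ^ multiplicity p (fib k))"
      proof (intro prod.mono_neutral_left finP \<open>prime_factors (fib k) \<subseteq> P\<close> ballI)
      fix p assume p: "p \<in> P - prime_factors (fib k)"
      hence "prime p" by (auto simp: P_def)
      hence "multiplicity p (fib k) = 0" using p by (auto simp: prime_factors_multiplicity)
      thus "p ^ multiplicity p (fib k) = 1" by simp
    qed
    finally have "ln (real (fib k)) = ln (\<Prod>p\<in>P. real p ^ multiplicity p (fib k))" by simp
    also have "\<dots> = (\<Sum>p\<in>P. ln (real p ^ multiplicity p (fib k)))"
      by (intro ln_prod) (auto simp: P_def in_prime_factors_iff prime_gt_0_nat)
    also have "\<dots> = (\<Sum>p\<in>P. ln (real p) * real (multiplicity p (fib k)))"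
      by (intro sum.cong refl) (auto simp: P_def in_prime_factors_iff prime_gt_0_nat ln_realpow)
    finally show "ln (real (fib (n div \<Prod>T))) = (\<Sum>p\<in>P. ln (real p) * real (multiplicity p (fib (n div \<Prod>T))))"
      unfolding nk .
  qed
  also have "\<dots> = (\<Sum>p\<in>P. ln (real p) * alt_sum (\<lambda>k. real (multiplicity p (fib k))) n S)"
    by (rule alt_sum_sum)
  also have "\<dots> = (\<Sum>p\<in>P. ln (real p) * (if sp p then 1 else 0))"
  proof (intro sum.cong refl)
    fix p assume p: "p \<in> P"
    hence "prime p" "p dvd fib n" by (auto simp: P_def in_prime_factors_iff)
    from alt_sum_multiplicity_fib[OF n this lt[OF p]] n7
    show "ln (real p) * alt_sum (\<lambda>k. real (multiplicity p (fib k))) n S = ln (real p) * (if sp p then 1 else 0)"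
      unfolding S_def sp_def by auto
  qed
  also have "\<dots> = (\<Sum>p\<in>{p\<in>P. sp p}. ln (real p))"
    by (simp add: sum.If_cases P_def Int_def if_distrib cong: if_cong)
  finally have eq: "alt_sum (\<lambda>k. ln (real (fib k))) n S = (\<Sum>p\<in>{p\<in>P. sp p}. ln (real p))" .
  have ge: "(real (totient n) - 2) * ln golden \<le> (\<Sum>p\<in>{p\<in>P. sp p}. ln (real p))"
    using alt_sum_ln_fib_ge[of n] n7 eq by (simp add: S_def)
  have g: "golden > 1" using golden_bounds by simp
  have "real (totient n) + 1 < golden ^ (totient n - 2)" using golden_power_gt[OF tot] by simp
  hence "ln (real (totient n) + 1) < ln (golden ^ (totient n - 2))" by (subst ln_less_cancel_iff) auto
  also have "\<dots> = (real (totient n) - 2) * ln golden" using g tot by (simp add: ln_realpow of_nat_diff)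
  finally have lt1: "ln (real (totient n) + 1) < (\<Sum>p\<in>{p\<in>P. sp p}. ln (real p))" using ge by simp
  show False
  proof (cases "{p\<in>P. sp p} = {}")
    case True
    have "ln (real (totient n) + 1) \<ge> 0" by simp
    thus False using lt1 unfolding True by simp
  next
    case False
    then obtain p where p: "p \<in> P" "sp p" by blast
    have uniq: "q = p" if "q \<in> P" "sp q" for q
    proof (rule ccontr)
      assume "q \<noteq> p"
      moreover have "prime p" "prime q" using p that by (auto simp: P_def)
      ultimately show False using rank_power_unique[of p q] rank_power_unique[of q p] p that n12
        unfolding sp_def by (metis nat_neq_iff)
    qed
    have "{q\<in>P. sp q} = {p}" using p uniq by blast
    hence "ln (real (totient n) + 1) < ln (real p)" using lt1 by simp
    moreover have pp: "prime p" using p by (auto simp: P_def in_prime_factors_iff)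
    ultimately have "totient n + 1 < p" using prime_gt_0_nat[OF pp] by (subst (asm) ln_less_cancel_iff) auto
    moreover have "p dvd n" using p unfolding sp_def by auto
    hence "p - 1 \<le> totient n" using totient_dvd_mono[of p n] n totient_prime[OF pp] by simp
    ultimately show False by simp
  qed
qed

text \<open>Each prime power p^e exactly dividing n satisfies p^(e-1) (p - 1) <= 6. This leaves 2^3,
  3^2, 5 and 7 as maximal powers, with product 2520.\<close>

lemma totient_small_dvd:
  assumes "n > 0" "totient n \<le> 6"
  shows "n dvd 2520"
proof -
  have pw: "p ^ (e - 1) * (p - 1) \<le> 6" if "prime p" "e = multiplicity p n" "e > 0" for p e
  proof -
    have "p ^ e dvd n" using that(2) multiplicity_dvd by blast
    hence "totient (p ^ e) \<le> totient n" using assms by (intro totient_dvd_mono)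
    thus ?thesis using totient_prime_power[OF that(1,3)] assms by simp
  qed
  have bound: "multiplicity p n \<le> multiplicity p (2520::nat)" if "prime p" for p
  proof (cases "multiplicity p n = 0")
    case False
    define e where "e = multiplicity p n"
    have e: "e > 0" using False by (simp add: e_def)
    have le: "p ^ (e - 1) * (p - 1) \<le> 6" using pw[OF that e_def e] .
    have p0: "p > 1" using that prime_gt_1_nat by blast
    have "1 * (p - 1) \<le> p ^ (e - 1) * (p - 1)" using p0 by (intro mult_right_mono) auto
    hence "p - 1 \<le> 6" using le by linarith
    hence "p \<le> 7" by simp
    hence "p \<in> {2,3,4,5,6,7}" using p0 by auto
    moreover have "p \<noteq> 4" "p \<noteq> 6" using that by auto
    ultimately have p: "p \<in> {2,3,5,7}" by auto
    have dvd: "p ^ e dvd 2520"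
    proof -
      have small: "e - 1 \<le> k" if "p ^ Suc k * (p - 1) > 6" for k
      proof (rule ccontr)
        assume "\<not> ?thesis"
        hence "p ^ Suc k \<le> p ^ (e - 1)" using p0 by (intro power_increasing) auto
        hence "p ^ Suc k * (p - 1) \<le> p ^ (e - 1) * (p - 1)" by (rule mult_right_mono) simp
        thus False using le that by linarith
      qed
      consider "p = 2" | "p = 3" | "p = 5" | "p = 7" using p by blast
      thus ?thesis
      proof cases
        case 1
        hence "e \<le> 3" using small[of 2] by simp
        hence "p ^ e dvd p ^ 3" by (rule le_imp_power_dvd)
        also have "p ^ 3 dvd 2520" using 1 by simp
        finally show ?thesis .
      next
        case 2
        hence "e \<le> 2" using small[of 1] by simp
        hence "p ^ e dvd p ^ 2" by (rule le_imp_power_dvd)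
        also have "p ^ 2 dvd 2520" using 2 by simp
        finally show ?thesis .
      next
        case 3
        hence "e \<le> 1" using small[of 0] by simp
        hence "p ^ e dvd p ^ 1" by (rule le_imp_power_dvd)
        also have "p ^ 1 dvd 2520" using 3 by simp
        finally show ?thesis .
      next
        case 4
        hence "e \<le> 1" using small[of 0] by simp
        hence "p ^ e dvd p ^ 1" by (rule le_imp_power_dvd)
        also have "p ^ 1 dvd 2520" using 4 by simp
        finally show ?thesis .
      qed
    qed
    moreover have "\<not> is_unit p" using p0 by simp
    ultimately show ?thesis unfolding e_def[symmetric] by (intro multiplicity_geI) auto
  qed simp
  show ?thesis
    by (rule multiplicity_le_imp_dvd) (use assms bound in auto)
qed

text \<open>The totient is monotone under divisibility, so seven numbers of totient above 6 act as
  forbidden divisors among the divisors of 2520.\<close>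

lemma totient_small_cases:
  assumes "n > 0" "totient n \<le> 6"
  shows "n \<in> {1,2,3,4,5,6,7,8,9,10,12,14,18}"
proof -
  have d: "n dvd 2520" by (rule totient_small_dvd[OF assms])
  have no: "\<not> m dvd n" if "totient m > 6" for m
    using that totient_dvd_mono[OF _ assms(1), of m] assms(2) by auto
  have "totient 15 = 8" "totient 20 = 8" "totient 24 = 8" "totient 36 = 12" "totient 21 = 12" "totient 28 = 12" "totient 35 = 24"
    by code_simp+
  hence nd: "\<not> 15 dvd n" "\<not> 20 dvd n" "\<not> 24 dvd n" "\<not> 36 dvd n" "\<not> 21 dvd n" "\<not> 28 dvd n" "\<not> 35 dvd n"
    by (auto intro!: no)
  have "n dvd 8 * (9 * (5 * 7))" using d by simp
  then obtain x m where x: "n = x * m" "x dvd 8" and m: "m dvd 9 * (5 * 7)" by (rule dvd_productE)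
  from m obtain y m' where y: "m = y * m'" "y dvd 9" and m': "m' dvd 5 * 7" by (rule dvd_productE)
  from m' obtain z w where z: "m' = z * w" "z dvd 5" and w: "w dvd 7" by (rule dvd_productE)
  have "x \<le> 8" "x \<noteq> 0" using x(2) dvd_imp_le[OF x(2)] by (auto intro!: Nat.gr0I)
  hence "x \<in> {1,2,3,4,5,6,7,8}" by auto
  hence "x \<in> {1,2,4,8}" using x(2) by auto
  moreover have "y \<le> 9" "y \<noteq> 0" using y(2) dvd_imp_le[OF y(2)] by (auto intro!: Nat.gr0I)
  hence "y \<in> {1,2,3,4,5,6,7,8,9}" by auto
  hence "y \<in> {1,3,9}" using y(2) by auto
  moreover have "z \<le> 5" "z \<noteq> 0" using z(2) dvd_imp_le[OF z(2)] by (auto intro!: Nat.gr0I)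
  hence "z \<in> {1,2,3,4,5}" by auto
  hence "z \<in> {1,5}" using z(2) by auto
  moreover have "w \<le> 7" "w \<noteq> 0" using w dvd_imp_le[OF w] by (auto intro!: Nat.gr0I)
  hence "w \<in> {1,2,3,4,5,6,7}" by auto
  hence "w \<in> {1,7}" using w by auto
  moreover have "n = x * (y * (z * w))" using x y z by simp
  ultimately show ?thesis using nd by (elim insertE emptyE) (simp_all del: One_nat_def)
qed

definition fib_prim :: "nat \<Rightarrow> nat \<Rightarrow> bool" where
  "fib_prim n p \<longleftrightarrow> prime p \<and> p dvd fib n \<and> (\<forall>m. 0 < m \<and> m < n \<longrightarrow> \<not> p dvd fib m)"

lemma fib_values:
  shows "fib 3 = 2" "fib 4 = 3" "fib 5 = 5" "fib 6 = 8" "fib 7 = 13" "fib 8 = 21" "fib 9 = 34" "fib 10 = 55" "fib 11 = 89" "fib 12 = 144" "fib 13 = 233" "fib 14 = 377" "fib 15 = 610" "fib 16 = 987" "fib 17 = 1597" "fib 18 = 2584"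
proof -
  show f3: "fib 3 = 2" by (simp add: eval_nat_numeral)
  show f4: "fib 4 = 3" using fib_plus_2[of 2] f3 by simp
  show f5: "fib 5 = 5" using fib_plus_2[of 3] f4 f3 by simp
  show f6: "fib 6 = 8" using fib_plus_2[of 4] f5 f4 by simp
  show f7: "fib 7 = 13" using fib_plus_2[of 5] f6 f5 by simp
  show f8: "fib 8 = 21" using fib_plus_2[of 6] f7 f6 by simp
  show f9: "fib 9 = 34" using fib_plus_2[of 7] f8 f7 by simp
  show f10: "fib 10 = 55" using fib_plus_2[of 8] f9 f8 by simp
  show f11: "fib 11 = 89" using fib_plus_2[of 9] f10 f9 by simp
  show f12: "fib 12 = 144" using fib_plus_2[of 10] f11 f10 by simp
  show f13: "fib 13 = 233" using fib_plus_2[of 11] f12 f11 by simp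
  show f14: "fib 14 = 377" using fib_plus_2[of 12] f13 f12 by simp
  show f15: "fib 15 = 610" using fib_plus_2[of 13] f14 f13 by simp
  show f16: "fib 16 = 987" using fib_plus_2[of 14] f15 f14 by simp
  show f17: "fib 17 = 1597" using fib_plus_2[of 15] f16 f15 by simp
  show f18: "fib 18 = 2584" using fib_plus_2[of 16] f17 f16 by simp
qed

lemma fib_prim_check:
  assumes "prime p" "p dvd fib n" "list_all (\<lambda>m. \<not> p dvd fib m) [2..<n]"
  shows "fib_prim n p"
  unfolding fib_prim_def
proof (intro conjI allI impI assms(1,2))
  fix m assume m: "0 < m \<and> m < n"
  show "\<not> p dvd fib m"
  proof (cases "m = 1")
    case True
    thus ?thesis using assms(1) by auto
  next
    case False
    thus ?thesis using m assms(3) by (auto simp: list_all_iff)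
  qed
qed

text \<open>Totient at most 6 leaves nine indices, each with an explicit primitive prime.\<close>

theorem carmichael_fib:
  assumes "n \<ge> 3" "n \<noteq> 6" "n \<noteq> 12"
  shows "\<exists>p. fib_prim n p"
proof (cases "totient n \<ge> 7")
  case True
  thus ?thesis using primitive_prime_if_totient_large[OF True assms(3)] by (auto simp: fib_prim_def)
next
  case False
  hence "n \<in> {3,4,5,7,8,9,10,14,18}" using totient_small_cases[of n] assms by auto
  moreover have "\<exists>p. fib_prim 3 p" by (rule exI[of _ 2], rule fib_prim_check) (simp_all add: fib_values)
  moreover have "\<exists>p. fib_prim 4 p" by (rule exI[of _ 3], rule fib_prim_check) (simp_all add: fib_values)
  moreover have "\<exists>p. fib_prim 5 p" by (rule exI[of _ 5], rule fib_prim_check) (simp_all add: fib_values)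
  moreover have "\<exists>p. fib_prim 7 p" by (rule exI[of _ 13], rule fib_prim_check) (simp_all add: fib_values)
  moreover have "\<exists>p. fib_prim 8 p" by (rule exI[of _ 7], rule fib_prim_check) (simp_all add: fib_values)
  moreover have "\<exists>p. fib_prim 9 p" by (rule exI[of _ 17], rule fib_prim_check) (simp_all add: fib_values)
  moreover have "\<exists>p. fib_prim 10 p" by (rule exI[of _ 11], rule fib_prim_check) (simp_all add: fib_values)
  moreover have "\<exists>p. fib_prim 14 p" by (rule exI[of _ 29], rule fib_prim_check) (simp_all add: fib_values)
  moreover have "\<exists>p. fib_prim 18 p" by (rule exI[of _ 19], rule fib_prim_check) (simp_all add: fib_values)
  ultimately show ?thesis by auto
qed

text \<open>The exponents vanish one by one, starting from the largest index, because of its primitive prime.\<close>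
lemma ln_fib_independent:
  fixes c :: "nat \<Rightarrow> int"
  assumes "finite A" "\<And>n. n \<in> A \<Longrightarrow> n \<ge> 3 \<and> n \<noteq> 6 \<and> n \<noteq> 12"
    and "(\<Sum>n\<in>A. of_int (c n) * ln (real (fib n))) = 0"
  shows "\<forall>n\<in>A. c n = 0"
  using assms
proof (induction A rule: finite_linorder_max_induct)
  case (insert n A)
  obtain p where p: "prime p" "p dvd fib n" "\<And>m. 0 < m \<Longrightarrow> m < n \<Longrightarrow> \<not> p dvd fib m"
    using carmichael_fib[of n] insert.prems(1)[of n] unfolding fib_prim_def by auto
  have nA: "n \<notin> A" using insert.hyps by auto
  define I where "I = insert n A"
  have finI: "finite I" using insert.hyps by (simp add: I_def)
  have pos: "real (fib k) > 0" if "k \<in> I" for k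
    using insert.prems(1)[of k] that fib_neq_0_nat[of k] by (force simp: I_def)
  \<comment> \<open>Positive and negative coefficients are separated, so that the linear relation
    becomes an equality \<open>X = Y\<close> of natural numbers, to which divisibility by the
    primitive prime applies.\<close>
  define X where "X = (\<Prod>k\<in>I. fib k ^ nat (c k))"
  define Y where "Y = (\<Prod>k\<in>I. fib k ^ nat (- c k))"
  have lnX: "ln (real X) = (\<Sum>k\<in>I. of_int (int (nat (c k))) * ln (real (fib k)))"
    unfolding X_def of_nat_prod of_nat_power using finI pos
    by (subst ln_prod) (auto simp: ln_realpow intro!: sum.cong)
  have lnY: "ln (real Y) = (\<Sum>k\<in>I. of_int (int (nat (- c k))) * ln (real (fib k)))"
    unfolding Y_def of_nat_prod of_nat_power using finI pos
    by (subst ln_prod) (auto simp: ln_realpow intro!: sum.cong)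
  have "ln (real X) - ln (real Y) = (\<Sum>k\<in>I. of_int (c k) * ln (real (fib k)))"
    unfolding lnX lnY sum_subtractf[symmetric] by (intro sum.cong refl) (auto simp: algebra_simps)
  hence "ln (real X) = ln (real Y)" using insert.prems(2) by (simp add: I_def)
  moreover have "X > 0" "Y > 0" using pos by (auto simp: X_def Y_def intro!: prod_pos)
  ultimately have XY: "X = Y" by simp
  have ndA: "\<not> p dvd fib k" if "k \<in> A" for k
    using p(3)[of k] insert.hyps that insert.prems(1)[of k] by force
  have "c n = 0"
  proof (rule ccontr)
    assume cn: "c n \<noteq> 0"
    show False
    proof (cases "c n > 0")
      case True
      hence "p dvd X" unfolding X_def I_def using nA insert.hyps p(2) cn by (simp add: dvd_power_iff dvd_mult2 dvd_trans[OF p(2) dvd_power])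
      hence "p dvd Y" using XY by simp
      then obtain k where "k \<in> I" "p dvd fib k ^ nat (- c k)"
        unfolding Y_def using p(1) finI by (auto simp: prime_dvd_prod_iff)
      moreover from this have "k \<noteq> n" using True p(1) by auto
      ultimately show False using ndA p(1) by (auto simp: I_def dest: prime_dvd_power)
    next
      case False
      hence neg: "c n < 0" using cn by simp
      hence "p dvd Y" unfolding Y_def I_def using nA insert.hyps p(2) by (simp add: dvd_mult2 dvd_trans[OF p(2) dvd_power])
      hence "p dvd X" using XY by simp
      then obtain k where "k \<in> I" "p dvd fib k ^ nat (c k)"
        unfolding X_def using p(1) finI by (auto simp: prime_dvd_prod_iff)
      moreover from this have "k \<noteq> n" using neg p(1) by auto
      ultimately show False using ndA p(1) by (auto simp: I_def dest: prime_dvd_power)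
    qed
  qed
  moreover have "\<forall>k\<in>A. c k = 0"
    using insert.prems calculation nA insert.hyps by (intro insert.IH) auto
  ultimately show ?case by simp
qed simp

section \<open>The Fibonacci zeta function\<close>

definition fpow :: "nat \<Rightarrow> real \<Rightarrow> real" where
  "fpow n \<sigma> = real (fib (Suc n)) powr (- \<sigma>)"

text \<open>Coefficients of modulus at most 1 cover \<open>Z_F\<close>, its vertical translates and
  the limiting sign patterns at once, so that holomorphy and uniform estimates are proved only
  once.\<close>

definition fib_series :: "(nat \<Rightarrow> complex) \<Rightarrow> complex \<Rightarrow> complex" where
  "fib_series w s = (\<Sum>n. w n * of_nat (fib (Suc n)) powr (- s))"

lemma fib_Suc_pos: "fib (Suc n) > 0" by (simp add: fib_neq_0_nat)

lemma fib_Suc_ge_1: "real (fib (Suc n)) \<ge> 1" using fib_Suc_pos[of n] by linarith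

lemma fib_Suc_ge_power: "(3/2) ^ n / 2 \<le> real (fib (Suc n))"
proof (induction n rule: fib.induct)
  case (3 n)
  have "(3/2 :: real) ^ Suc (Suc n) / 2 \<le> (3/2) ^ Suc n / 2 + (3/2) ^ n / 2" by simp
  with 3 show ?case by (simp del: power_Suc)
qed auto

lemma fpow_pos: "fpow n \<sigma> > 0"
  unfolding fpow_def using fib_Suc_pos[of n] by simp

lemma fpow_antimono: "\<sigma> \<le> \<tau> \<Longrightarrow> fpow n \<tau> \<le> fpow n \<sigma>"
  unfolding fpow_def using fib_Suc_ge_1[of n] by (intro powr_mono) auto

lemma fpow_le_geometric:
  assumes "\<sigma> > 0"
  shows "fpow n \<sigma> \<le> 2 powr \<sigma> * ((3/2) powr (- \<sigma>)) ^ n"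
proof -
  have "fpow n \<sigma> \<le> ((3/2) ^ n / 2) powr (- \<sigma>)"
    unfolding fpow_def using fib_Suc_ge_power[of n] assms by (intro powr_mono2') auto
  also have "\<dots> = ((3/2) ^ n) powr (- \<sigma>) / 2 powr (- \<sigma>)" by (rule powr_divide)
  also have "((3/2 :: real) ^ n) powr (- \<sigma>) = ((3/2) powr (- \<sigma>)) ^ n"
    by (simp add: powr_realpow[symmetric] powr_powr mult.commute)
  also have "\<dots> / 2 powr (- \<sigma>) = 2 powr \<sigma> * ((3/2) powr (- \<sigma>)) ^ n"
    by (simp add: powr_minus field_simps)
  finally show ?thesis .
qed

lemma summable_fpow: "\<sigma> > 0 \<Longrightarrow> summable (\<lambda>n. fpow n \<sigma>)"
proof (rule summable_comparison_test'[where N = 0])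
  assume s: "\<sigma> > 0"
  show "summable (\<lambda>n. 2 powr \<sigma> * ((3/2) powr (- \<sigma>)) ^ n)"
    using s by (intro summable_mult summable_geometric) (simp add: powr_less_one)
  show "norm (fpow n \<sigma>) \<le> 2 powr \<sigma> * ((3/2) powr (- \<sigma>)) ^ n" for n
    using fpow_le_geometric[OF s] fpow_pos[of n \<sigma>] by simp
qed

lemma norm_fib_powr: "norm (of_nat (fib (Suc n)) powr (- s) :: complex) = fpow n (Re s)"
  unfolding fpow_def using fib_Suc_pos[of n]
  by (subst norm_powr_real_powr) auto

lemma norm_fib_term_le:
  assumes "norm (w n) \<le> 1" "\<delta> \<le> Re s"
  shows "norm (w n * of_nat (fib (Suc n)) powr (- s)) \<le> fpow n \<delta>"
proof -
  have "norm (w n * of_nat (fib (Suc n)) powr (- s)) \<le> 1 * fpow n (Re s)"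
    unfolding norm_mult norm_fib_powr using assms fpow_pos[of n "Re s"] by (intro mult_right_mono) auto
  also have "\<dots> \<le> fpow n \<delta>" using fpow_antimono[OF assms(2)] by simp
  finally show ?thesis .
qed

lemma summable_fib_series:
  assumes "\<And>n. norm (w n) \<le> 1" "Re s > 0"
  shows "summable (\<lambda>n. w n * of_nat (fib (Suc n)) powr (- s))"
proof (rule summable_comparison_test'[OF summable_fpow[OF assms(2)], where N = 0])
  show "norm (w n * of_nat (fib (Suc n)) powr (- s)) \<le> fpow n (Re s)" for n
    by (rule norm_fib_term_le) (use assms in auto)
qed

lemma uniform_limit_fib_series:
  assumes "\<And>n. norm (w n) \<le> 1" "\<delta> > 0"
  shows "uniform_limit {s. \<delta> \<le> Re s} (\<lambda>N s. \<Sum>n<N. w n * of_nat (fib (Suc n)) powr (- s)) (fib_series w) sequentially"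
  unfolding fib_series_def
proof (rule Weierstrass_m_test)
  show "norm (w n * of_nat (fib (Suc n)) powr (- s)) \<le> fpow n \<delta>" if "s \<in> {s. \<delta> \<le> Re s}" for n s
    by (rule norm_fib_term_le) (use assms that in auto)
qed (rule summable_fpow[OF assms(2)])

lemma holomorphic_fib_series:
  assumes "\<And>n. norm (w n) \<le> 1"
  shows "fib_series w holomorphic_on {s. Re s > 0}"
proof (rule holomorphic_uniform_sequence)
  show "open {s. Re s > 0}" by (rule open_halfspace_Re_gt)
  show "(\<lambda>s. \<Sum>n<N. w n * of_nat (fib (Suc n)) powr (- s)) holomorphic_on {s. Re s > 0}" for N
    by (intro holomorphic_intros) (use fib_Suc_pos in auto)
  fix x :: complex assume x: "x \<in> {s. Re s > 0}"
  define d where "d = Re x / 2"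
  have d: "d > 0" using x by (simp add: d_def)
  have sub: "cball x d \<subseteq> {s. d \<le> Re s}"
  proof
    fix s assume "s \<in> cball x d"
    hence "\<bar>Re (x - s)\<bar> \<le> d" using abs_Re_le_cmod[of "x - s"] by (simp add: dist_norm)
    hence "Re x - Re s \<le> d" by (simp add: abs_le_iff)
    thus "s \<in> {s. d \<le> Re s}" by (simp add: d_def)
  qed
  show "\<exists>d>0. cball x d \<subseteq> {s. 0 < Re s} \<and>
      uniform_limit (cball x d) (\<lambda>N s. \<Sum>n<N. w n * of_nat (fib (Suc n)) powr (- s)) (fib_series w) sequentially"
    using d sub uniform_limit_on_subset[OF uniform_limit_fib_series[OF assms d] sub] by (intro exI[of _ d]) force
qed

lemma Z_F_eq: "Z_F = fib_series (\<lambda>_. 1)"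
  by (auto simp: Z_F_def fib_series_def)

lemma fib_powr_polar:
  "(of_nat (fib (Suc n)) powr (- s) :: complex) = of_real (fpow n (Re s)) * cis (- (Im s * ln (fib (Suc n))))"
proof -
  have "(of_nat (fib (Suc n)) :: complex) = of_real (real (fib (Suc n)))" by simp
  hence "(of_nat (fib (Suc n)) powr (- s) :: complex) = exp (- s * of_real (ln (fib (Suc n))))"
    unfolding powr_def using fib_Suc_pos[of n] by (simp add: Ln_of_real)
  also have "\<dots> = of_real (exp (- Re s * ln (fib (Suc n)))) * cis (- (Im s * ln (fib (Suc n))))"
    by (subst exp_eq_polar) simp
  also have "exp (- Re s * ln (fib (Suc n))) = fpow n (Re s)"
    unfolding fpow_def powr_def using fib_Suc_pos[of n] by simp
  finally show ?thesis .
qed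

section \<open>The real equation for the critical abscissa\<close>

definition Gsum :: "real \<Rightarrow> real" where
  "Gsum \<sigma> = (\<Sum>n. fpow n \<sigma>) - 2 * fpow 11 \<sigma>"

lemma fib_12: "fib (Suc 11) = 144" by (simp add: fib_values)

lemma Z_F_of_real: "\<sigma> > 0 \<Longrightarrow> Z_F (of_real \<sigma>) = of_real (\<Sum>n. fpow n \<sigma>)"
  unfolding Z_F_def fib_powr_polar
  using suminf_of_real[OF summable_fpow[of \<sigma>], where 'a = complex] by simp

lemma H_F_eq: "\<sigma> > 0 \<Longrightarrow> H_F \<sigma> = of_real (Gsum \<sigma> - 4)"
proof -
  assume s: "\<sigma> > 0"
  have "(144 :: complex) powr (- of_real \<sigma>) = of_real (144 powr (- \<sigma>))"
    using powr_of_real[of 144 "- \<sigma>"] by simp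
  thus ?thesis unfolding H_F_def Z_F_of_real[OF s] Gsum_def fpow_def fib_12 by simp
qed

text \<open>In \<open>Gsum\<close> the term of 144 has coefficient -1 and so increases. The terms of
  55 and 89 outweigh it because ln 144 < ln 55 + ln 89.\<close>

lemma fpow_three_strict_antimono:
  assumes "\<sigma> < \<tau>" "0 \<le> \<sigma>"
  shows "55 powr (- \<tau>) + 89 powr (- \<tau>) - 144 powr (- \<tau>) < 55 powr (- \<sigma>) + 89 powr (- \<sigma>) - 144 powr (- \<sigma> :: real)"
proof (rule DERIV_neg_imp_decreasing[OF assms(1)])
  fix x assume x: "\<sigma> \<le> x" "x \<le> \<tau>"
  let ?d = "- ln 55 * 55 powr (- x) - ln 89 * 89 powr (- x) + ln 144 * 144 powr (- x :: real)"
  have "((\<lambda>x. 55 powr (- x) + 89 powr (- x) - 144 powr (- x)) has_real_derivative ?d) (at x)"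
    by (auto intro!: derivative_eq_intros)
  moreover have "?d < 0"
  proof -
    have p: "144 powr (- x) \<le> 55 powr (- x)" "144 powr (- x) \<le> 89 powr (- x)"
      using x assms by (auto intro!: powr_mono2')
    have "ln (144::real) < ln (55 * 89)" by (subst ln_less_cancel_iff) auto
    also have "\<dots> = ln 55 + ln 89" by (rule ln_mult_pos) auto
    finally have "ln 144 * 144 powr (- x) < (ln 55 + ln 89) * 144 powr (- x :: real)"
      by (intro mult_strict_right_mono) auto
    also have "\<dots> \<le> ln 55 * 55 powr (- x) + ln 89 * 89 powr (- x)"
      using p by (auto simp: distrib_right intro!: add_mono mult_left_mono)
    finally show ?thesis by simp
  qed
  ultimately show "\<exists>y. ((\<lambda>x. 55 powr (- x) + 89 powr (- x) - 144 powr (- x)) has_real_derivative y) (at x) \<and> y < 0" by blast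
qed

text \<open>With 144 compensated by 55 and 89, the whole decrease of the term of 2 remains. This
  explicit rate later turns a bound on the value of \<open>Gsum\<close> into one on the position of
  its crossing with 4.\<close>

lemma Gsum_diff_gt:
  assumes "0 < \<sigma>" "\<sigma> < \<tau>"
  shows "Gsum \<sigma> - Gsum \<tau> > 2 powr (- \<sigma>) - 2 powr (- \<tau>)"
proof -
  have sm: "summable (\<lambda>n. fpow n \<sigma> - fpow n \<tau>)"
    using assms by (intro summable_diff summable_fpow) auto
  have "(\<Sum>n\<in>{2,9,10,11}. fpow n \<sigma> - fpow n \<tau>) \<le> (\<Sum>n. fpow n \<sigma> - fpow n \<tau>)"
    using assms by (intro sum_le_suminf sm) (auto intro: fpow_antimono)
  also have "\<dots> = (\<Sum>n. fpow n \<sigma>) - (\<Sum>n. fpow n \<tau>)"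
    using assms by (intro suminf_diff[symmetric] summable_fpow) auto
  finally show ?thesis
    using fpow_three_strict_antimono[OF assms(2)] assms(1) unfolding Gsum_def fpow_def by (simp add: fib_values)
qed

lemma Gsum_strict_antimono: "0 < \<sigma> \<Longrightarrow> \<sigma> < \<tau> \<Longrightarrow> Gsum \<tau> < Gsum \<sigma>"
proof -
  assume *: "0 < \<sigma>" "\<sigma> < \<tau>"
  hence "2 powr (- \<tau>) \<le> (2 powr (- \<sigma>) :: real)" by (intro powr_mono) auto
  thus ?thesis using Gsum_diff_gt[OF *] by linarith
qed

lemma continuous_on_Gsum: "continuous_on {0<..} Gsum"
proof -
  have "continuous_on {s. Re s > 0} Z_F"
    unfolding Z_F_eq by (intro holomorphic_on_imp_continuous_on holomorphic_fib_series) simp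
  hence "continuous_on {0<..} (\<lambda>x. Z_F (of_real x))"
    by (rule continuous_on_compose2) (auto intro!: continuous_intros)
  hence "continuous_on {0<..} (\<lambda>x. Re (Z_F (of_real x)) - 2 * fpow 11 x)"
    unfolding fpow_def by (intro continuous_intros) (auto simp: fib_values)
  thus ?thesis
    by (rule continuous_on_eq) (auto simp: Gsum_def Z_F_of_real)
qed

text \<open>A Lipschitz bound: each difference is at most (sigma - beta) x^(-beta) ln x, and ln x <=
  2 sqrt x leaves exponent at most -1/10, for which the series still converges.\<close>

lemma Gsum_diff_le:
  assumes "6/10 \<le> \<beta>" "\<beta> \<le> \<sigma>"
  shows "Gsum \<beta> - Gsum \<sigma> \<le> (2 * (\<Sum>n. fpow n (1/10))) * (\<sigma> - \<beta>)"
proof -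
  have term_le: "fpow n \<beta> - fpow n \<sigma> \<le> 2 * fpow n (1/10) * (\<sigma> - \<beta>)" for n
  proof -
    define x where "x = real (fib (Suc n))"
    have x: "x \<ge> 1" using fib_Suc_ge_1 by (simp add: x_def)
    have "x powr (- (\<sigma> - \<beta>)) = exp (- ((\<sigma> - \<beta>) * ln x))" using x by (simp add: powr_def algebra_simps)
    also have "\<dots> \<ge> 1 + - ((\<sigma> - \<beta>) * ln x)" by (rule exp_ge_add_one_self)
    finally have 1: "1 - x powr (- (\<sigma> - \<beta>)) \<le> (\<sigma> - \<beta>) * ln x" by simp
    have "ln x = 2 * ln (x powr (1/2))" using x by (simp add: ln_powr)
    also have "ln (x powr (1/2)) \<le> x powr (1/2)" using x ln_le_minus_one[of "x powr (1/2)"] by simp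
    finally have 2: "ln x \<le> 2 * x powr (1/2)" by simp
    have "x powr (- \<beta>) - x powr (- \<sigma>) = x powr (- \<beta>) * (1 - x powr (- (\<sigma> - \<beta>)))"
      by (simp add: right_diff_distrib powr_add[symmetric])
    also have "\<dots> \<le> x powr (- \<beta>) * ((\<sigma> - \<beta>) * (2 * x powr (1/2)))"
      using 1 2 assms by (intro mult_left_mono order_trans[OF 1]) (auto intro: mult_left_mono)
    also have "\<dots> = 2 * (x powr (- \<beta> + 1/2)) * (\<sigma> - \<beta>)" by (simp add: powr_add[symmetric])
    also have "\<dots> \<le> 2 * (x powr (- (1/10))) * (\<sigma> - \<beta>)"
      using x assms by (intro mult_right_mono mult_left_mono powr_mono) auto
    finally show ?thesis unfolding fpow_def x_def .
  qed
  have "Gsum \<beta> - Gsum \<sigma> \<le> (\<Sum>n. fpow n \<beta>) - (\<Sum>n. fpow n \<sigma>)"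
    unfolding Gsum_def using fpow_antimono[OF assms(2), of 11] by simp
  also have "\<dots> = (\<Sum>n. fpow n \<beta> - fpow n \<sigma>)"
    using assms by (intro suminf_diff summable_fpow) auto
  also have "\<dots> \<le> (\<Sum>n. 2 * fpow n (1/10) * (\<sigma> - \<beta>))"
    using assms by (intro suminf_le term_le summable_diff summable_fpow summable_mult summable_mult2) auto
  also have "\<dots> = (2 * (\<Sum>n. fpow n (1/10))) * (\<sigma> - \<beta>)"
    using summable_fpow[of "1/10"] by (simp add: suminf_mult suminf_mult2[symmetric] summable_mult)
  finally show ?thesis .
qed

section \<open>Cosine inequalities and alignment of phases at a zero\<close>

text \<open>Subadditivity of |sin|, followed by (2a - 5b)^2 >= 0. The weights are unequal on
  purpose: with 2 and 2 the multiplier of the term of 2 would become 32, whereas (144/2)^sigma is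
  only about 24 near \<open>sigma_F\<close>.\<close>

lemma one_minus_cos_sum_le:
  "1 - cos (p + q) \<le> (7/5) * (1 - cos p) + (7/2) * (1 - cos (q::real))"
proof -
  have c: "1 - cos x = 2 * (sin (x / 2)) ^ 2" for x :: real
    using cos_double_sin[of "x/2"] by simp
  define a where "a = \<bar>sin (p/2)\<bar>"
  define b where "b = \<bar>sin (q/2)\<bar>"
  have "\<bar>sin ((p + q) / 2)\<bar> = \<bar>sin (p/2) * cos (q/2) + cos (p/2) * sin (q/2)\<bar>"
    by (simp add: sin_add add_divide_distrib)
  also have "\<dots> \<le> a * \<bar>cos (q/2)\<bar> + \<bar>cos (p/2)\<bar> * b"
    unfolding a_def b_def by (simp add: abs_mult[symmetric])
  also have "\<dots> \<le> a * 1 + 1 * b"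
    unfolding a_def b_def by (intro add_mono mult_mono) (auto simp: abs_cos_le_one)
  finally have "\<bar>sin ((p + q) / 2)\<bar> \<le> a + b" by simp
  hence "(sin ((p + q) / 2))\<^sup>2 \<le> (a + b)^2" using abs_le_square_iff[of "sin ((p+q)/2)" "a + b"] by (simp add: a_def b_def)
  also have "\<dots> \<le> (7/5) * a^2 + (7/2) * b^2"
    using zero_le_power2[of "2 * a - 5 * b"] by (simp add: power2_eq_square algebra_simps)
  finally show ?thesis unfolding c a_def b_def by simp
qed

lemma one_minus_cos_double: "1 - cos (2 * x) \<le> 4 * (1 + cos (x::real))"
proof -
  have "1 - cos (2 * x) = 2 * (1 - cos x) * (1 + cos x)"
    using cos_double_cos[of x] by (simp add: power2_eq_square algebra_simps)
  also have "\<dots> \<le> 4 * (1 + cos x)"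
    using cos_ge_minus_one[of x] by (intro mult_right_mono) (auto simp del: cos_ge_minus_one)
  finally show ?thesis .
qed

lemma one_minus_cos_quad: "1 - cos (4 * x) \<le> 16 * (1 + cos (x::real))"
proof -
  have "1 - cos (4 * x) = 2 * (1 + cos (2 * x)) * (1 - cos (2 * x))"
    using cos_double_cos[of "2 * x"] by (simp add: power2_eq_square algebra_simps)
  also have "\<dots> \<le> 4 * (1 - cos (2 * x))"
    by (intro mult_right_mono) auto
  also have "\<dots> \<le> 16 * (1 + cos x)" using one_minus_cos_double[of x] by simp
  finally show ?thesis .
qed

text \<open>144 = 2^4 * 3^2 makes the angle 4 (t ln 2) + 2 (t ln 3); the constants are 16 * 7/5 and
  4 * 7/2.\<close>

lemma one_minus_cos_144:
  "1 - cos (t * ln 144) \<le> (112/5) * (1 + cos (t * ln 2)) + 14 * (1 + cos (t * ln (3::real)))"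
proof -
  have "ln (144::real) = ln (16 * 9)" by simp
  also have "\<dots> = ln 16 + ln 9" by (rule ln_mult_pos) auto
  also have "ln (16::real) = 4 * ln 2" using ln_realpow[of 2 4] by simp
  also have "ln (9::real) = 2 * ln 3" using ln_realpow[of 3 2] by simp
  finally have *: "t * ln 144 = 4 * (t * ln 2) + 2 * (t * ln (3::real))" by (simp add: algebra_simps)
  have arith: "a \<le> (112/5) * e + 14 * f" if "a \<le> (7/5) * b + (7/2) * c" "b \<le> 16 * e" "c \<le> 4 * f" for a b c e f :: real
    using that by linarith
  show ?thesis unfolding *
    by (rule arith[OF one_minus_cos_sum_le one_minus_cos_quad one_minus_cos_double])
qed

lemma power_powr: "x > 0 \<Longrightarrow> (x ^ n) powr a = x powr (real n * a)" for x a :: real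
  by (simp add: powr_realpow[symmetric] powr_powr)

lemma powr_ratio_bounds:
  assumes "\<sigma> \<ge> 74/100"
  shows "(112/5) * 144 powr (- \<sigma>) \<le> (99/100) * 2 powr (- \<sigma> :: real)"
    and "14 * 144 powr (- \<sigma>) \<le> (99/100) * 3 powr (- \<sigma> :: real)"
proof -
  \<comment> \<open>The exponent 11/15 is a rational just below 74/100; it reduces the claim to a
    comparison of integer powers.\<close>
  have *: "c * 144 powr (- \<sigma>) \<le> (99/100) * b powr (- \<sigma>)"
    if "0 < b" "b < 144" "0 < c" "((100/99) * c) ^ 15 \<le> (144 / b) ^ 11" for b c :: real
  proof -
    have "(100/99) * c = (((100/99) * c) ^ 15) powr (1/15)"
      using that by (subst power_powr) auto
    also have "\<dots> \<le> ((144 / b) ^ 11) powr (1/15)"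
      using that by (intro powr_mono2) auto
    also have "\<dots> = (144 / b) powr (11/15)"
      using that by (subst power_powr) auto
    also have "\<dots> \<le> (144 / b) powr \<sigma>" using assms that by (intro powr_mono) auto
    also have "\<dots> = 144 powr \<sigma> / b powr \<sigma>" using that by (simp add: powr_divide)
    finally show ?thesis using that by (simp add: powr_minus field_simps)
  qed
  show "(112/5) * 144 powr (- \<sigma>) \<le> (99/100) * 2 powr (- \<sigma> :: real)"
    by (rule *) (simp_all add: power_divide)
  show "14 * 144 powr (- \<sigma>) \<le> (99/100) * 3 powr (- \<sigma> :: real)"
    by (rule *) (simp_all add: power_divide)
qed

text \<open>At a zero every term with index other than 1, 2, 12 nearly points in the negative direction; the
  contribution of 144 is absorbed by those of 2 and 3.\<close>
lemma zero_imp_cos_bound: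
  assumes Z: "Z_F s = 0" and s: "Re s \<ge> 74/100" and n: "n \<ge> 2" "n \<noteq> 11"
  shows "fpow n (Re s) * (1 + cos (Im s * ln (fib (Suc n)))) \<le> 100 * (Gsum (Re s) - 4)"
proof -
  define \<sigma> where "\<sigma> = Re s"
  define E where "E = (\<lambda>n. 1 + cos (Im s * ln (fib (Suc n))))"
  define b where "b = (\<lambda>n. fpow n \<sigma> * E n)"
  have \<sigma>: "\<sigma> > 0" using s by (simp add: \<sigma>_def)
  have E: "E n \<ge> 0" "E n \<le> 2" for n 
    using cos_ge_minus_one[of "Im s * ln (fib (Suc n))"] by (auto simp: E_def simp del: cos_ge_minus_one)
  have b0: "b n \<ge> 0" for n using E fpow_pos[of n \<sigma>] by (simp add: b_def)
  have sm: "summable (\<lambda>n. (1::complex) * of_nat (fib (Suc n)) powr (- s))"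
    using \<sigma> by (intro summable_fib_series) (auto simp: \<sigma>_def)
  hence "(\<lambda>n. of_nat (fib (Suc n)) powr (- s) :: complex) sums 0"
    using Z unfolding Z_F_def by (simp add: sums_iff)
  from sums_Re[OF this] have "(\<lambda>n. fpow n \<sigma> * cos (Im s * ln (fib (Suc n)))) sums 0"
    by (simp add: fib_powr_polar \<sigma>_def)
  hence "(\<lambda>n. fpow n \<sigma> + fpow n \<sigma> * cos (Im s * ln (fib (Suc n)))) sums ((\<Sum>n. fpow n \<sigma>) + 0)"
    by (intro sums_add summable_sums summable_fpow \<sigma>)
  hence bs: "b sums (\<Sum>n. fpow n \<sigma>)" by (simp add: b_def E_def algebra_simps)
  \<comment> \<open>Indices 0 and 1 both carry the number 1, where the cosine is 1; their terms add
    up to the 4 in the conclusion.\<close>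
  define A where "A = {0,1,2,3,11,n}"
  have "(\<Sum>k\<in>A. b k) \<le> (\<Sum>n. b n)" using bs b0 by (intro sum_le_suminf) (auto simp: A_def sums_iff)
  also have "\<dots> = Gsum \<sigma> + 2 * fpow 11 \<sigma>" using bs by (simp add: sums_iff Gsum_def)
  finally have 1: "(\<Sum>k\<in>A. b k) \<le> Gsum \<sigma> + 2 * fpow 11 \<sigma>" .
  have b01: "b 0 = 2" "b 1 = 2" by (simp_all add: b_def E_def fpow_def)
  have f: "fib 3 = 2" "fib 4 = 3" "fib 12 = 144" by (simp_all add: fib_values)
  have fp: "fpow 2 \<sigma> = 2 powr (- \<sigma>)" "fpow 3 \<sigma> = 3 powr (- \<sigma>)" "fpow 11 \<sigma> = 144 powr (- \<sigma>)"
    by (simp_all add: fpow_def fib_values)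
  have "fpow 11 \<sigma> * (2 - E 11) \<le> fpow 11 \<sigma> * ((112/5) * E 2 + 14 * E 3)"
    using one_minus_cos_144[of "Im s"] fpow_pos[of 11 \<sigma>] by (intro mult_left_mono) (auto simp: E_def f)
  also have "\<dots> = ((112/5) * fpow 11 \<sigma>) * E 2 + (14 * fpow 11 \<sigma>) * E 3" by (simp add: algebra_simps)
  also have "\<dots> \<le> (99/100) * fpow 2 \<sigma> * E 2 + (99/100) * fpow 3 \<sigma> * E 3"
    using powr_ratio_bounds[of \<sigma>] s E unfolding fp
    by (intro add_mono mult_right_mono) (auto simp: \<sigma>_def)
  finally have 2: "2 * fpow 11 \<sigma> - b 11 \<le> (99/100) * b 2 + (99/100) * b 3"
    by (simp add: b_def algebra_simps)
  \<comment> \<open>After paying for 144, the terms of 2 and 3 keep only a hundredth of their size,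
    whence the factor 100.\<close>
  have "b n \<le> 100 * (Gsum \<sigma> - 4)"
  proof (cases "n = 2 \<or> n = 3")
    case True
    hence "A = {0,1,2,3,11}" by (auto simp: A_def)
    hence "(\<Sum>k\<in>A. b k) = b 0 + b 1 + b 2 + b 3 + b 11" by simp
    thus ?thesis using 1 2 b01 True b0[of 2] b0[of 3] by auto
  next
    case False
    hence "(\<Sum>k\<in>A. b k) = b 0 + b 1 + b 2 + b 3 + b 11 + b n" using n by (simp add: A_def)
    thus ?thesis using 1 2 b01 b0[of 2] b0[of 3] b0[of n] by auto
  qed
  thus ?thesis by (simp add: b_def E_def \<sigma>_def)
qed

section \<open>Numerical location of the critical abscissa\<close>

text \<open>Fixed-point arithmetic with \<open>26\<close> decimal digits: a pair \<open>(X, e)\<close> approximates every real \<open>x\<close> with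
  \<open>\<bar>10\<^sup>2\<^sup>6 x - X\<bar> \<le> e\<close>.\<close>

definition scale :: int where "scale = 100000000000000000000000000"

definition apx :: "real \<Rightarrow> int \<times> int \<Rightarrow> bool" where
  "apx x A \<longleftrightarrow> \<bar>x * of_int scale - of_int (fst A)\<bar> \<le> of_int (snd A)"

text \<open>\<open>div\<close> rounds down twice, once in the product and once in the propagated
  error; \<open>+ 2\<close> covers both.\<close>

fun apx_mul :: "int \<times> int \<Rightarrow> int \<times> int \<Rightarrow> int \<times> int" where
  "apx_mul (X, e) (Y, d) = (X * Y div scale, (\<bar>X\<bar> * d + \<bar>Y\<bar> * e + e * d) div scale + 2)"

fun apx_add :: "int \<times> int \<Rightarrow> int \<times> int \<Rightarrow> int \<times> int" where
  "apx_add (X, e) (Y, d) = (X + Y, e + d)"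

lemma scale_pos: "scale > 0" by (simp add: scale_def)

lemma real_of_int_div_bounds:
  assumes "y > 0"
  shows "of_int (x div y) \<le> (of_int x / of_int y :: real)" "(of_int x / of_int y :: real) \<le> of_int (x div y) + 1"
proof -
  have "of_int (x div y) = (of_int \<lfloor>of_int x / of_int y :: real\<rfloor> :: real)"
    by (simp add: floor_divide_of_int_eq)
  thus "of_int (x div y) \<le> (of_int x / of_int y :: real)" "(of_int x / of_int y :: real) \<le> of_int (x div y) + 1"
    by linarith+
qed

lemma apx_mul:
  assumes "apx x A" "apx y B"
  shows "apx (x * y) (apx_mul A B)"
proof -
  obtain X e Y d where AB: "A = (X, e)" "B = (Y, d)" by (cases A, cases B) auto
  define k :: real where "k = of_int scale"
  have k: "k > 0" using scale_pos by (simp add: k_def)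
  have 1: "\<bar>x * k - X\<bar> \<le> e" and 2: "\<bar>y * k - Y\<bar> \<le> d"
    using assms by (simp_all add: AB apx_def k_def)
  have "x * k * (y * k) - X * Y = X * (y * k - Y) + Y * (x * k - X) + (x * k - X) * (y * k - Y)"
    by (simp add: algebra_simps)
  hence "\<bar>x * k * (y * k) - X * Y\<bar> \<le> \<bar>X * (y * k - Y)\<bar> + \<bar>Y * (x * k - X)\<bar> + \<bar>(x * k - X) * (y * k - Y)\<bar>"
    by linarith
  also have "\<dots> \<le> \<bar>X\<bar> * d + \<bar>Y\<bar> * e + e * d"
    unfolding abs_mult of_int_add of_int_mult of_int_abs using 1 2
    by (intro add_mono mult_left_mono mult_mono) auto
  finally have 3: "\<bar>x * k * (y * k) - X * Y\<bar> \<le> \<bar>X\<bar> * d + \<bar>Y\<bar> * e + e * d" .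
  have "x * y * k - X * Y / k = (x * k * (y * k) - X * Y) / k" using k by (simp add: field_simps)
  hence "\<bar>x * y * k - X * Y / k\<bar> = \<bar>x * k * (y * k) - X * Y\<bar> / k" using k by simp
  also have "\<dots> \<le> (\<bar>X\<bar> * d + \<bar>Y\<bar> * e + e * d) / k" using 3 k by (intro divide_right_mono) auto
  finally have 4: "\<bar>x * y * k - X * Y / k\<bar> \<le> of_int (\<bar>X\<bar> * d + \<bar>Y\<bar> * e + e * d) / k" by simp
  have 5: "of_int (\<bar>X\<bar> * d + \<bar>Y\<bar> * e + e * d) / k \<le> of_int ((\<bar>X\<bar> * d + \<bar>Y\<bar> * e + e * d) div scale) + 1"
    unfolding k_def by (rule real_of_int_div_bounds(2)[OF scale_pos])
  have 6: "of_int (X * Y div scale) \<le> of_int (X * Y) / k" "of_int (X * Y) / k \<le> of_int (X * Y div scale) + 1"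
    unfolding k_def by (rule real_of_int_div_bounds[OF scale_pos])+
  have "\<bar>x * y * k - of_int (X * Y div scale)\<bar> \<le> of_int ((\<bar>X\<bar> * d + \<bar>Y\<bar> * e + e * d) div scale) + 2"
    using 4 5 6 unfolding of_int_mult by linarith
  thus ?thesis by (simp add: apx_def AB k_def)
qed

lemma apx_add: "apx x A \<Longrightarrow> apx y B \<Longrightarrow> apx (x + y) (apx_add A B)"
  by (cases A; cases B) (auto simp: apx_def algebra_simps)

text \<open>Rounded binomial series of \<open>(1 + p/q) powr (- 0.743163398726901648)\<close>; \<open>t\<close> is its current term.\<close>
fun binom_sum :: "nat \<Rightarrow> int \<Rightarrow> int \<Rightarrow> int \<Rightarrow> int \<Rightarrow> int" where
  "binom_sum 0 n t p q = 0"
| "binom_sum (Suc k) n t p q = t + binom_sum k (n + 1)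
     ((t * (- (743163398726901648 + n * 1000000000000000000)) * p) div ((n + 1) * 1000000000000000000 * q)) p q"

text \<open>The claimed decimal expansion cut after 18 places. Everything numerical takes place at
  this single rational point.\<close>

definition expo :: real where "expo = 743163398726901648 / 1000000000000000000"

lemma expo_bounds: "74/100 < expo" "expo < 75/100" by (simp_all add: expo_def)

lemma gbinomial_Suc_rec: "(a gchoose Suc m) = (a gchoose m) * (a - of_nat m) / of_nat (Suc m)" for a :: real
  by (simp add: gbinomial_prod_rev prod.atLeast0_lessThan_Suc field_simps)

lemma gbinomial_expo_le: "\<bar>(- expo) gchoose m\<bar> \<le> 1"
proof (induction m)
  case (Suc m)
  have "\<bar>(- expo) gchoose Suc m\<bar> = \<bar>(- expo) gchoose m\<bar> * ((expo + m) / (m + 1))"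
  proof -
    have "(- expo) gchoose Suc m = - (((- expo) gchoose m) * ((expo + m) / (m + 1)))"
      by (simp add: gbinomial_Suc_rec field_simps)
    thus ?thesis using expo_bounds by (simp add: abs_mult)
  qed
  also have "\<dots> \<le> 1 * 1" using Suc expo_bounds by (intro mult_mono) (auto simp: field_simps)
  finally show ?case by simp
qed simp

text \<open>The ratio of successive terms is at most 1/9 in absolute value and each rounding costs
  at most 1. As 2/9 + 1 <= 2, an error of 2 per term is invariant.\<close>

lemma binom_sum_error:
  fixes p q :: int
  assumes pq: "q \<ge> 9" "\<bar>p\<bar> = 1"
    and "\<bar>of_int t - of_int scale * ((- expo) gchoose m) * (of_int p / of_int q) ^ m\<bar> \<le> 2" "n = int m"
  shows "\<bar>of_int (binom_sum k n t p q) - of_int scale * (\<Sum>i<k. ((- expo) gchoose (m + i)) * (of_int p / of_int q) ^ (m + i))\<bar> \<le> 2 * real k"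
  using assms(3,4)
proof (induction k arbitrary: n t m)
  case 0
  then show ?case by simp
next
  case (Suc k)
  define u :: real where "u = of_int p / of_int q"
  define c where "c = (\<lambda>m. of_int scale * ((- expo) gchoose m) * u ^ m)"
  have u: "\<bar>u\<bar> \<le> 1/9" using pq by (simp add: u_def abs_divide field_simps)
  define t' where "t' = (t * (- (743163398726901648 + n * 1000000000000000000)) * p) div ((n + 1) * 1000000000000000000 * q)"
  define \<rho> where "\<rho> = - (expo + m) / (m + 1) * u"
  have "\<bar>\<rho>\<bar> = ((expo + m) / (m + 1)) * \<bar>u\<bar>" using expo_bounds by (simp add: \<rho>_def abs_mult abs_divide)
  also have "\<dots> \<le> 1 * (1/9)" using u expo_bounds by (intro mult_mono) (auto simp: field_simps)
  finally have \<rho>: "\<bar>\<rho>\<bar> \<le> 1/9" by simp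
  have c: "c (Suc m) = c m * \<rho>"
    unfolding c_def \<rho>_def gbinomial_Suc_rec by (simp add: field_simps)
  have pos: "(n + 1) * 1000000000000000000 * q > 0" using pq Suc.prems by simp
  have eq: "of_int (t * (- (743163398726901648 + n * 1000000000000000000)) * p) / of_int ((n + 1) * 1000000000000000000 * q) = of_int t * \<rho>"
  proof -
    have gen: "of_int t * - (D * (expo + m)) * of_int p / ((real m + 1) * D * of_int q) = of_int t * \<rho>"
      if "D > 0" for D :: real
    proof -
      have "of_int t * - (D * (expo + m)) * of_int p = D * (of_int t * - (expo + m) * of_int p)"
        by (simp add: algebra_simps)
      moreover have "(real m + 1) * D * of_int q = D * ((real m + 1) * of_int q)" by simp
      ultimately have "of_int t * - (D * (expo + m)) * of_int p / ((real m + 1) * D * of_int q) =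
          of_int t * - (expo + m) * of_int p / ((real m + 1) * of_int q)"
        using that by (simp only: mult_divide_mult_cancel_left)
      thus ?thesis by (simp add: \<rho>_def u_def add.commute)
    qed
    have num: "real_of_int (743163398726901648 + n * 1000000000000000000) = 1000000000000000000 * (expo + m)"
      using Suc.prems(2) by (simp add: expo_def)
    have den: "real_of_int (n + 1) = real m + 1" "real_of_int 1000000000000000000 = 1000000000000000000"
      using Suc.prems(2) by simp_all
    show ?thesis unfolding of_int_mult of_int_minus num den by (rule gen) simp
  qed
  have "\<bar>of_int t' - of_int t * \<rho>\<bar> \<le> 1"
    using real_of_int_div_bounds[OF pos, of "t * (- (743163398726901648 + n * 1000000000000000000)) * p"]
    unfolding eq t'_def[symmetric] by linarith
  moreover have "\<bar>of_int t * \<rho> - c m * \<rho>\<bar> \<le> 2 * (1/9)"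
    using Suc.prems(1) \<rho> unfolding left_diff_distrib[symmetric] abs_mult c_def u_def by (intro mult_mono) auto
  ultimately have "\<bar>of_int t' - c (Suc m)\<bar> \<le> 2" unfolding c by linarith
  from Suc.IH[of t' "Suc m" "n + 1"] this Suc.prems
  have IH: "\<bar>of_int (binom_sum k (n + 1) t' p q) - (\<Sum>i<k. c (Suc m + i))\<bar> \<le> 2 * real k"
    by (simp add: c_def u_def sum_distrib_left mult.assoc)
  have "of_int scale * (\<Sum>i<Suc k. ((- expo) gchoose (m + i)) * u ^ (m + i)) = (\<Sum>i<Suc k. c (m + i))"
    unfolding c_def sum_distrib_left by (simp only: mult.assoc)
  also have "\<dots> = c m + (\<Sum>i<k. c (Suc m + i))" by (subst sum.lessThan_Suc_shift) simp
  finally have 2: "of_int scale * (\<Sum>i<Suc k. ((- expo) gchoose (m + i)) * u ^ (m + i)) = c m + (\<Sum>i<k. c (Suc m + i))" .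
  have 3: "binom_sum (Suc k) n t p q = t + binom_sum k (n + 1) t' p q" by (simp add: t'_def)
  have "\<bar>of_int t - c m\<bar> \<le> 2" using Suc.prems(1) by (simp add: c_def u_def)
  thus ?case unfolding u_def[symmetric] 2 3 using IH by simp
qed

text \<open>28 terms cost at most 56 by rounding, and for ratio at most 1/9 the tail is below one
  unit; 58 covers both.\<close>

definition apx_powr :: "int \<Rightarrow> int \<Rightarrow> int \<times> int" where
  "apx_powr p q = (binom_sum 28 0 scale p q, 58)"

lemma apx_powr:
  fixes p q :: int
  assumes pq: "q \<ge> 9" "\<bar>p\<bar> = 1"
  shows "apx ((1 + of_int p / of_int q) powr (- expo)) (apx_powr p q)"
proof -
  define u :: real where "u = of_int p / of_int q"
  define g where "g = (\<lambda>i. ((- expo) gchoose i) * u ^ i)"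
  have u: "\<bar>u\<bar> \<le> 1/9" using pq by (simp add: u_def abs_divide field_simps)
  have sums: "g sums (1 + u) powr (- expo)" unfolding g_def by (rule gen_binomial_real) (use u in simp)
  have tail: "\<bar>\<Sum>i. g (i + 28)\<bar> \<le> (\<Sum>i. (1/9) ^ 28 * (1/9) ^ i)"
  proof -
    have "norm (g (i + 28)) \<le> (1/9) ^ 28 * (1/9) ^ i" for i
    proof -
      have "norm (g (i + 28)) \<le> 1 * \<bar>u\<bar> ^ (i + 28)"
        unfolding g_def real_norm_def abs_mult power_abs by (intro mult_right_mono gbinomial_expo_le) simp
      also have "\<dots> \<le> (1/9) ^ (i + 28)" using u by (simp only: mult_1_left) (intro power_mono, auto)
      finally show ?thesis by (simp only: power_add mult.commute)
    qed
    moreover have "summable (\<lambda>i. (1/9::real) ^ 28 * (1/9) ^ i)" by (intro summable_mult) simp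
    ultimately show ?thesis unfolding real_norm_def[symmetric] by (rule norm_suminf_le)
  qed
  have "(\<Sum>i. (1/9::real) ^ 28 * (1/9) ^ i) = (1/9) ^ 28 * (9/8)"
    by (subst suminf_mult) (auto simp: suminf_geometric)
  also have "\<dots> \<le> 1 / of_int scale" by (simp add: scale_def power_divide)
  finally have tail': "\<bar>\<Sum>i. g (i + 28)\<bar> \<le> 1 / of_int scale" using tail by linarith
  have split: "(1 + u) powr (- expo) = (\<Sum>i. g (i + 28)) + (\<Sum>i<28. g i)"
    using suminf_split_initial_segment[of g 28] sums by (simp add: sums_iff)
  have err: "\<bar>of_int (binom_sum 28 0 scale p q) - of_int scale * (\<Sum>i<28. g i)\<bar> \<le> 56"
    using binom_sum_error[OF pq, of scale 0 0 28] by (simp add: g_def u_def)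
  have "\<bar>of_int scale * (\<Sum>i. g (i + 28))\<bar> \<le> 1"
    using tail' scale_pos by (simp add: abs_mult field_simps)
  thus ?thesis using err unfolding apx_def apx_powr_def u_def[symmetric] split by (simp add: algebra_simps)
qed

fun apx_chain :: "nat \<Rightarrow> int \<Rightarrow> int \<Rightarrow> int \<times> int \<Rightarrow> int \<times> int \<Rightarrow> int \<times> int \<Rightarrow> (int \<times> int) \<times> (int \<times> int) \<times> (int \<times> int)" where
  "apx_chain 0 f0 f1 Q X S = (Q, X, S)"
| "apx_chain (Suc k) f0 f1 Q X S =
    (let f2 = f0 + f1; Q' = apx_mul Q (apx_powr (f2 * f0 - f1 * f1) (f1 * f1)); X' = apx_mul X Q'
     in apx_chain k f1 f2 Q' X' (apx_add S X'))"

text \<open>By Cassini's identity consecutive quotients \<open>fib (n + 1) / fib n\<close> differ by a factor \<open>1 \<plusminus> 1 / fib n ^ 2\<close>.\<close>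
lemma apx_chain:
  assumes "n \<ge> 4"
    and "apx ((real (fib n) / real (fib (n - 1))) powr (- expo)) Q"
    and "apx (real (fib n) powr (- expo)) X" and "apx (\<Sum>i=1..n. real (fib i) powr (- expo)) S"
    and "apx_chain k (int (fib (n - 1))) (int (fib n)) Q X S = (Q', X', S')"
  shows "apx ((real (fib (n + k)) / real (fib (n + k - 1))) powr (- expo)) Q' \<and>
    apx (real (fib (n + k)) powr (- expo)) X' \<and> apx (\<Sum>i=1..n + k. real (fib i) powr (- expo)) S'"
  using assms
proof (induction k arbitrary: n Q X S)
  case 0
  then show ?case by simp
next
  case (Suc k)
  define f0 f1 f2 where "f0 = fib (n - 1)" and "f1 = fib n" and "f2 = fib (Suc n)"
  obtain m where n: "n = Suc m" "m \<ge> 3" using Suc.prems(1) by (cases n) auto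
  have f2: "f2 = f0 + f1" unfolding f0_def f1_def f2_def n by simp
  have f0: "f0 > 0" and f1: "f1 > 0"
    unfolding f0_def f1_def using fib_neq_0_nat n by auto
  have "fib 4 \<le> f1" unfolding f1_def by (rule fib_mono) (use Suc.prems in simp)
  hence f13: "f1 \<ge> 3" by (simp add: fib_values)
  define p where "p = int f2 * int f0 - int f1 * int f1"
  have p: "p = - ((-1) ^ m)"
    using fib_Cassini_int[of m] unfolding p_def f0_def f1_def f2_def n by (simp add: power2_eq_square)
  hence p1: "\<bar>p\<bar> = 1" by (cases "even m") auto
  define q where "q = int f1 * int f1"
  \<comment> \<open>Starting at index 4, where the Fibonacci number is 3, makes the denominator at
    least 9, as the binomial series requires.\<close>
  have "3 * 3 \<le> f1 * f1" using f13 by (intro mult_mono) auto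
  hence q9: "q \<ge> 9" unfolding q_def of_nat_mult[symmetric] by linarith
  have ratio: "1 + of_int p / of_int q = (real f2 / real f1) / (real f1 / real f0)"
    using f0 f1 by (simp add: p_def q_def field_simps)
  define Q1 where "Q1 = apx_mul Q (apx_powr p q)"
  define X1 where "X1 = apx_mul X Q1"
  have "apx ((real f1 / real f0) powr (- expo) * (1 + of_int p / of_int q) powr (- expo)) Q1"
    unfolding Q1_def using Suc.prems(2) apx_powr[OF q9 p1] by (intro apx_mul) (auto simp: f0_def f1_def)
  also have "(real f1 / real f0) powr (- expo) * (1 + of_int p / of_int q) powr (- expo) = (real f2 / real f1) powr (- expo)"
    unfolding ratio using f0 f1 by (subst powr_mult[symmetric]) auto
  finally have Q1: "apx ((real f2 / real f1) powr (- expo)) Q1" .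
  have "apx (real f1 powr (- expo) * (real f2 / real f1) powr (- expo)) X1"
    unfolding X1_def using Suc.prems(3) Q1 by (intro apx_mul) (auto simp: f1_def)
  also have "real f1 powr (- expo) * (real f2 / real f1) powr (- expo) = real f2 powr (- expo)"
    using f1 by (subst powr_mult[symmetric]) auto
  finally have X1: "apx (real f2 powr (- expo)) X1" .
  have S1: "apx (\<Sum>i=1..Suc n. real (fib i) powr (- expo)) (apx_add S X1)"
    using apx_add[OF Suc.prems(4) X1] by (simp add: f2_def)
  have ch: "apx_chain k (int (fib (Suc n - 1))) (int (fib (Suc n))) Q1 X1 (apx_add S X1) = (Q', X', S')"
    using Suc.prems(5)[folded f0_def f1_def]
    by (simp add: Q1_def X1_def p_def q_def Let_def f1_def[symmetric] f2_def[symmetric] f2)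
  show ?case using Suc.IH[OF _ _ _ S1 ch] Q1 X1 Suc.prems(1) by (simp add: f1_def f2_def)
qed

text \<open>\<open>2 = (10/9)\<^sup>7 (24/25)\<^sup>2 (81/80)\<^sup>3\<close> and \<open>3/2 = (10/9)\<^sup>4 (24/25) (81/80)\<^sup>2\<close>.\<close>
definition apx_2_3 :: "(int \<times> int) \<times> (int \<times> int) \<times> (int \<times> int)" where
  "apx_2_3 = (let g1 = apx_powr 1 9; g2 = apx_powr (- 1) 25; g3 = apx_powr 1 80; h = apx_mul g2 g3;
     k = apx_mul (apx_mul g1 (apx_mul g1 g1)) h; Q = apx_mul k (apx_mul g1 g3); X = apx_mul Q k
     in (X, Q, apx_mul X Q))"

lemma apx_2_3:
  assumes "apx_2_3 = (X2, Q, X3)"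
  shows "apx (2 powr (- expo)) X2" "apx ((3/2) powr (- expo)) Q" "apx (3 powr (- expo)) X3"
proof -
  define c1 c2 c3 :: real where "c1 = 10/9" and "c2 = 24/25" and "c3 = 81/80"
  have c: "c1 > 0" "c2 > 0" "c3 > 0" by (simp_all add: c1_def c2_def c3_def)
  define g1 g2 g3 where "g1 = apx_powr 1 9" and "g2 = apx_powr (- 1) 25" and "g3 = apx_powr 1 80"
  have g: "apx (c1 powr (- expo)) g1" "apx (c2 powr (- expo)) g2" "apx (c3 powr (- expo)) g3"
    using apx_powr[of 9 1] apx_powr[of 25 "- 1"] apx_powr[of 80 1]
    by (simp_all add: c1_def c2_def c3_def g1_def g2_def g3_def)
  have mul: "apx ((x * y) powr (- expo)) (apx_mul A B)" if "apx (x powr (- expo)) A" "apx (y powr (- expo)) B" "0 < x" "0 < y" for x y A B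
    using apx_mul[OF that(1,2)] that(3,4) by (simp add: powr_mult)
  define h k where "h = apx_mul g2 g3" and "k = apx_mul (apx_mul g1 (apx_mul g1 g1)) h"
  have h: "apx ((c2 * c3) powr (- expo)) h" unfolding h_def by (intro mul g c)
  have k: "apx (((c1 * (c1 * c1)) * (c2 * c3)) powr (- expo)) k" unfolding k_def by (intro mul g h c mult_pos_pos)
  have "apx ((((c1 * (c1 * c1)) * (c2 * c3)) * (c1 * c3)) powr (- expo)) (apx_mul k (apx_mul g1 g3))"
    by (intro mul g k c mult_pos_pos)
  also have "((c1 * (c1 * c1)) * (c2 * c3)) * (c1 * c3) = 3/2" by (simp add: c1_def c2_def c3_def)
  also have "apx_mul k (apx_mul g1 g3) = Q"
    using assms unfolding apx_2_3_def Let_def g1_def[symmetric] g2_def[symmetric] g3_def[symmetric] h_def[symmetric] k_def[symmetric]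
    by simp
  finally show Q: "apx ((3/2) powr (- expo)) Q" .
  have "apx ((3/2 * ((c1 * (c1 * c1)) * (c2 * c3))) powr (- expo)) (apx_mul Q k)"
    by (intro mul Q k c mult_pos_pos) auto
  also have "3/2 * ((c1 * (c1 * c1)) * (c2 * c3)) = 2" by (simp add: c1_def c2_def c3_def)
  also have "apx_mul Q k = X2"
    using assms unfolding apx_2_3_def Let_def g1_def[symmetric] g2_def[symmetric] g3_def[symmetric] h_def[symmetric] k_def[symmetric]
    by auto
  finally show X2: "apx (2 powr (- expo)) X2" .
  have "apx ((2 * (3/2)) powr (- expo)) (apx_mul X2 Q)" by (intro mul X2 Q) auto
  also have "apx_mul X2 Q = X3"
    using assms unfolding apx_2_3_def Let_def by auto
  finally show "apx (3 powr (- expo)) X3" by simp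
qed

lemma apx_2_3_value: "apx_2_3 = ((59742793428685684683746587, 448), (73983593427327584586365269, 323), (44199865392406998328910702, 526))"
  by code_simp

lemma apx_chain_value: "apx_chain 40 2 3 (73983593427327584586365269, 323) (44199865392406998328910702, 526) (303942658821092683012657289, 974) = ((69933946181059653611100133, 1988), (26668463901588408415, 6), (404977469162180078773002489, 4531))"
  by code_simp

lemma apx_144_value: "apx_mul (apx_mul (apx_mul (59742793428685684683746587, 448) (59742793428685684683746587, 448)) (44199865392406998328910702, 526)) (apx_mul (apx_mul (59742793428685684683746587, 448) (59742793428685684683746587, 448)) (44199865392406998328910702, 526)) = (2488765596648822996117688, 136)"
  by code_simp

section \<open>The tail of the series and enclosure of the root\<close>

lemma fib_mult_le: "fib k * fib (Suc n) \<le> fib (Suc n + k)"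
proof -
  have "fib k * fib (Suc n) \<le> fib (Suc k) * fib (Suc n)" by (intro mult_right_mono fib_Suc_mono) simp
  also have "\<dots> \<le> fib (Suc (n + k))" unfolding fib_add by simp
  finally show ?thesis by simp
qed

text \<open>By d'Ocagne's identity the relative difference is fib (i - n) / (fib i * fib (n + 1)),
  and fib (i - n) * fib n <= fib i. The bound is uniform in i, so the tail can be compared with
  geometric series.\<close>

lemma fib_ratio_close:
  assumes "n > 0" "n \<le> i"
  shows "\<bar>(real (fib (Suc i)) / real (fib i)) / (real (fib (Suc n)) / real (fib n)) - 1\<bar> \<le> 1 / (real (fib n) * real (fib (Suc n)))"
proof -
  obtain k where i: "i = n + k" using assms(2) le_Suc_ex by blast
  obtain m where n: "n = Suc m" using assms(1) gr0_implies_Suc by blast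
  define A B C D where "A = real (fib i)" and "B = real (fib (Suc i))" and "C = real (fib n)" and "D = real (fib (Suc n))"
  have pos: "A > 0" "B > 0" "C > 0" "D > 0"
    unfolding A_def B_def C_def D_def using fib_neq_0_nat assms by auto
  have "D * A - C * B = (-1) ^ n * real (fib k)"
    using fib_det[OF assms(2)] arg_cong[of _ _ real_of_int] unfolding A_def B_def C_def D_def i by fastforce
  hence "\<bar>D * A - C * B\<bar> = real (fib k)" by (simp add: abs_mult power_abs)
  moreover have "(B / A) / (D / C) - 1 = - (D * A - C * B) / (A * D)" using pos by (simp add: field_simps)
  ultimately have "\<bar>(B / A) / (D / C) - 1\<bar> = real (fib k) / (A * D)" using pos by (simp add: abs_divide abs_mult)
  also have "\<dots> \<le> 1 / (C * D)"
  proof -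
    have "fib k * fib n \<le> fib i" using fib_mult_le[of k m] unfolding i n by simp
    hence "real (fib k) * C \<le> A" unfolding A_def C_def of_nat_mult[symmetric] of_nat_le_iff .
    thus ?thesis using pos by (simp add: field_simps)
  qed
  finally show ?thesis unfolding A_def B_def C_def D_def .
qed

lemma powr_near_one:
  assumes "\<bar>v - 1\<bar> \<le> d" "d \<le> 1/2" "0 \<le> a" "a \<le> 1"
  shows "1 - d \<le> v powr (- a)" "v powr (- a) \<le> 1 + 2 * (d::real)"
proof -
  have v: "v > 0" "1 - d \<le> v" "v \<le> 1 + d" using assms by (auto simp: abs_le_iff)
  have d: "d \<ge> 0" using assms(1) by linarith
  have "inverse (1 + d) \<le> v powr (- a)"
  proof (cases "v \<ge> 1")
    case True
    have "inverse (1 + d) \<le> inverse v" using v by (intro le_imp_inverse_le) auto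
    also have "\<dots> = v powr (-1)" using v by (simp add: powr_minus)
    also have "\<dots> \<le> v powr (- a)" using True assms by (intro powr_mono) auto
    finally show ?thesis .
  next
    case False
    have "inverse (1 + d) \<le> 1" using d by (simp add: field_simps)
    also have "1 \<le> v powr (- a)" using False v assms by (simp add: powr_minus powr_le1 one_le_inverse)
    finally show ?thesis .
  qed
  moreover have "1 - d \<le> inverse (1 + d)" using d by (simp add: field_simps)
  ultimately show "1 - d \<le> v powr (- a)" by linarith
  have "v powr (- a) \<le> inverse (1 - d)"
  proof (cases "v \<ge> 1")
    case True
    have "v powr (- a) \<le> v powr 0" using True assms by (intro powr_mono) auto
    also have "\<dots> \<le> inverse (1 - d)" using v d assms by (simp add: one_le_inverse)
    finally show ?thesis .
  next
    case False
    have "v powr (- a) \<le> v powr (-1)" using False v assms by (intro powr_mono') auto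
    also have "\<dots> = inverse v" using v by (simp add: powr_minus)
    also have "\<dots> \<le> inverse (1 - d)" using v assms by (intro le_imp_inverse_le) auto
    finally show ?thesis .
  qed
  moreover have "inverse (1 - d) \<le> 1 + 2 * d" 
  proof -
    have "1 \<le> (1 + 2 * d) * (1 - d)" using d assms(2) mult_left_mono[of d "1/2" d] by (simp add: algebra_simps)
    thus ?thesis using assms(2) by (simp add: field_simps)
  qed
  ultimately show "v powr (- a) \<le> 1 + 2 * d" by linarith
qed

text \<open>The first 44 terms are enclosed by the chain of quotients; the rest lies between
  geometric series with ratios \<open>m\<close> and \<open>M\<close>. An error of 10^(-19) is small
  enough against the drop of \<open>Gsum\<close> over a step of 10^(-18).\<close>

lemma Gsum_expo_bounds: "4 \<le> Gsum expo" "Gsum expo \<le> 4 + 1 / 10000000000000000000"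
proof -
  note small = apx_2_3[OF apx_2_3_value]
  have f: "fib 3 = 2" "fib 4 = 3" "fib (4 - 1) = 2" by (simp_all add: fib_values)
  have sum4: "(\<Sum>i=1..4. g i) = g 1 + g 2 + g 3 + g 4" for g :: "nat \<Rightarrow> real"
    by (simp add: eval_nat_numeral)
  have S0: "apx (\<Sum>i=1..4. real (fib i) powr (- expo)) (303942658821092683012657289, 974)"
    using small(1,3) unfolding sum4 by (simp add: f apx_def scale_def abs_le_iff)
  have chain: "apx ((real (fib (4 + 40)) / real (fib (4 + 40 - 1))) powr (- expo)) (69933946181059653611100133, 1988) \<and>
    apx (real (fib (4 + 40)) powr (- expo)) (26668463901588408415, 6) \<and> apx (\<Sum>i=1..4 + 40. real (fib i) powr (- expo)) (404977469162180078773002489, 4531)"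
  proof (rule apx_chain)
    show "apx ((real (fib 4) / real (fib (4 - 1))) powr (- expo)) (73983593427327584586365269, 323)" using small(2) by (simp add: f)
    show "apx (real (fib 4) powr (- expo)) (44199865392406998328910702, 526)" using small(3) by (simp add: f)
    show "apx_chain 40 (int (fib (4 - 1))) (int (fib 4)) (73983593427327584586365269, 323) (44199865392406998328910702, 526) (303942658821092683012657289, 974) = ((69933946181059653611100133, 1988), (26668463901588408415, 6), (404977469162180078773002489, 4531))"
      using apx_chain_value by (simp add: f)
    show "apx (\<Sum>i=1..4. real (fib i) powr (- expo)) (303942658821092683012657289, 974)" by (rule S0)
  qed simp
  define q where "q = (real (fib 44) / real (fib 43)) powr (- expo)"
  define x where "x = real (fib 44) powr (- expo)"
  define S where "S = (\<Sum>i=1..44. real (fib i) powr (- expo))"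
  have q: "apx q (69933946181059653611100133, 1988)" and x: "apx x (26668463901588408415, 6)" and S: "apx S (404977469162180078773002489, 4531)"
    using chain by (simp_all add: q_def x_def S_def)
  have "apx (((2 powr (- expo) * 2 powr (- expo)) * 3 powr (- expo)) * ((2 powr (- expo) * 2 powr (- expo)) * 3 powr (- expo))) (2488765596648822996117688, 136)"
    unfolding apx_144_value[symmetric] by (intro apx_mul small(1,3))
  also have "((2 powr (- expo) * 2 powr (- expo)) * 3 powr (- expo)) * ((2 powr (- expo) * 2 powr (- expo)) * 3 powr (- expo)) = 144 powr (- expo)"
    by (simp flip: powr_mult)
  finally have x12: "apx (144 powr (- expo)) (2488765596648822996117688, 136)" .
  \<comment> \<open>The computed quotient, moved by 10^(-17) either way. This covers its own error
    and the relative variation of later quotients, at most \<open>2 * d\<close>, about 7 *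
    10^(-18).\<close>
  define m M :: real where "m = 69933946181059652611100133 / 100000000000000000000000000" and "M = 69933946181059654611100133 / 100000000000000000000000000"
  have mM: "0 < m" "m < 1" "0 < M" "M < 1" by (simp_all add: m_def M_def)
  have x0: "x > 0" "x \<ge> 0" unfolding x_def using fib_neq_0_nat[of 44] by simp_all
  have "fib 21 = 10946" "fib 22 = 17711" using fib_add[of 10 10] fib_add[of 10 11] by (simp_all add: fib_values)
  hence f44: "fib 43 = 433494437" "fib 44 = 701408733"
    using fib_add[of 21 21] fib_add[of 21 22] fib_plus_2[of 21] by simp_all
  define d where "d = 1 / (real (fib 43) * real (fib 44))"
  have ratio: "m \<le> (real (fib (Suc i)) / real (fib i)) powr (- expo)" "(real (fib (Suc i)) / real (fib i)) powr (- expo) \<le> M"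
    if "i \<ge> 44" for i
  proof -
    define v where "v = (real (fib (Suc i)) / real (fib i)) / (real (fib 44) / real (fib 43))"
    have "\<bar>v - 1\<bar> \<le> d" using fib_ratio_close[of 43 i] that unfolding v_def d_def by simp
    moreover have "d \<le> 1/2" by (simp add: d_def f44)
    ultimately have v: "1 - d \<le> v powr (- expo)" "v powr (- expo) \<le> 1 + 2 * d"
      using powr_near_one[of v d expo] expo_bounds by auto
    have eq: "(real (fib (Suc i)) / real (fib i)) powr (- expo) = q * v powr (- expo)"
      unfolding q_def v_def by (subst powr_mult[symmetric]) (auto simp: f44)
    have q': "69933946181059653611098145 / 100000000000000000000000000 \<le> q" "q \<le> 69933946181059653611102121 / 100000000000000000000000000"
      using q by (auto simp: apx_def scale_def abs_le_iff field_simps)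
    have "m \<le> (69933946181059653611098145 / 100000000000000000000000000) * (1 - d)" by (simp add: m_def d_def f44)
    also have "\<dots> \<le> q * v powr (- expo)" using q' v by (intro mult_mono) (auto simp: d_def f44)
    finally show "m \<le> (real (fib (Suc i)) / real (fib i)) powr (- expo)" unfolding eq .
    have "q * v powr (- expo) \<le> (69933946181059653611102121 / 100000000000000000000000000) * (1 + 2 * d)" using q' v by (intro mult_mono) (auto simp: d_def f44)
    also have "\<dots> \<le> M" by (simp add: M_def d_def f44)
    finally show "(real (fib (Suc i)) / real (fib i)) powr (- expo) \<le> M" unfolding eq .
  qed
  have step: "fpow (Suc n) expo = fpow n expo * (real (fib (Suc (Suc n))) / real (fib (Suc n))) powr (- expo)" for n
    unfolding fpow_def using fib_Suc_pos[of n] by (subst powr_mult[symmetric]) auto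
  have tail: "x * m ^ j \<le> fpow (43 + j) expo \<and> fpow (43 + j) expo \<le> x * M ^ j" for j
  proof (induction j)
    case 0
    then show ?case by (simp add: x_def fpow_def)
  next
    case (Suc j)
    have r: "m \<le> (real (fib (Suc (Suc (43 + j)))) / real (fib (Suc (43 + j)))) powr (- expo)"
        "(real (fib (Suc (Suc (43 + j)))) / real (fib (Suc (43 + j)))) powr (- expo) \<le> M"
      by (rule ratio, simp)+
    have "(x * m ^ j) * m \<le> fpow (Suc (43 + j)) expo" unfolding step
      using Suc r mM x0 fpow_pos[of "43 + j" expo] by (intro mult_mono) auto
    moreover have "fpow (Suc (43 + j)) expo \<le> (x * M ^ j) * M" unfolding step
      using Suc r mM x0 fpow_pos[of "43 + j" expo] by (intro mult_mono) auto
    ultimately show ?case by (simp add: mult_ac)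
  qed
  have e0: "expo > 0" using expo_bounds by simp
  have sm: "summable (\<lambda>n. fpow n expo)" by (rule summable_fpow[OF e0])
  have sm': "summable (\<lambda>j. fpow (44 + j) expo)" using sm by (subst (asm) summable_iff_shift[symmetric, of _ 44]) (simp add: add.commute)
  have "(\<Sum>n. fpow n expo) = (\<Sum>j. fpow (j + 44) expo) + (\<Sum>n<44. fpow n expo)"
    by (rule suminf_split_initial_segment[OF sm])
  also have "(\<Sum>n<44. fpow n expo) = S"
    unfolding S_def fpow_def by (rule sum.reindex_bij_witness[of _ "\<lambda>i. i - 1" Suc]) auto
  also have "(\<Sum>j. fpow (j + 44) expo) = (\<Sum>j. fpow (44 + j) expo)" by (simp add: add.commute)
  finally have total: "(\<Sum>n. fpow n expo) = (\<Sum>j. fpow (44 + j) expo) + S" .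
  have geo: "(\<Sum>j. x * y ^ Suc j) = x * (y / (1 - y))" "summable (\<lambda>j. x * y ^ Suc j)" if "0 < y" "y < 1" for y :: real
    using that by (simp_all add: suminf_mult suminf_geometric summable_mult)
  have tl: "x * (m / (1 - m)) \<le> (\<Sum>j. fpow (44 + j) expo)"
    unfolding geo(1)[OF mM(1,2), symmetric] using tail[of "Suc _"] geo(2)[OF mM(1,2)] sm' by (intro suminf_le) auto
  have tu: "(\<Sum>j. fpow (44 + j) expo) \<le> x * (M / (1 - M))"
    unfolding geo(1)[OF mM(3,4), symmetric] using tail[of "Suc _"] geo(2)[OF mM(3,4)] sm' by (intro suminf_le) auto
  have x': "26668463901588408409 / 100000000000000000000000000 \<le> x" "x \<le> 26668463901588408421 / 100000000000000000000000000"
    using x by (auto simp: apx_def scale_def abs_le_iff field_simps)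
  have "62031117567225432223 / 100000000000000000000000000 \<le> (26668463901588408409 / 100000000000000000000000000) * (m / (1 - m))" by (simp add: m_def)
  also have "\<dots> \<le> x * (m / (1 - m))" using x' mM by (intro mult_right_mono) auto
  finally have t1: "62031117567225432223 / 100000000000000000000000000 \<le> (\<Sum>j. fpow (44 + j) expo)" using tl by linarith
  have "x * (M / (1 - M)) \<le> (26668463901588408421 / 100000000000000000000000000) * (M / (1 - M))" using x' mM by (intro mult_right_mono) auto
  also have "\<dots> \<le> 62031117567225438152 / 100000000000000000000000000" by (simp add: M_def)
  finally have t2: "(\<Sum>j. fpow (44 + j) expo) \<le> 62031117567225438152 / 100000000000000000000000000" using tu by linarith
  have G: "Gsum expo = (\<Sum>j. fpow (44 + j) expo) + S - 2 * 144 powr (- expo)"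
    unfolding Gsum_def total by (simp add: fpow_def fib_values)
  show "4 \<le> Gsum expo" "Gsum expo \<le> 4 + 1 / 10000000000000000000"
    using S x12 t1 t2 unfolding G apx_def scale_def by (auto simp: abs_le_iff)
qed

text \<open>Over a step of 10^(-18) the term of 2 alone falls by at least (1/2) * (2/3) * 10^(-18),
  more than the excess of \<open>Gsum expo\<close> over 4. So \<open>Gsum\<close> crosses 4 within
  that step, and only once by monotonicity.\<close>

lemma sigma_F_properties:
  shows "\<exists>!\<sigma>::real. \<sigma> \<in> {0.7<..<0.75} \<and> H_F \<sigma> = 0"
    and "expo \<le> sigma_F" "sigma_F < expo + 1 / 1000000000000000000" "Gsum sigma_F = 4"
proof -
  define b where "b = expo + 1 / 1000000000000000000"
  have b: "0 < expo" "expo < b" "b < 0.75" using expo_bounds by (simp_all add: b_def expo_def)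
  have "2 powr (- expo) - 2 powr (- b) > 1 / 10000000000000000000"
  proof -
    have "2 powr (b - expo) = exp ((b - expo) * ln 2)" by (simp add: powr_def)
    also have "\<dots> \<ge> 1 + (b - expo) * ln 2" by (rule exp_ge_add_one_self)
    finally have 1: "2 powr (b - expo) - 1 \<ge> (b - expo) * ln 2" by simp
    have "ln (2::real) \<ge> 2/3" by (rule ln2_ge_two_thirds)
    hence "(b - expo) * (2/3) \<le> (b - expo) * ln 2" using b by (intro mult_left_mono) auto
    hence 2: "2 / 3000000000000000000 \<le> 2 powr (b - expo) - 1" using 1 by (simp add: b_def)
    have "2 powr (- expo) - 2 powr (- b) = 2 powr (- b) * (2 powr (b - expo) - 1)"
      by (simp add: right_diff_distrib powr_add[symmetric])
    also have "\<dots> \<ge> 2 powr (-1) * (2 / 3000000000000000000)"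
      using 2 b by (intro mult_mono powr_mono) auto
    finally show ?thesis by (simp add: powr_minus)
  qed
  hence Gb: "Gsum b < 4" using Gsum_diff_gt[OF b(1,2)] Gsum_expo_bounds(2) by linarith
  have "\<exists>x\<ge>expo. x \<le> b \<and> Gsum x = 4"
    using b Gb Gsum_expo_bounds(1) by (intro IVT2' continuous_on_subset[OF continuous_on_Gsum]) auto
  then obtain x where x: "expo \<le> x" "x \<le> b" "Gsum x = 4" by blast
  have xr: "x \<in> {0.7<..<0.75}" "x > 0" using x b expo_bounds by auto
  have uniq: "y = x" if "y \<in> {0.7<..<0.75}" "H_F y = 0" for y
  proof -
    have "Gsum y = 4" using that H_F_eq[of y] by (simp del: of_real_diff)
    thus ?thesis using Gsum_strict_antimono[of x y] Gsum_strict_antimono[of y x] x xr that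
      by (cases x y rule: linorder_cases) auto
  qed
  have Hx: "H_F x = 0" using H_F_eq[OF xr(2)] x by simp
  show ex: "\<exists>!\<sigma>::real. \<sigma> \<in> {0.7<..<0.75} \<and> H_F \<sigma> = 0"
    using xr(1) Hx uniq by blast
  have "sigma_F = x" unfolding sigma_F_def
    by (rule the_equality, intro conjI, rule xr(1), rule Hx, elim conjE, rule uniq)
  moreover have "x \<noteq> b" using x Gb by auto
  ultimately show "expo \<le> sigma_F" "sigma_F < expo + 1 / 1000000000000000000" "Gsum sigma_F = 4"
    using x by (auto simp: b_def)
qed

section \<open>Density of the real parts of zeros\<close>

text \<open>Kakeya's greedy choice of signs: the remainder never exceeds the tail of the series.\<close>
lemma signed_sums_exists:
  fixes a :: "nat \<Rightarrow> real"
  assumes nonneg: "\<And>n. 0 \<le> a n" and sm: "summable a"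
    and tail: "\<And>n. a n \<le> (\<Sum>k. a (k + Suc n))" and c: "\<bar>c\<bar> \<le> (\<Sum>k. a k)"
  shows "\<exists>e. (\<forall>n. e n = 1 \<or> e n = - 1) \<and> (\<lambda>n. e n * a n) sums c"
proof -
  define sg :: "real \<Rightarrow> real" where "sg = (\<lambda>x. if x \<ge> 0 then 1 else - 1)"
  define r where "r = rec_nat c (\<lambda>n x. x - sg x * a n)"
  have r: "r 0 = c" "\<And>n. r (Suc n) = r n - sg (r n) * a n" by (simp_all add: r_def)
  define T where "T = (\<lambda>n. \<Sum>k. a (k + n))"
  have T: "T n = a n + T (Suc n)" for n
    unfolding T_def using suminf_split_head[of "\<lambda>k. a (k + n)"] sm by (simp add: summable_iff_shift)
  have inv: "\<bar>r n\<bar> \<le> T n" for n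
  proof (induction n)
    case 0
    then show ?case using c by (simp add: r T_def)
  next
    case (Suc n)
    have "a n \<le> T (Suc n)" using tail by (simp add: T_def)
    then show ?case using Suc T[of n] nonneg[of n] unfolding r by (auto simp: sg_def)
  qed
  have part: "(\<Sum>i<n. sg (r i) * a i) = c - r n" for n
    by (induction n) (simp_all add: r)
  have Teq: "T = (\<lambda>n. (\<Sum>k. a k) - (\<Sum>k<n. a k))"
    unfolding T_def using suminf_minus_initial_segment[OF sm] by (intro ext) simp
  have "(\<lambda>n. (\<Sum>k. a k) - (\<Sum>k<n. a k)) \<longlonglongrightarrow> (\<Sum>k. a k) - (\<Sum>k. a k)"
    by (intro tendsto_intros summable_LIMSEQ sm)
  hence "T \<longlonglongrightarrow> 0" unfolding Teq by simp
  hence "r \<longlonglongrightarrow> 0"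
    by (rule Lim_null_comparison[rotated]) (use inv in auto)
  hence "(\<lambda>n. c - r n) \<longlonglongrightarrow> c - 0" by (intro tendsto_intros)
  hence "(\<lambda>n. sg (r n) * a n) sums c" unfolding sums_def part by simp
  thus ?thesis by (intro exI[of _ "\<lambda>n. sg (r n)"]) (auto simp: sg_def)
qed

text \<open>Since x / y <= 1, the worst exponent is 3/4, for which the claim is an inequality
  between integer powers.\<close>

lemma powr_quotient_le:
  assumes "0 < x" "x \<le> y" "0 < c" "c ^ 4 \<le> (x / y) ^ 3" "0 < \<sigma>" "\<sigma> \<le> 3/4"
  shows "c * x powr (- \<sigma>) \<le> y powr (- \<sigma> :: real)"
proof -
  have xy: "0 < x / y" "x / y \<le> 1" using assms by auto
  have "c = (c ^ 4) powr (1/4)" using assms by (subst power_powr) auto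
  also have "\<dots> \<le> ((x / y) ^ 3) powr (1/4)" using assms by (intro powr_mono2) auto
  also have "\<dots> = (x / y) powr (3/4)" using xy by (subst power_powr) auto
  also have "\<dots> \<le> (x / y) powr \<sigma>" using xy assms by (intro powr_mono') auto
  also have "\<dots> = x powr \<sigma> / y powr \<sigma>" using assms by (simp add: powr_divide)
  finally show ?thesis using assms by (simp add: powr_minus field_simps)
qed

lemma fib_three_le: "m \<ge> 4 \<Longrightarrow> 3 * fib (Suc m) \<le> 5 * fib m"
proof -
  assume "m \<ge> 4"
  then obtain k where m: "m = Suc (Suc (Suc (Suc k)))" by (auto dest!: le_Suc_ex simp: eval_nat_numeral)
  have "fib (Suc k) \<ge> fib k" by (rule fib_Suc_mono)
  thus ?thesis unfolding m by simp
qed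

text \<open>The indices of 1, 1, 2, 3, 8, 144, shifted by one as in \<open>Z_F\<close>.\<close>
definition dep_index :: "nat set" where "dep_index = {0, 1, 2, 3, 5, 11}"

definition free_term :: "real \<Rightarrow> nat \<Rightarrow> real" where
  "free_term \<sigma> n = (if n \<in> dep_index then 0 else fpow n \<sigma>)"

lemma free_term_bounds: "0 \<le> free_term \<sigma> n" "free_term \<sigma> n \<le> fpow n \<sigma>"
  using fpow_pos[of n \<sigma>] by (auto simp: free_term_def)

lemma summable_free_term: "\<sigma> > 0 \<Longrightarrow> summable (free_term \<sigma>)"
  using free_term_bounds
  by (intro summable_comparison_test'[OF summable_fpow, where N = 0]) auto

text \<open>The condition for the greedy choice, with the dependent terms deleted. Usually the next
  two terms suffice (0.66 + 0.45 > 1). After 5, 55 and 89 one of these is 8 or 144; there 13, 21,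
  34, then 89, 233, then 233, 377, 610 are used instead.\<close>

lemma free_term_le_tail:
  assumes \<sigma>: "0 < \<sigma>" "\<sigma> \<le> 3/4"
  shows "free_term \<sigma> n \<le> (\<Sum>k. free_term \<sigma> (k + Suc n))"
proof -
  have sm: "summable (\<lambda>k. free_term \<sigma> (k + Suc n))"
    using summable_free_term[OF \<sigma>(1)] by (rule summable_ignore_initial_segment)
  define tl where "tl = (\<Sum>k. free_term \<sigma> (k + Suc n))"
  have part: "(\<Sum>k\<in>A. free_term \<sigma> (k + Suc n)) \<le> tl" if "finite A" for A
    unfolding tl_def using sm that by (intro sum_le_suminf) (auto simp: free_term_bounds)
  have nn: "tl \<ge> 0" unfolding tl_def using sm free_term_bounds by (intro suminf_nonneg) auto
  note pq = powr_quotient_le[OF _ _ _ _ \<sigma>]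
  consider "n \<in> dep_index" | "n = 4" | "n = 9" | "n = 10" | "n \<notin> dep_index" "n \<noteq> 4" "n \<noteq> 9" "n \<noteq> 10" by blast
  hence "free_term \<sigma> n \<le> tl"
  proof cases
    case 1
    thus ?thesis using nn by (simp add: free_term_def)
  next
    case 2
    have "(48/100) * 5 powr (- \<sigma>) \<le> 13 powr (- \<sigma>)" "(34/100) * 5 powr (- \<sigma>) \<le> 21 powr (- \<sigma>)" "(23/100) * 5 powr (- \<sigma>) \<le> 34 powr (- \<sigma>)"
      by (rule pq; simp add: power_divide)+
    moreover have "(5::real) powr (- \<sigma>) > 0" by simp
    moreover have "13 powr (- \<sigma>) + 21 powr (- \<sigma>) + 34 powr (- \<sigma>) \<le> tl" using part[of "{1,2,3}"] 2
      by (simp add: free_term_def dep_index_def fpow_def fib_values)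
    ultimately have "5 powr (- \<sigma>) \<le> tl" by linarith
    thus ?thesis using 2 by (simp add: free_term_def dep_index_def fpow_def fib_values)
  next
    case 3
    have "(69/100) * 55 powr (- \<sigma>) \<le> 89 powr (- \<sigma>)" "(33/100) * 55 powr (- \<sigma>) \<le> 233 powr (- \<sigma>)"
      by (rule pq; simp add: power_divide)+
    moreover have "(55::real) powr (- \<sigma>) > 0" by simp
    moreover have "89 powr (- \<sigma>) + 233 powr (- \<sigma>) \<le> tl" using part[of "{0,2}"] 3
      by (simp add: free_term_def dep_index_def fpow_def fib_values)
    ultimately have "55 powr (- \<sigma>) \<le> tl" by linarith
    thus ?thesis using 3 by (simp add: free_term_def dep_index_def fpow_def fib_values)
  next
    case 4
    have "(48/100) * 89 powr (- \<sigma>) \<le> 233 powr (- \<sigma>)" "(33/100) * 89 powr (- \<sigma>) \<le> 377 powr (- \<sigma>)" "(23/100) * 89 powr (- \<sigma>) \<le> 610 powr (- \<sigma>)"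
      by (rule pq; simp add: power_divide)+
    moreover have "(89::real) powr (- \<sigma>) > 0" by simp
    moreover have "233 powr (- \<sigma>) + 377 powr (- \<sigma>) + 610 powr (- \<sigma>) \<le> tl" using part[of "{1,2,3}"] 4
      by (simp add: free_term_def dep_index_def fpow_def fib_values)
    ultimately have "89 powr (- \<sigma>) \<le> tl" by linarith
    thus ?thesis using 4 by (simp add: free_term_def dep_index_def fpow_def fib_values)
  next
    case 5
    hence n: "n > 5" "Suc n \<notin> dep_index" "Suc (Suc n) \<notin> dep_index" by (auto simp: dep_index_def)
    define x y z where "x = real (fib (Suc n))" and "y = real (fib (Suc (Suc n)))" and "z = real (fib (Suc (Suc (Suc n))))"
    have pos: "x > 0" "y > 0" "z > 0" unfolding x_def y_def z_def by (simp_all only: of_nat_0_less_iff fib_Suc_pos)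
    have "3 * y \<le> 5 * x" using fib_three_le[of "Suc n"] n(1) unfolding x_def y_def by linarith
    moreover have z: "z = y + x" unfolding x_def y_def z_def by simp
    ultimately have "3/5 \<le> x / y" "3/8 \<le> x / z" using pos by (auto simp: field_simps)
    hence "(3/5) ^ 3 \<le> (x / y) ^ 3" "(3/8) ^ 3 \<le> (x / z) ^ 3" by (intro power_mono; simp)+
    moreover have "(66/100::real) ^ 4 \<le> (3/5) ^ 3" "(45/100::real) ^ 4 \<le> (3/8) ^ 3" by (simp_all add: power_divide)
    moreover have "x \<le> y" unfolding x_def y_def by (simp add: fib_Suc_mono)
    ultimately have "(66/100) * x powr (- \<sigma>) \<le> y powr (- \<sigma>)" "(45/100) * x powr (- \<sigma>) \<le> z powr (- \<sigma>)"
      using pos z by (intro pq; linarith)+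
    moreover have "x powr (- \<sigma>) > 0" using pos by simp
    moreover have "y powr (- \<sigma>) + z powr (- \<sigma>) \<le> tl"
      using part[of "{0,1}"] n by (simp add: free_term_def fpow_def y_def z_def)
    ultimately have "x powr (- \<sigma>) \<le> tl" by linarith
    thus ?thesis using 5(1) by (simp add: free_term_def fpow_def x_def)
  qed
  thus ?thesis by (simp only: tl_def)
qed

text \<open>The signs are forced at 1, 1, 2, 3, 8, 144; the remaining ones are free by Carmichael's theorem.\<close>
lemma sign_pattern_exists:
  assumes \<sigma>: "0 < \<sigma>" "\<sigma> \<le> sigma_F"
  shows "\<exists>w :: nat \<Rightarrow> real. (\<forall>n. w n = 1 \<or> w n = - 1) \<and> w 0 = 1 \<and> w 1 = 1 \<and> w 2 = - 1 \<and> w 3 = - 1 \<and> w 5 = - 1 \<and> w 11 = 1 \<and>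
     (\<lambda>n. w n * fpow n \<sigma>) sums 0"
proof -
  have sF: "sigma_F < 3/4" using sigma_F_properties(3) expo_bounds by (simp add: expo_def)
  have s34: "\<sigma> \<le> 3/4" using \<sigma> sF by simp
  define D where "D = (\<lambda>n. if n \<in> dep_index then fpow n \<sigma> else 0)"
  define w0 :: "nat \<Rightarrow> real" where "w0 = (\<lambda>n. if n \<in> {2,3,5} then - 1 else 1)"
  define c where "c = (\<Sum>n\<in>dep_index. w0 n * fpow n \<sigma>)"
  have fin: "finite dep_index" by (simp add: dep_index_def)
  have sumdep: "(\<Sum>n\<in>dep_index. g n) = g 0 + g 1 + g 2 + g 3 + g 5 + g 11" for g :: "nat \<Rightarrow> real"
    by (simp add: dep_index_def)
  have fp: "fpow 0 \<sigma> = 1" "fpow 1 \<sigma> = 1" "fpow 2 \<sigma> = 2 powr (- \<sigma>)" "fpow 3 \<sigma> = 3 powr (- \<sigma>)" "fpow 4 \<sigma> = 5 powr (- \<sigma>)" "fpow 5 \<sigma> = 8 powr (- \<sigma>)" "fpow 11 \<sigma> = 144 powr (- \<sigma>)"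
    by (simp_all add: fpow_def fib_values)
  have c: "c = 2 - 2 powr (- \<sigma>) - 3 powr (- \<sigma>) - 8 powr (- \<sigma>) + 144 powr (- \<sigma>)"
    unfolding c_def sumdep using fp by (simp add: w0_def)
  have Dsums: "D sums (\<Sum>n\<in>dep_index. fpow n \<sigma>)"
    unfolding D_def using sums_If_finite_set[OF fin, of "\<lambda>n. fpow n \<sigma>"] by simp
  have "(\<lambda>n. free_term \<sigma> n + D n) sums ((\<Sum>n. free_term \<sigma> n) + (\<Sum>n\<in>dep_index. fpow n \<sigma>))"
    by (intro sums_add summable_sums summable_free_term \<sigma> Dsums)
  also have "(\<lambda>n. free_term \<sigma> n + D n) = (\<lambda>n. fpow n \<sigma>)" by (auto simp: free_term_def D_def)
  finally have total: "(\<Sum>n. fpow n \<sigma>) = (\<Sum>n. free_term \<sigma> n) + (\<Sum>n\<in>dep_index. fpow n \<sigma>)" by (simp add: sums_iff)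
  \<comment> \<open>The inequality \<open>Gsum \<sigma> \<ge> 4\<close> says exactly that the free
    terms can outweigh the forced part \<open>c\<close>; this is what makes \<open>sigma_F\<close>
    the limit of the construction.\<close>
  have "Gsum \<sigma> \<ge> 4"
    using Gsum_strict_antimono[OF \<sigma>(1), of sigma_F] \<sigma>(2) sigma_F_properties(4) by (cases "\<sigma> = sigma_F") auto
  hence c1: "c \<le> (\<Sum>n. free_term \<sigma> n)"
    using total unfolding Gsum_def sumdep c fp by linarith
  \<comment> \<open>For the other sign, the terms of 2 and 3 are at most 1 each, so -c is at most
    the term of 8, which is below the free term of 5.\<close>
  have "2 powr (- \<sigma>) \<le> 2 powr 0" "3 powr (- \<sigma>) \<le> 3 powr 0" using \<sigma> by (intro powr_mono; simp)+
  hence "2 powr (- \<sigma>) \<le> 1" "3 powr (- \<sigma>) \<le> 1" by simp_all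
  moreover have "8 powr (- \<sigma>) \<le> 5 powr (- \<sigma>)" using \<sigma> by (intro powr_mono2') auto
  moreover have "5 powr (- \<sigma>) = free_term \<sigma> 4" by (simp add: free_term_def dep_index_def fp)
  moreover have "free_term \<sigma> 4 \<le> (\<Sum>n. free_term \<sigma> n)"
    using sum_le_suminf[OF summable_free_term[OF \<sigma>(1)], of "{4}"] free_term_bounds by simp
  moreover have "144 powr (- \<sigma>) > 0" by simp
  ultimately have c2: "- c \<le> (\<Sum>n. free_term \<sigma> n)" unfolding c by linarith
  have "\<bar>- c\<bar> \<le> (\<Sum>n. free_term \<sigma> n)" using c1 c2 by (simp add: abs_le_iff)
  from signed_sums_exists[OF free_term_bounds(1) summable_free_term[OF \<sigma>(1)] free_term_le_tail[OF \<sigma>(1) s34] this]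
  obtain e where e: "\<forall>n. e n = 1 \<or> e n = - 1" "(\<lambda>n. e n * free_term \<sigma> n) sums (- c)" by blast
  define w where "w = (\<lambda>n. if n \<in> dep_index then w0 n else e n)"
  have "(\<lambda>n. e n * free_term \<sigma> n + (if n \<in> dep_index then w0 n * fpow n \<sigma> else 0)) sums (- c + c)"
    unfolding c_def[symmetric]
    using sums_add[OF e(2) sums_If_finite_set[OF fin, of "\<lambda>n. w0 n * fpow n \<sigma>"]] by (simp add: c_def)
  also have "(\<lambda>n. e n * free_term \<sigma> n + (if n \<in> dep_index then w0 n * fpow n \<sigma> else 0)) = (\<lambda>n. w n * fpow n \<sigma>)"
    by (auto simp: w_def free_term_def)
  finally have "(\<lambda>n. w n * fpow n \<sigma>) sums 0" by simp
  moreover have "\<forall>n. w n = 1 \<or> w n = - 1" using e by (auto simp: w_def w0_def)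
  ultimately show ?thesis by (intro exI[of _ w]) (auto simp: w_def w0_def dep_index_def)
qed

section \<open>Realising sign patterns by vertical translates\<close>

lemma norm_cis_minus_one_sq: "(norm (cis x - 1))\<^sup>2 = 2 * (1 - cos x)"
proof -
  have "(norm (cis x - 1))\<^sup>2 = (cos x - 1)\<^sup>2 + (sin x)\<^sup>2" by (simp add: cmod_power2)
  also have "\<dots> = (sin x)\<^sup>2 + (cos x)\<^sup>2 + 1 - 2 * cos x" by (simp add: power2_eq_square algebra_simps)
  finally show ?thesis by simp
qed

lemma norm_cis_diff_le: "norm (cis x - cis y) \<le> \<bar>x - y\<bar>"
proof -
  have "cis x - cis y = cis y * (cis (x - y) - 1)" by (simp add: right_diff_distrib cis_mult)
  hence 1: "norm (cis x - cis y) = norm (cis (x - y) - 1)" by (simp add: norm_mult)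
  have "\<bar>sin ((x - y) / 2)\<bar> \<le> \<bar>(x - y) / 2\<bar>" by (rule abs_sin_x_le_abs_x)
  from power_mono[OF this, of 2] have "(sin ((x - y) / 2))\<^sup>2 \<le> ((x - y) / 2)\<^sup>2" by (simp add: power_divide)
  moreover have "1 - cos (x - y) = 2 * (sin ((x - y) / 2))\<^sup>2" proof -
    have "2 * ((x - y) / 2) = x - y" by simp
    thus ?thesis using cos_double_sin[of "(x - y) / 2"] by (simp only:)
  qed
  ultimately have "(norm (cis (x - y) - 1))\<^sup>2 \<le> \<bar>x - y\<bar>\<^sup>2"
    unfolding norm_cis_minus_one_sq by (simp add: power_divide)
  thus ?thesis unfolding 1 by (rule power2_le_imp_le) simp
qed

text \<open>The multiplier t is real, so Kronecker's theorem asks only for independence of the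
  logarithms over the integers; dividing them by 2 pi turns phases into distances to
  integers.\<close>

lemma fib_kronecker:
  assumes J: "finite J" "\<And>n. n \<in> J \<Longrightarrow> n \<ge> 3 \<and> n \<noteq> 6 \<and> n \<noteq> 12" and "\<epsilon> > 0"
  shows "\<exists>t h. \<forall>n\<in>J. \<bar>t * ln (real (fib n)) - 2 * pi * (of_int (h n) + \<alpha> n)\<bar> < \<epsilon>"
proof -
  interpret R: Modules.module "(\<lambda>r. (*) (real_of_int r))"
    by (simp add: Modules.module.intro distrib_left mult.commute)
  obtain b where b: "bij_betw b {..<card J} J"
    using ex_bij_betw_nat_finite[OF J(1)] by (auto simp: atLeast0LessThan)
  define L where "L = (\<lambda>n. ln (real (fib n)) / (2 * pi))"
  have inj: "inj_on L J"
  proof (rule inj_onI)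
    fix m n assume mn: "m \<in> J" "n \<in> J" "L m = L n"
    hence eq: "ln (real (fib m)) = ln (real (fib n))" by (simp add: L_def)
    show "m = n"
    proof (rule ccontr)
      assume "m \<noteq> n"
      moreover have "(\<Sum>k\<in>{m, n}. of_int (if k = m then 1 else - 1) * ln (real (fib k))) = 0"
        using \<open>m \<noteq> n\<close> eq by simp
      ultimately show False
        using ln_fib_independent[of "{m, n}" "\<lambda>k. if k = m then 1 else - 1"] mn J(2) by auto
    qed
  qed
  have ind: "R.independent (L ` J)"
    unfolding R.independent_explicit_module
  proof (intro allI impI)
    fix T u v assume T: "finite T" "T \<subseteq> L ` J" "(\<Sum>v\<in>T. real_of_int (u v) * v) = 0" "v \<in> T"
    obtain A where A: "A \<subseteq> J" "T = L ` A" using T(2) by (meson subset_imageE)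
    have injA: "inj_on L A" using inj A(1) inj_on_subset by blast
    have finA: "finite A" using A(1) J(1) finite_subset by blast
    have "(\<Sum>n\<in>A. of_int (u (L n)) * L n) = 0"
      using T(3) unfolding A(2) by (simp add: sum.reindex[OF injA])
    hence "(\<Sum>n\<in>A. of_int (u (L n)) * ln (real (fib n))) = 0"
      by (simp add: L_def flip: sum_divide_distrib)
    hence "\<forall>n\<in>A. u (L n) = 0"
      by (intro ln_fib_independent finA) (use A J in auto)
    thus "u v = 0" using T(4) A(2) by auto
  qed
  have bJ: "b ` {..<card J} = J" using b by (simp add: bij_betw_def)
  have "\<epsilon> / (2 * pi) > 0" using assms by simp
  then obtain t h where th: "\<And>i. i < card J \<Longrightarrow> \<bar>t * L (b i) - of_int (h i) - \<alpha> (b i)\<bar> < \<epsilon> / (2 * pi)"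
  proof (rule Kronecker_thm_1[rotated 2, where \<theta> = "\<lambda>i. L (b i)" and n = "card J" and \<alpha> = "\<lambda>i. \<alpha> (b i)"])
    show "R.independent ((\<lambda>i. L (b i)) ` {..<card J})"
      using ind bJ by (simp add: image_image[symmetric])
    show "inj_on (\<lambda>i. L (b i)) {..<card J}"
      using comp_inj_on[of b "{..<card J}" L] b inj bJ by (simp add: bij_betw_def comp_def)
  qed blast
  define h' where "h' = (\<lambda>n. h (the_inv_into {..<card J} b n))"
  have "\<bar>t * ln (real (fib n)) - 2 * pi * (of_int (h' n) + \<alpha> n)\<bar> < \<epsilon>" if "n \<in> J" for n
  proof -
    have "n \<in> b ` {..<card J}" unfolding bJ by (rule that)
    then obtain i where i: "i < card J" "b i = n" by (elim imageE) simp
    have "h' n = h i" unfolding h'_def using i b by (metis bij_betw_def lessThan_iff the_inv_into_f_f)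
    hence "\<bar>t * L n - of_int (h' n) - \<alpha> n\<bar> < \<epsilon> / (2 * pi)" using th[OF i(1)] i(2) by simp
    hence "2 * pi * \<bar>t * L n - of_int (h' n) - \<alpha> n\<bar> < \<epsilon>" by (simp add: field_simps)
    moreover have "2 * pi * \<bar>t * L n - of_int (h' n) - \<alpha> n\<bar> = \<bar>2 * pi * (t * L n - of_int (h' n) - \<alpha> n)\<bar>"
      by (simp add: abs_mult)
    moreover have "2 * pi * (t * L n - of_int (h' n) - \<alpha> n) = t * ln (real (fib n)) - 2 * pi * (of_int (h' n) + \<alpha> n)"
      by (simp add: L_def algebra_simps)
    ultimately show ?thesis by simp
  qed
  thus ?thesis by blast
qed

text \<open>A sign pattern with the right values at 8 = 2^3 and 144 = 2^4 * 3^2 is approximated by the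
  phases of a vertical translate.\<close>
lemma phases_approximate_signs:
  fixes w :: "nat \<Rightarrow> real"
  assumes w: "\<And>n. w n = 1 \<or> w n = - 1" "w 0 = 1" "w 1 = 1" "w 2 = - 1" "w 3 = - 1" "w 5 = - 1" "w 11 = 1"
    and "\<epsilon> > 0"
  shows "\<exists>t. \<forall>n<N. norm (cis (- (t * ln (real (fib (Suc n))))) - of_real (w n)) \<le> \<epsilon>"
proof -
  define \<alpha> where "\<alpha> = (\<lambda>n. if w (n - 1) = 1 then 0 else 1/2 :: real)"
  \<comment> \<open>3 and 4 belong to \<open>J\<close> even for small \<open>N\<close>, since the
    phases of 8 and 144 are computed from those of 2 and 3.\<close>
  define J where "J = insert 3 (insert 4 {n. 3 \<le> n \<and> n \<le> N \<and> n \<noteq> 6 \<and> n \<noteq> 12})"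
  have "finite J" by (rule finite_subset[of _ "{..max N 4}"]) (auto simp: J_def)
  moreover have "\<And>n. n \<in> J \<Longrightarrow> n \<ge> 3 \<and> n \<noteq> 6 \<and> n \<noteq> 12" by (auto simp: J_def)
  \<comment> \<open>144 = 2^4 * 3^2 magnifies the error by up to 4 + 2.\<close>
  moreover have "\<epsilon> / 6 > 0" using assms by simp
  ultimately have "\<exists>t h. \<forall>n\<in>J. \<bar>t * ln (real (fib n)) - 2 * pi * (of_int (h n) + \<alpha> n)\<bar> < \<epsilon> / 6"
    by (rule fib_kronecker)
  then obtain t h where th: "\<And>n. n \<in> J \<Longrightarrow> \<bar>t * ln (real (fib n)) - 2 * pi * (of_int (h n) + \<alpha> n)\<bar> < \<epsilon> / 6"
    by blast
  have cis_w: "cis (- (2 * pi * (of_int k + (if w n = 1 then 0 else 1/2)))) = of_real (w n)" for k n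
  proof -
    have "cis (- (2 * pi * (of_int k + (if w n = 1 then 0 else 1/2)))) =
        cis (2 * pi * of_int (- k)) * cis (- (if w n = 1 then 0 else pi))"
      unfolding cis_mult by (intro arg_cong[of _ _ cis]) (auto simp: algebra_simps)
    also have "\<dots> = of_real (w n)" using w(1)[of n] by (auto simp: cis_multiple_2pi complex_eq_iff)
    finally show ?thesis .
  qed
  have main: "norm (cis (- (t * ln (real (fib (Suc n))))) - of_real (w n)) \<le> \<epsilon>"
    if "\<bar>t * ln (real (fib (Suc n))) - 2 * pi * (of_int k + (if w n = 1 then 0 else 1/2))\<bar> \<le> \<epsilon>" for n k
    unfolding cis_w[of k n, symmetric] by (rule order_trans[OF norm_cis_diff_le]) (use that in linarith)
  have f: "real (fib (Suc 5)) = 2 ^ 3" "real (fib (Suc 11)) = 2 ^ 4 * 3 ^ 2" "fib 3 = 2" "fib 4 = 3" by (simp_all add: fib_values)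
  have a: "\<alpha> 3 = 1/2" "\<alpha> 4 = 1/2" using w by (simp_all add: \<alpha>_def)
  have t2: "\<bar>t * ln 2 - 2 * pi * (of_int (h 3) + 1/2)\<bar> < \<epsilon> / 6" and t3: "\<bar>t * ln 3 - 2 * pi * (of_int (h 4) + 1/2)\<bar> < \<epsilon> / 6"
    using th[of 3] th[of 4] by (simp_all add: J_def f a)
  have arith3: "\<bar>a\<bar> \<le> \<epsilon>" if "a = 3 * b" "\<bar>b\<bar> < \<epsilon> / 6" for a b :: real
    using that by linarith
  have arith6: "\<bar>a\<bar> \<le> \<epsilon>" if "a = 4 * b + 2 * c" "\<bar>b\<bar> < \<epsilon> / 6" "\<bar>c\<bar> < \<epsilon> / 6" for a b c :: real
    using that by linarith
  have "norm (cis (- (t * ln (real (fib (Suc n))))) - of_real (w n)) \<le> \<epsilon>" if "n < N" for n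
  proof -
    have "n = 0 \<or> n = 1 \<or> n = 5 \<or> n = 11 \<or> Suc n \<in> J" using that by (auto simp: J_def)
    then consider "n = 0 \<or> n = 1" | "n = 5" | "n = 11" | "Suc n \<in> J" by blast
    thus ?thesis
    proof cases
      case 1
      thus ?thesis using w(2,3) \<open>\<epsilon> > 0\<close> by auto
    next
      case 2
      have "ln (2 ^ 3 :: real) = 3 * ln 2" using ln_realpow[of 2 3] by simp
      \<comment> \<open>3 (h + 1/2) is again a half-integer, so 8 inherits sign -1; for 144 below, 4
        (h + 1/2) + 2 (h' + 1/2) is an integer, giving sign +1.\<close>
      hence "t * ln (2 ^ 3) - 2 * pi * (of_int (3 * h 3 + 1) + 1/2) = 3 * (t * ln 2 - 2 * pi * (of_int (h 3) + 1/2))"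
        by (simp only:) (simp add: algebra_simps)
      hence "\<bar>t * ln (2 ^ 3) - 2 * pi * (of_int (3 * h 3 + 1) + 1/2)\<bar> \<le> \<epsilon>" by (rule arith3[OF _ t2])
      moreover have "w 5 \<noteq> 1" using w by simp
      ultimately show ?thesis unfolding 2 by (intro main[of 5 "3 * h 3 + 1"]) (simp only: f if_False)
    next
      case 3
      have "ln (2 ^ 4 * 3 ^ 2 :: real) = 4 * ln 2 + 2 * ln 3"
        using ln_mult_pos[of "2^4" "3^2"] ln_realpow[of 2 4] ln_realpow[of 3 2] by simp
      hence "t * ln (2 ^ 4 * 3 ^ 2) - 2 * pi * (of_int (4 * h 3 + 2 * h 4 + 3) + 0) =
          4 * (t * ln 2 - 2 * pi * (of_int (h 3) + 1/2)) + 2 * (t * ln 3 - 2 * pi * (of_int (h 4) + 1/2))"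
        by (simp only:) (simp add: algebra_simps)
      hence "\<bar>t * ln (2 ^ 4 * 3 ^ 2) - 2 * pi * (of_int (4 * h 3 + 2 * h 4 + 3) + 0)\<bar> \<le> \<epsilon>" by (rule arith6[OF _ t2 t3])
      moreover have "w 11 = 1" using w by simp
      ultimately show ?thesis unfolding 3 by (intro main[of 11 "4 * h 3 + 2 * h 4 + 3"]) (simp only: f if_True simp_thms)
    next
      case 4
      have "\<bar>t * ln (real (fib (Suc n))) - 2 * pi * (of_int (h (Suc n)) + \<alpha> (Suc n))\<bar> \<le> \<epsilon>"
        using th[OF 4] \<open>\<epsilon> > 0\<close> by linarith
      thus ?thesis by (intro main[of n "h (Suc n)"]) (simp add: \<alpha>_def)
    qed
  qed
  thus ?thesis by blast
qed

lemma fib_series_shift: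
  "fib_series (\<lambda>n. cis (- (t * ln (real (fib (Suc n)))))) s = Z_F (s + \<i> * of_real t)"
  unfolding fib_series_def Z_F_def
proof (intro suminf_cong)
  fix n
  have "cis (- (t * ln (fib (Suc n)))) * cis (- (Im s * ln (fib (Suc n)))) = cis (- ((Im s + t) * ln (fib (Suc n))))"
    unfolding cis_mult by (rule arg_cong[of _ _ cis]) (simp add: algebra_simps)
  thus "cis (- (t * ln (fib (Suc n)))) * of_nat (fib (Suc n)) powr (- s) = of_nat (fib (Suc n)) powr (- (s + \<i> * of_real t))"
    unfolding fib_powr_polar by (simp add: mult_ac)
qed

lemma fib_series_diff_le:
  assumes v: "\<And>n. norm (v n) \<le> 1" and w: "\<And>n. norm (w n) \<le> 1"
    and e0: "0 \<le> \<epsilon>" and \<delta>: "0 < \<delta>" "\<delta> \<le> Re s" and close: "\<And>n. n < N \<Longrightarrow> norm (v n - w n) \<le> \<epsilon>"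
  shows "norm (fib_series v s - fib_series w s) \<le> \<epsilon> * (\<Sum>n. fpow n \<delta>) + 2 * (\<Sum>n. fpow (n + N) \<delta>)"
proof -
  define f where "f = (\<lambda>n. (v n - w n) * of_nat (fib (Suc n)) powr (- s))"
  have Re: "Re s > 0" using \<delta> by simp
  have sm: "summable (\<lambda>n. v n * of_nat (fib (Suc n)) powr (- s))" "summable (\<lambda>n. w n * of_nat (fib (Suc n)) powr (- s))"
    by (rule summable_fib_series, rule v, rule Re, rule summable_fib_series, rule w, rule Re)
  have diff: "fib_series v s - fib_series w s = suminf f"
    unfolding fib_series_def f_def by (subst suminf_diff[OF sm]) (simp add: left_diff_distrib)
  have nf: "norm (f n) = norm (v n - w n) * fpow n (Re s)" for n by (simp add: f_def norm_mult norm_fib_powr)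
  have fle: "fpow n (Re s) \<le> fpow n \<delta>" for n using \<delta>(2) by (rule fpow_antimono)
  have vw: "norm (v n - w n) \<le> 2" for n
    using norm_triangle_ineq4[of "v n" "w n"] v[of n] w[of n] by linarith
  have b2: "norm (f n) \<le> 2 * fpow n \<delta>" for n
    unfolding nf using vw[of n] fle[of n] fpow_pos[of n "Re s"] by (intro mult_mono) auto
  have smd: "summable (\<lambda>n. fpow n \<delta>)" using \<delta> by (intro summable_fpow)
  have smf: "summable f"
    by (rule summable_comparison_test'[where N = 0 and g = "\<lambda>n. 2 * fpow n \<delta>"]) (use b2 smd in \<open>auto intro: summable_mult\<close>)
  have "suminf f = (\<Sum>n. f (n + N)) + (\<Sum>n<N. f n)" by (rule suminf_split_initial_segment[OF smf])
  hence "norm (suminf f) \<le> norm (\<Sum>n. f (n + N)) + norm (\<Sum>n<N. f n)" by (simp add: norm_triangle_ineq)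
  moreover have "norm (\<Sum>n. f (n + N)) \<le> (\<Sum>n. 2 * fpow (n + N) \<delta>)"
    by (rule norm_suminf_le) (use b2 smd in \<open>auto intro!: summable_mult summable_ignore_initial_segment\<close>)
  moreover have "(\<Sum>n. 2 * fpow (n + N) \<delta>) = 2 * (\<Sum>n. fpow (n + N) \<delta>)"
    using smd by (intro suminf_mult summable_ignore_initial_segment)
  moreover have "norm (\<Sum>n<N. f n) \<le> \<epsilon> * (\<Sum>n. fpow n \<delta>)"
  proof -
    have "norm (\<Sum>n<N. f n) \<le> (\<Sum>n<N. \<epsilon> * fpow n \<delta>)"
    proof (rule sum_norm_le)
      fix n assume "n \<in> {..<N}"
      thus "norm (f n) \<le> \<epsilon> * fpow n \<delta>"
        unfolding nf using close[of n] fle[of n] fpow_pos[of n "Re s"] e0 by (intro mult_mono) auto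
    qed
    also have "\<dots> = \<epsilon> * (\<Sum>n<N. fpow n \<delta>)" by (simp add: sum_distrib_left)
    also have "\<dots> \<le> \<epsilon> * (\<Sum>n. fpow n \<delta>)"
      using e0 smd fpow_pos by (intro mult_left_mono sum_le_suminf) (auto intro: less_imp_le)
    finally show ?thesis .
  qed
  ultimately show ?thesis unfolding diff by linarith
qed

text \<open>Hurwitz's theorem requires a nonconstant limit. By continuation the series would vanish
  at sigma_F + 1. There every term from index 2 on is at most half its value at
  \<open>sigma_F\<close>, so these total at most 1 + 144^(-sigma_F) < 2 and cannot cancel the two
  initial ones.\<close>

lemma sign_series_not_constant:
  fixes w :: "nat \<Rightarrow> real"
  assumes w: "\<And>n. w n = 1 \<or> w n = - 1" "w 0 = 1" "w 1 = 1"
    and S: "open S" "S \<noteq> {}" "S \<subseteq> {s. Re s > 0}" and zero: "\<And>s. s \<in> S \<Longrightarrow> fib_series (\<lambda>n. of_real (w n)) s = 0"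
  shows False
proof -
  have nw: "norm (of_real (w n) :: complex) \<le> 1" for n using w(1)[of n] by auto
  define g where "g = fib_series (\<lambda>n. of_real (w n))"
  have hol: "g holomorphic_on {s. Re s > 0}" unfolding g_def by (rule holomorphic_fib_series[OF nw])
  define x where "x = sigma_F + 1"
  have sF: "sigma_F > 0" using sigma_F_properties(2) expo_bounds by simp
  have "g (of_real x) = 0"
  proof (rule analytic_continuation_open[of S "{s. Re s > 0}" g "\<lambda>_. 0", simplified])
    show "connected {s. 0 < Re s}" by (intro convex_connected convex_halfspace_Re_gt)
    show "open {s. 0 < Re s}" by (rule open_halfspace_Re_gt)
  qed (use S zero hol sF in \<open>auto simp: g_def x_def\<close>)
  hence "(\<lambda>n. of_real (w n) * of_nat (fib (Suc n)) powr (- of_real x) :: complex) sums 0"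
    using summable_sums[OF summable_fib_series[of "\<lambda>n. of_real (w n)" "of_real x"]] nw sF
    by (simp add: g_def fib_series_def x_def)
  from sums_Re[OF this] have wsum: "(\<lambda>n. w n * fpow n x) sums 0" by (simp add: fib_powr_polar)
  have smF: "summable (\<lambda>n. fpow n sigma_F)" by (rule summable_fpow[OF sF])
  have half: "fpow n x \<le> (1/2) * fpow n sigma_F" if "n \<ge> 2" for n
  proof -
    have "fib 3 \<le> fib (Suc n)" by (rule fib_mono) (use that in simp)
    hence "real (fib (Suc n)) \<ge> 2" by (simp add: fib_values)
    moreover have "fpow n x = fpow n sigma_F * (1 / real (fib (Suc n)))"
      unfolding fpow_def x_def using fib_Suc_pos[of n] by (simp add: powr_diff)
    moreover have "fpow n sigma_F * (1 / real (fib (Suc n))) \<le> fpow n sigma_F * (1 / 2)"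
      using calculation(1) fpow_pos[of n sigma_F] by (intro mult_left_mono frac_le) auto
    ultimately show ?thesis by simp
  qed
  have sumF: "(\<Sum>n. fpow n sigma_F) = 4 + 2 * 144 powr (- sigma_F)"
    using sigma_F_properties(4) by (simp add: Gsum_def fpow_def fib_values)
  have p144: "144 powr (- sigma_F) < 1" using sF by (simp add: powr_less_one)
  define u where "u = (\<lambda>n. w n * fpow n x + (1/2) * fpow n sigma_F)"
  have us: "u sums (0 + (1/2) * (\<Sum>n. fpow n sigma_F))"
    unfolding u_def by (intro sums_add wsum sums_mult summable_sums smF)
  have "u n \<ge> 0" for n
  proof (cases "n = 0 \<or> n = 1")
    case True
    thus ?thesis using w fpow_pos[of n x] fpow_pos[of n sigma_F] by (auto simp: u_def)
  next
    case False
    hence "n \<ge> 2" by auto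
    thus ?thesis using half[of n] w(1)[of n] fpow_pos[of n x] by (auto simp: u_def)
  qed
  hence "(\<Sum>n\<in>{0,1}. u n) \<le> suminf u" using us by (intro sum_le_suminf) (auto simp: sums_iff)
  moreover have "u 0 = 3/2" "u 1 = 3/2" using w by (simp_all add: u_def fpow_def)
  moreover have "suminf u = 2 + 144 powr (- sigma_F)" using us sumF by (simp add: sums_iff)
  ultimately show False using p144 by simp
qed

lemma zeros_near:
  assumes \<sigma>: "0 < \<sigma>" "\<sigma> \<le> sigma_F" and r: "0 < r" "r < \<sigma>"
  shows "\<exists>\<rho>. Z_F \<rho> = 0 \<and> \<bar>Re \<rho> - \<sigma>\<bar> < r"
proof (rule ccontr)
  assume neg: "\<not> ?thesis"
  obtain w :: "nat \<Rightarrow> real" where w: "\<And>n. w n = 1 \<or> w n = - 1" "w 0 = 1" "w 1 = 1" "w 2 = - 1" "w 3 = - 1" "w 5 = - 1" "w 11 = 1"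
    and wsum: "(\<lambda>n. w n * fpow n \<sigma>) sums 0" using sign_pattern_exists[OF \<sigma>] by blast
  define wc where "wc = (\<lambda>n. of_real (w n) :: complex)"
  have nwc: "norm (wc n) \<le> 1" for n using w(1)[of n] by (auto simp: wc_def)
  define g where "g = fib_series wc"
  have "(\<lambda>n. of_real (w n * fpow n \<sigma>)) sums (of_real 0 :: complex)" using wsum by (rule sums_of_real)
  hence g0: "g (of_real \<sigma>) = 0" by (simp add: g_def fib_series_def fib_powr_polar wc_def sums_iff)
  define S where "S = ball (of_real \<sigma> :: complex) r"
  have Re_S: "\<bar>Re s - \<sigma>\<bar> < r" if "s \<in> S" for s
    using that abs_Re_le_cmod[of "s - of_real \<sigma>"] by (simp add: S_def dist_norm norm_minus_commute)
  define \<delta> where "\<delta> = \<sigma> - r"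
  have \<delta>: "\<delta> > 0" using r by (simp add: \<delta>_def)
  have S\<delta>: "\<delta> \<le> Re s" if "s \<in> S" for s using Re_S[OF that] by (simp add: \<delta>_def)
  have "\<exists>t. \<forall>n<k. norm (cis (- (t * ln (real (fib (Suc n))))) - wc n) \<le> 1 / real (Suc k)" for k
    unfolding wc_def by (rule phases_approximate_signs) (use w in auto)
  then obtain t where t: "\<And>k n. n < k \<Longrightarrow> norm (cis (- (t k * ln (real (fib (Suc n))))) - wc n) \<le> 1 / real (Suc k)" by metis
  define F where "F = (\<lambda>k. fib_series (\<lambda>n. cis (- (t k * ln (real (fib (Suc n)))))))"
  \<comment> \<open>The bound depends only on the left edge \<open>\<delta>\<close> of the disc, so
    convergence is uniform on all of it.\<close>
  define B where "B = (\<lambda>k. (1 / real (Suc k)) * (\<Sum>n. fpow n \<delta>) + 2 * (\<Sum>n. fpow (n + k) \<delta>))"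
  have FB: "norm (F k s - g s) \<le> B k" if "s \<in> S" for k s
    unfolding F_def g_def B_def by (rule fib_series_diff_le) (use t nwc \<delta> S\<delta>[OF that] in auto)
  have "B \<longlonglongrightarrow> 0 * (\<Sum>n. fpow n \<delta>) + 2 * 0"
    unfolding B_def
  proof (intro tendsto_intros)
    show "(\<lambda>k. 1 / real (Suc k)) \<longlonglongrightarrow> 0" using LIMSEQ_inverse_real_of_nat by (simp add: inverse_eq_divide)
    have sm: "summable (\<lambda>n. fpow n \<delta>)" by (rule summable_fpow[OF \<delta>])
    have "(\<lambda>k. (\<Sum>n. fpow n \<delta>) - (\<Sum>n<k. fpow n \<delta>)) \<longlonglongrightarrow> (\<Sum>n. fpow n \<delta>) - (\<Sum>n. fpow n \<delta>)"
      by (intro tendsto_intros summable_LIMSEQ sm)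
    thus "(\<lambda>k. \<Sum>n. fpow (n + k) \<delta>) \<longlonglongrightarrow> 0" by (simp add: suminf_minus_initial_segment[OF sm])
  qed
  hence B0: "B \<longlonglongrightarrow> 0" by simp
  have ulim: "uniform_limit S F g sequentially"
  proof (rule uniform_limitI)
    fix e :: real assume "e > 0"
    hence "\<forall>\<^sub>F k in sequentially. B k < e" using B0 by (auto dest: order_tendstoD)
    thus "\<forall>\<^sub>F k in sequentially. \<forall>s\<in>S. dist (F k s) (g s) < e"
      by eventually_elim (use FB in \<open>auto simp: dist_norm intro: le_less_trans\<close>)
  qed
  have sub: "S \<subseteq> {s. Re s > 0}" using S\<delta> \<delta> by force
  have holF: "F k holomorphic_on S" for k
    unfolding F_def by (rule holomorphic_on_subset[OF holomorphic_fib_series sub]) simp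
  have holg: "g holomorphic_on S"
    unfolding g_def by (rule holomorphic_on_subset[OF holomorphic_fib_series sub]) (rule nwc)
  have inS: "of_real \<sigma> \<in> S" using r by (simp add: S_def)
  have Fnz: "F k s \<noteq> 0" if "s \<in> S" for k s
  proof
    assume "F k s = 0"
    hence "Z_F (s + \<i> * of_real (t k)) = 0" by (simp add: F_def fib_series_shift)
    thus False using neg Re_S[OF that] by (metis (no_types, lifting) Re_complex_of_real add.right_neutral complex_Re_numeral plus_complex.simps(1) mult.commute Re_i_times Im_complex_of_real neg_0_equal_iff_equal)
  qed
  have nonconst: "\<not> g constant_on S"
  proof
    assume "g constant_on S"
    hence "g s = 0" if "s \<in> S" for s using g0 inS that unfolding constant_on_def by metis
    thus False
      using sign_series_not_constant[of w S] w(1,2,3) inS sub unfolding g_def wc_def S_def by auto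
  qed
  have "g (of_real \<sigma>) \<noteq> 0"
  proof (rule Hurwitz_no_zeros[of S F g])
    show "open S" "connected S" by (simp_all add: S_def)
    show "uniform_limit K F g sequentially" if "compact K" "K \<subseteq> S" for K
      using ulim that(2) by (rule uniform_limit_on_subset)
  qed (use holF holg nonconst Fnz inS in auto)
  thus False using g0 by simp
qed

section \<open>Zero-free half-plane and heights of zeros\<close>

lemma sigma_F_bounds: "743/1000 < sigma_F" "sigma_F < 744/1000"
  using sigma_F_properties(2,3) by (simp_all add: expo_def)

lemma cos_eq_minus_one_imp:
  assumes "cos x = - 1"
  shows "\<exists>k::int. x = of_int (2 * k - 1) * pi"
proof -
  have "cos (x + pi) = 1" using assms by simp
  then obtain k :: int where "x + pi = of_int k * 2 * pi" using cos_one_2pi_int by blast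
  thus ?thesis by (intro exI[of _ k]) (simp add: algebra_simps)
qed

text \<open>A zero in this half-plane would have \<open>2 powr (- it) = 3 powr (- it) = - 1\<close>, making
  \<open>ln 3 / ln 2\<close> a quotient of odd integers.\<close>
lemma no_zeros_right:
  assumes "Re s \<ge> sigma_F"
  shows "Z_F s \<noteq> 0"
proof
  assume Z: "Z_F s = 0"
  have s74: "Re s \<ge> 74/100" using assms sigma_F_bounds by simp
  have G4: "Gsum (Re s) \<le> 4"
    using Gsum_strict_antimono[of sigma_F "Re s"] assms sigma_F_bounds sigma_F_properties(4)
    by (cases "Re s = sigma_F") auto
  have le: "fpow n (Re s) * (1 + cos (Im s * ln (fib (Suc n)))) \<le> 0" if "n \<ge> 2" "n \<noteq> 11" for n
    by (rule order_trans[OF zero_imp_cos_bound[OF Z s74 that]]) (use G4 in simp)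
  have cosm1: "cos (Im s * ln (fib (Suc n))) = - 1" if "n \<ge> 2" "n \<noteq> 11" for n
    using le[OF that] fpow_pos[of n "Re s"] cos_ge_minus_one[of "Im s * ln (fib (Suc n))"]
    by (auto simp: mult_le_0_iff simp del: cos_ge_minus_one)
  obtain a :: int where a: "Im s * ln 2 = of_int (2 * a - 1) * pi"
    using cos_eq_minus_one_imp[OF cosm1[of 2]] by (auto simp: fib_values)
  obtain b :: int where b: "Im s * ln 3 = of_int (2 * b - 1) * pi"
    using cos_eq_minus_one_imp[OF cosm1[of 3]] by (auto simp: fib_values)
  have "2 * a - 1 \<noteq> 0" by presburger
  hence "real_of_int (2 * a - 1) \<noteq> 0" by (simp only: of_int_eq_0_iff not_False_eq_True)
  hence t0: "Im s \<noteq> 0" using a by (metis mult_eq_0_iff pi_neq_zero)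
  have "Im s * (of_int (2 * b - 1) * ln 2 - of_int (2 * a - 1) * ln 3) =
      of_int (2 * b - 1) * (Im s * ln 2) - of_int (2 * a - 1) * (Im s * ln 3)" by (simp only: algebra_simps)
  also have "\<dots> = 0" unfolding a b by (simp only: algebra_simps)
  finally have eq: "of_int (2 * b - 1) * ln 2 - of_int (2 * a - 1) * ln (3::real) = 0" using t0 by simp
  define e where "e = (\<lambda>n::nat. if n = 3 then 2 * b - 1 else - (2 * a - 1))"
  have "(\<Sum>n\<in>{3,4}. of_int (e n) * ln (real (fib n))) = 0"
    using eq by (simp add: e_def fib_values algebra_simps)
  hence "\<forall>n\<in>{3,4}. e n = 0" by (intro ln_fib_independent) auto
  hence "2 * b - 1 = 0" by (simp add: e_def)
  thus False by presburger
qed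

section \<open>Discreteness of zeros and the minimal height\<close>

text \<open>\<open>Z_F\<close> is not constant, since it has zeros near \<open>sigma_F\<close> but
  none at it. The finiteness gives the minimum in \<open>T_F\<close> and keeps zeros of bounded
  height away from the critical line.\<close>

lemma finite_zeros_box:
  assumes "a > 0"
  shows "finite {s. a \<le> Re s \<and> Re s \<le> b \<and> \<bar>Im s\<bar> \<le> T \<and> Z_F s = 0}"
proof -
  define K where "K = cbox (Complex a (- T)) (Complex b T)"
  have "finite {s \<in> K. Z_F s = 0}"
  proof (rule holomorphic_compact_finite_zeros)
    show "Z_F holomorphic_on {s. Re s > 0}" unfolding Z_F_eq by (rule holomorphic_fib_series) simp
    show "open {s. Re s > 0}" by (rule open_halfspace_Re_gt)
    show "connected {s. Re s > 0}" by (intro convex_connected convex_halfspace_Re_gt)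
    show "compact K" by (simp add: K_def compact_cbox)
    show "K \<subseteq> {s. Re s > 0}" using assms by (auto simp: K_def in_cbox_complex_iff)
    show "\<not> Z_F constant_on {s. Re s > 0}"
    proof
      assume "Z_F constant_on {s. Re s > 0}"
      then obtain c where c: "\<And>s. Re s > 0 \<Longrightarrow> Z_F s = c" by (auto simp: constant_on_def)
      have "sigma_F > 0" using sigma_F_bounds by simp
      then obtain \<rho> where \<rho>: "Z_F \<rho> = 0" "\<bar>Re \<rho> - sigma_F\<bar> < sigma_F / 2"
        using zeros_near[of sigma_F "sigma_F / 2"] by auto
      hence "Re \<rho> > 0" by linarith
      hence "c = 0" using c \<rho> by auto
      thus False using c[of "of_real sigma_F"] no_zeros_right[of "of_real sigma_F"] \<open>sigma_F > 0\<close> by simp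
    qed
  qed
  moreover have "{s. a \<le> Re s \<and> Re s \<le> b \<and> \<bar>Im s\<bar> \<le> T \<and> Z_F s = 0} = {s \<in> K. Z_F s = 0}"
    by (auto simp: K_def in_cbox_complex_iff abs_le_iff)
  ultimately show ?thesis by simp
qed

text \<open>One zero in the strip exists by density. Only heights up to its own compete for the
  minimum, and in Re s > 1/2 there are finitely many of these.\<close>

lemma T_F_is_least:
  assumes "0 < \<epsilon>" "\<epsilon> < sigma_F - 1/2"
  shows "T_F \<epsilon> \<in> zero_heights \<epsilon> \<and> (\<forall>t\<in>zero_heights \<epsilon>. T_F \<epsilon> \<le> t)"
proof -
  obtain \<rho> where \<rho>: "Z_F \<rho> = 0" "\<bar>Re \<rho> - (sigma_F - \<epsilon> / 2)\<bar> < \<epsilon> / 2"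
    using zeros_near[of "sigma_F - \<epsilon> / 2" "\<epsilon> / 2"] assms by auto
  define t0 where "t0 = \<bar>Im \<rho>\<bar>"
  have t0: "t0 \<in> zero_heights \<epsilon>" using \<rho> unfolding zero_heights_def t0_def abs_less_iff by force
  define A where "A = {t \<in> zero_heights \<epsilon>. t \<le> t0}"
  have "A \<subseteq> (\<lambda>s. \<bar>Im s\<bar>) ` {s. 1/2 \<le> Re s \<and> Re s \<le> sigma_F \<and> \<bar>Im s\<bar> \<le> t0 \<and> Z_F s = 0}"
    using assms by (auto simp: A_def zero_heights_def)
  hence finA: "finite A" using finite_zeros_box[of "1/2" sigma_F t0] by (auto dest: finite_subset)
  have A0: "A \<noteq> {}" using t0 by (auto simp: A_def)
  have Min: "Min A \<in> zero_heights \<epsilon>" using Min_in[OF finA A0] by (simp add: A_def)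
  have least: "Min A \<le> t" if "t \<in> zero_heights \<epsilon>" for t
  proof (cases "t \<le> t0")
    case True
    thus ?thesis using that finA by (intro Min_le) (auto simp: A_def)
  next
    case False
    thus ?thesis using Min_in[OF finA A0] by (auto simp: A_def)
  qed
  have "T_F \<epsilon> = Min A" unfolding T_F_def by (rule Least_equality) (use Min least in auto)
  thus ?thesis using Min least by auto
qed

lemma closure_R_F: "closure R_F = {0..sigma_F}"
proof
  have "R_F \<subseteq> {0..sigma_F}"
  proof
    fix x assume "x \<in> R_F"
    then obtain \<rho> where "x = Re \<rho>" "Z_F \<rho> = 0" "Re \<rho> > 0" by (auto simp: R_F_def)
    thus "x \<in> {0..sigma_F}" using no_zeros_right[of \<rho>] by force
  qed
  thus "closure R_F \<subseteq> {0..sigma_F}" by (rule closure_minimal) simp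
  have sF: "0 < sigma_F" using sigma_F_bounds by simp
  have "{0<..<sigma_F} \<subseteq> closure R_F"
  proof
    fix \<sigma> assume \<sigma>: "\<sigma> \<in> {0<..<sigma_F}"
    show "\<sigma> \<in> closure R_F"
      unfolding closure_approachable
    proof (intro allI impI)
      fix e :: real assume e: "e > 0"
      define r where "r = min (e / 2) (\<sigma> / 2)"
      have r: "0 < r" "r < \<sigma>" "r < e" using e \<sigma> by (auto simp: r_def)
      obtain \<rho> where \<rho>: "Z_F \<rho> = 0" "\<bar>Re \<rho> - \<sigma>\<bar> < r"
        using zeros_near[of \<sigma> r] \<sigma> r by auto
      have "Re \<rho> > 0" using \<rho>(2) r by (auto simp: abs_less_iff)
      hence "Re \<rho> \<in> R_F" using \<rho> by (auto simp: R_F_def)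
      moreover have "dist (Re \<rho>) \<sigma> < e" using \<rho>(2) r by (simp add: dist_real_def)
      ultimately show "\<exists>y\<in>R_F. dist y \<sigma> < e" by blast
    qed
  qed
  hence "closure {0<..<sigma_F} \<subseteq> closure R_F" by (rule closure_minimal) simp
  thus "{0..sigma_F} \<subseteq> closure R_F" using sF by simp
qed

lemma Sup_R_F: "Sup R_F = sigma_F"
proof -
  have sF: "0 < sigma_F" using sigma_F_bounds by simp
  have ne: "R_F \<noteq> {}" using closure_R_F sF by auto
  have sub: "R_F \<subseteq> {0..sigma_F}" using closure_R_F closure_subset by blast
  have bdd: "bdd_above R_F" by (rule bdd_above_mono[OF _ sub]) simp
  have "closure R_F \<subseteq> {..Sup R_F}" by (rule closure_minimal) (auto intro: cSup_upper bdd)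
  hence "sigma_F \<le> Sup R_F" using closure_R_F sF by auto
  moreover have "Sup R_F \<le> sigma_F" using ne sub by (intro cSup_least) auto
  ultimately show ?thesis by simp
qed

section \<open>Lower bound for the heights by Cassini's identity\<close>

text \<open>Adding pi to each angle leaves x + y - 2z unchanged and turns 1 + cos into 1 - cos,
  after which subadditivity applies twice; the constants 7/5, 49/10 and 49 stay below 100.\<close>

lemma one_minus_cos_cassini:
  "1 - cos (x + y - 2 * z) \<le> 100 * ((1 + cos x) + (1 + cos y) + (1 + cos (z::real)))"
proof -
  have dbl: "1 - cos (2 * v) \<le> 4 * (1 - cos v)" for v :: real
  proof -
    have "1 - cos (2 * v) = 2 * (1 + cos v) * (1 - cos v)"
      using cos_double_cos[of v] by (simp add: power2_eq_square algebra_simps)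
    also have "\<dots> \<le> 4 * (1 - cos v)" by (intro mult_right_mono) auto
    finally show ?thesis .
  qed
  have nn: "1 + cos v \<ge> 0" for v :: real using cos_ge_minus_one[of v] by linarith
  have "1 - cos (x + y - 2 * z) = 1 - cos ((x + pi) + ((y + pi) + 2 * (- (z + pi))))"
    by (simp add: algebra_simps)
  also have "\<dots> \<le> (7/5) * (1 - cos (x + pi)) + (7/2) * (1 - cos ((y + pi) + 2 * (- (z + pi))))"
    by (rule one_minus_cos_sum_le)
  also have "1 - cos ((y + pi) + 2 * (- (z + pi))) \<le> (7/5) * (1 - cos (y + pi)) + (7/2) * (1 - cos (2 * (- (z + pi))))"
    by (rule one_minus_cos_sum_le)
  also have "1 - cos (2 * (- (z + pi))) \<le> 4 * (1 - cos (- (z + pi)))" by (rule dbl)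
  finally have "1 - cos (x + y - 2 * z) \<le> (7/5) * (1 + cos x) + (7/2) * ((7/5) * (1 + cos y) + (7/2) * (4 * (1 + cos z)))"
    by simp
  thus ?thesis using nn[of x] nn[of y] nn[of z] by argo
qed

text \<open>By Cassini's identity d is the logarithm of 1 plus or minus 1 / F_m^2, so it is small
  but of known order and never zero.\<close>

lemma cassini_ln_bounds:
  assumes "m \<ge> 3"
  defines "d \<equiv> ln (real (fib (m + 1))) + ln (real (fib (m - 1))) - 2 * ln (real (fib m))"
  shows "1 / (2 * real (fib m) ^ 2) \<le> \<bar>d\<bar>" "\<bar>d\<bar> \<le> 2 / real (fib m) ^ 2"
proof -
  obtain k where m: "m = Suc k" "k \<ge> 2" using assms by (cases m) auto
  define F where "F = real (fib m)"
  define u where "u = 1 / F ^ 2"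
  have "fib 3 \<le> fib m" by (rule fib_mono) (use assms in simp)
  hence F: "F \<ge> 2" by (simp add: F_def fib_values)
  have pos: "real (fib (m + 1)) > 0" "real (fib (m - 1)) > 0" "F > 0"
    using fib_neq_0_nat[of "m + 1"] fib_neq_0_nat[of "m - 1"] m F by simp_all
  have "2 ^ 2 \<le> F ^ 2" using F by (intro power_mono) auto
  hence F2: "F ^ 2 \<ge> 4" by simp
  have u: "0 < u" "u \<le> 1/4" using F2 pos by (auto simp: u_def field_simps)
  have "real_of_int (int (fib (Suc (Suc k)) * fib k) - int ((fib (Suc k))\<^sup>2)) = real_of_int (- ((-1) ^ k))"
    by (simp only: fib_Cassini_int)
  hence "real (fib (m + 1)) * real (fib (m - 1)) - F ^ 2 = - ((-1) ^ k)"
    by (simp add: m F_def)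
  hence "real (fib (m + 1)) * real (fib (m - 1)) = F ^ 2 * (1 - (-1) ^ k * u)"
    using pos by (simp add: u_def algebra_simps)
  moreover have "d = ln (real (fib (m + 1)) * real (fib (m - 1))) - ln (F ^ 2)"
    unfolding d_def F_def[symmetric] using pos by (simp add: ln_mult ln_realpow)
  moreover have "1 - (-1) ^ k * u > 0" using u by (cases "even k") auto
  ultimately have d: "d = ln (1 - (-1) ^ k * u)" using pos by (simp add: ln_mult)
  have "u / 2 \<le> \<bar>d\<bar> \<and> \<bar>d\<bar> \<le> 2 * u"
  proof (cases "even k")
    case True
    hence dd: "d = ln (1 - u)" by (simp add: d)
    have up: "d \<le> - u" using ln_le_minus_one[of "1 - u"] u unfolding dd by simp
    have "- d = ln (1 / (1 - u))" using u unfolding dd by (simp add: ln_div)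
    also have "\<dots> \<le> 1 / (1 - u) - 1" using u by (intro ln_le_minus_one) simp
    also have "\<dots> \<le> 2 * u" 
    proof -
      have "0 \<le> u * (1 - 2 * u)" using u by simp
      hence "1 \<le> (1 + 2 * u) * (1 - u)" by (simp add: algebra_simps)
      thus ?thesis using u by (simp add: field_simps)
    qed
    finally show ?thesis using up u by linarith
  next
    case False
    hence dd: "d = ln (1 + u)" by (simp add: d)
    have up: "d \<le> u" using ln_le_minus_one[of "1 + u"] u unfolding dd by simp
    have "- d = ln (1 / (1 + u))" using u unfolding dd by (simp add: ln_div)
    also have "\<dots> \<le> 1 / (1 + u) - 1" using u by (intro ln_le_minus_one) simp
    also have "\<dots> \<le> - (u / 2)" using u by (simp add: field_simps)
    finally show ?thesis using up u by linarith
  qed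
  thus "1 / (2 * real (fib m) ^ 2) \<le> \<bar>d\<bar>" "\<bar>d\<bar> \<le> 2 / real (fib m) ^ 2"
    by (simp_all add: u_def F_def)
qed

text \<open>377^2 = 142129 is below 150000, so the bracketing index m is at least 14; then m - 1, m
  and m + 1 all avoid the exceptional index 12.\<close>

lemma fib_square_bracket:
  assumes "X \<ge> 150000"
  shows "\<exists>m\<ge>14. real (fib m) ^ 2 \<le> X \<and> X < real (fib (Suc m)) ^ 2"
proof -
  obtain N where N: "X < (3/2) ^ N" using real_arch_pow[of "3/2" X] by auto
  have "(3/2) ^ N / 2 \<le> real (fib (Suc N))" by (rule fib_Suc_ge_power)
  hence f: "X / 2 < real (fib (Suc N))" using N by linarith
  have "X < (X / 2) * (X / 2)" using assms mult_strict_left_mono[of 4 X X] by simp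
  also have "\<dots> \<le> real (fib (Suc N)) ^ 2" unfolding power2_eq_square using f assms by (intro mult_mono) auto
  finally have ex: "X < real (fib (Suc N)) ^ 2" .
  define k where "k = (LEAST k. X < real (fib k) ^ 2)"
  have k: "X < real (fib k) ^ 2" unfolding k_def using ex by (rule LeastI)
  have k15: "k \<ge> 15"
  proof (rule ccontr)
    assume "\<not> ?thesis"
    hence "fib k \<le> fib 14" by (intro fib_mono) simp
    hence "real (fib k) \<le> 377" by (simp add: fib_values)
    hence "real (fib k) ^ 2 \<le> 377 ^ 2" by (intro power_mono) auto
    thus False using k assms by simp
  qed
  then obtain m where m: "k = Suc m" "m \<ge> 14" by (cases k) auto
  have "\<not> X < real (fib m) ^ 2" using not_less_Least[of m "\<lambda>k. X < real (fib k) ^ 2"] m by (simp add: k_def)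
  thus ?thesis using k m by (intro exI[of _ m]) auto
qed

lemma zero_height_lower_bound:
  "\<exists>c>0. \<exists>\<epsilon>\<^sub>0>0. \<forall>\<epsilon> \<rho>. 0 < \<epsilon> \<longrightarrow> \<epsilon> < \<epsilon>\<^sub>0 \<longrightarrow> Z_F \<rho> = 0 \<longrightarrow> sigma_F - \<epsilon> < Re \<rho> \<longrightarrow> Re \<rho> < sigma_F \<longrightarrow>
     c \<le> \<epsilon> * \<bar>Im \<rho>\<bar>"
proof -
  define C where "C = 2 * (\<Sum>n. fpow n (1/10))"
  have "fpow 0 (1/10) \<le> (\<Sum>n. fpow n (1/10))"
    using sum_le_suminf[OF summable_fpow[of "1/10"], of "{0}"] fpow_pos by (auto intro: less_imp_le)
  hence C: "C > 0" using fpow_pos[of 0 "1/10"] by (simp add: C_def)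
  define \<kappa> :: real where "\<kappa> = 1 - cos (1/8)"
  have "cos (1/8 :: real) < cos 0" using pi_gt3 by (intro cos_monotone_0_pi) auto
  hence \<kappa>: "\<kappa> > 0" by (simp add: \<kappa>_def)
  define T0 :: real where "T0 = 40000"
  define B where "B = Re ` {s. 1/2 \<le> Re s \<and> Re s \<le> sigma_F \<and> \<bar>Im s\<bar> \<le> T0 \<and> Z_F s = 0}"
  have finB: "finite B" unfolding B_def by (intro finite_imageI finite_zeros_box) simp
  have Blt: "x < sigma_F" if "x \<in> B" for x
    using that no_zeros_right unfolding B_def by force
  \<comment> \<open>Finitely many zeros have height up to \<open>T0\<close>, all strictly left of
    \<open>sigma_F\<close>. To the right of \<open>M\<close> every zero is higher than
    \<open>T0\<close>, large enough for the bracketing of \<open>4 * \<bar>t\<bar>\<close>.\<close>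
  define M where "M = Max (insert (sigma_F - 1/1000) B)"
  have M: "M < sigma_F" "sigma_F - 1/1000 \<le> M" "\<And>x. x \<in> B \<Longrightarrow> x \<le> M"
    using finB Blt unfolding M_def by auto
  define c where "c = \<kappa> / (240000 * C)"
  have main: "c \<le> \<epsilon> * \<bar>Im \<rho>\<bar>"
    if \<epsilon>: "0 < \<epsilon>" "\<epsilon> < sigma_F - M" and Z: "Z_F \<rho> = 0" and Re: "sigma_F - \<epsilon> < Re \<rho>" "Re \<rho> < sigma_F" for \<epsilon> \<rho>
  proof -
    have ReM: "Re \<rho> > M" using \<epsilon> Re by linarith
    have e1: "\<epsilon> < 1/1000" using \<epsilon> M by linarith
    have r74: "Re \<rho> \<ge> 74/100" using Re e1 sigma_F_bounds by linarith
    have T: "\<bar>Im \<rho>\<bar> > T0"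
    proof (rule ccontr)
      assume "\<not> ?thesis"
      hence "Re \<rho> \<in> B" using Z Re r74 unfolding B_def by force
      thus False using M(3) ReM by force
    qed
    define t where "t = Im \<rho>"
    have E: "1 + cos (t * ln (fib (Suc n))) \<le> 100 * C * \<epsilon> * real (fib (Suc n))" if "n \<ge> 2" "n \<noteq> 11" for n
    proof -
      have "Gsum (Re \<rho>) - 4 \<le> C * (sigma_F - Re \<rho>)"
        using Gsum_diff_le[of "Re \<rho>" sigma_F] r74 Re sigma_F_properties(4) by (simp add: C_def)
      also have "\<dots> \<le> C * \<epsilon>" using Re C by (intro mult_left_mono) auto
      finally have "fpow n (Re \<rho>) * (1 + cos (t * ln (fib (Suc n)))) \<le> 100 * (C * \<epsilon>)"
        unfolding t_def by (intro order_trans[OF zero_imp_cos_bound[OF Z r74 that]] mult_left_mono) auto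
      moreover have "real (fib (Suc n)) powr (-1) \<le> fpow n (Re \<rho>)"
        unfolding fpow_def using fib_Suc_ge_1[of n] Re sigma_F_bounds by (intro powr_mono) auto
      moreover have nn: "1 + cos (t * ln (fib (Suc n))) \<ge> 0" using cos_ge_minus_one[of "t * ln (fib (Suc n))"] by linarith
      ultimately have "real (fib (Suc n)) powr (-1) * (1 + cos (t * ln (fib (Suc n)))) \<le> 100 * (C * \<epsilon>)"
        by (meson mult_right_mono order_trans)
      thus ?thesis using fib_Suc_ge_1[of n] by (simp add: powr_minus field_simps)
    qed
    have "4 * \<bar>t\<bar> \<ge> 150000" using T by (simp add: T0_def t_def)
    then obtain m where m: "m \<ge> 14" "real (fib m) ^ 2 \<le> 4 * \<bar>t\<bar>" "4 * \<bar>t\<bar> < real (fib (Suc m)) ^ 2"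
      using fib_square_bracket by blast
    define F where "F = real (fib m)"
    define d where "d = ln (real (fib (m + 1))) + ln (real (fib (m - 1))) - 2 * ln (real (fib m))"
    have d: "1 / (2 * F ^ 2) \<le> \<bar>d\<bar>" "\<bar>d\<bar> \<le> 2 / F ^ 2"
      using cassini_ln_bounds[of m] m unfolding d_def F_def by auto
    have F1: "F \<ge> 1" using fib_Suc_ge_1[of "m - 1"] m by (simp add: F_def)
    have F2: "real (fib (Suc m)) \<le> 2 * F"
    proof -
      obtain k where "m = Suc k" using m by (cases m) auto
      thus ?thesis using fib_Suc_mono[of k] by (simp add: F_def)
    qed
    have tF: "\<bar>t\<bar> \<ge> F ^ 2 / 4" using m by (simp add: F_def)
    have "real (fib (Suc m)) ^ 2 \<le> (2 * F) ^ 2" using F2 by (intro power_mono) auto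
    hence tF': "\<bar>t\<bar> \<le> F ^ 2" using m by (simp add: power_mult_distrib)
    have FF: "F ^ 2 > 0" using F1 by simp
    have "1/8 \<le> \<bar>t\<bar> * \<bar>d\<bar>"
    proof -
      have "(F ^ 2 / 4) * (1 / (2 * F ^ 2)) \<le> \<bar>t\<bar> * \<bar>d\<bar>" using tF d FF by (intro mult_mono) auto
      thus ?thesis using FF by simp
    qed
    moreover have "\<bar>t\<bar> * \<bar>d\<bar> \<le> 2"
    proof -
      have "\<bar>t\<bar> * \<bar>d\<bar> \<le> F ^ 2 * (2 / F ^ 2)" using tF' d FF by (intro mult_mono) auto
      thus ?thesis using FF by simp
    qed
    \<comment> \<open>The product lies in [1/8, 2], inside (0, pi), where cos is decreasing; this is
      the quantitative obstruction to alignment.\<close>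
    ultimately have "cos (\<bar>t\<bar> * \<bar>d\<bar>) \<le> cos (1/8)" using pi_gt3 by (intro cos_monotone_0_pi_le) auto
    hence "cos (t * d) \<le> cos (1/8)" by (simp add: abs_mult[symmetric])
    hence "\<kappa> \<le> 1 - cos (t * d)" by (simp add: \<kappa>_def)
    also have "t * d = t * ln (fib (m + 1)) + t * ln (fib (m - 1)) - 2 * (t * ln (fib m))"
      unfolding d_def by (simp add: algebra_simps)
    also have "1 - cos \<dots> \<le> 100 * ((1 + cos (t * ln (fib (m + 1)))) + (1 + cos (t * ln (fib (m - 1)))) + (1 + cos (t * ln (fib m))))"
      by (rule one_minus_cos_cassini)
    also have "\<dots> \<le> 100 * (100 * C * \<epsilon> * (2 * F) + 100 * C * \<epsilon> * (2 * F) + 100 * C * \<epsilon> * (2 * F))"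
    proof -
      have E': "1 + cos (t * ln (fib j)) \<le> 100 * C * \<epsilon> * (2 * F)" if "j \<ge> 13" "j \<le> m + 1" for j
      proof -
        have "fib j \<le> fib (Suc m)" using that by (intro fib_mono) simp
        hence "real (fib j) \<le> 2 * F" using F2 by linarith
        hence "100 * C * \<epsilon> * real (fib j) \<le> 100 * C * \<epsilon> * (2 * F)" using C \<epsilon> by (intro mult_left_mono) auto
        moreover have "1 + cos (t * ln (fib j)) \<le> 100 * C * \<epsilon> * real (fib j)"
          using E[of "j - 1"] that by simp
        ultimately show ?thesis by linarith
      qed
      show ?thesis using E'[of "m + 1"] E'[of "m - 1"] E'[of m] m(1) by (intro mult_left_mono add_mono) auto
    qed
    also have "\<dots> = 60000 * C * (\<epsilon> * F)" by simp
    \<comment> \<open>F is even at most 2 sqrt |t|, which would give heights of order epsilon^(-2);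
      the cruder linear bound suffices.\<close>
    also have "\<dots> \<le> 60000 * C * (\<epsilon> * (4 * \<bar>t\<bar>))"
    proof -
      have "F * 1 \<le> F * F" using F1 by (intro mult_left_mono) auto
      hence "F \<le> 4 * \<bar>t\<bar>" using tF by (simp add: power2_eq_square)
      thus ?thesis using C \<epsilon> by (intro mult_left_mono) auto
    qed
    finally have "\<kappa> \<le> 240000 * C * (\<epsilon> * \<bar>t\<bar>)" by simp
    thus ?thesis using C by (simp add: c_def t_def field_simps)
  qed
  have "c > 0" "sigma_F - M > 0" using \<kappa> C M by (auto simp: c_def)
  thus ?thesis using main by blast
qed

theorem theorem1p1:
  shows "(\<exists>!\<sigma>::real. \<sigma> \<in> {0.7<..<0.75} \<and> H_F \<sigma> = 0)
    \<and> 0.743163398726901648 \<le> sigma_F \<and> sigma_F < 0.743163398726901649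
    \<and> (\<forall>s. Re s \<ge> sigma_F \<longrightarrow> Z_F s \<noteq> 0)
    \<and> closure R_F = {0..sigma_F}
    \<and> (\<forall>\<epsilon>. 0 < \<epsilon> \<and> \<epsilon> < sigma_F - 1/2 \<longrightarrow>
          T_F \<epsilon> \<in> zero_heights \<epsilon> \<and> (\<forall>t \<in> zero_heights \<epsilon>. T_F \<epsilon> \<le> t))
    \<and> (\<forall>\<eta>>0. \<exists>c>0. \<exists>\<epsilon>\<^sub>0>0. \<forall>\<epsilon>. 0 < \<epsilon> \<and> \<epsilon> < \<epsilon>\<^sub>0 \<longrightarrow>
          T_F \<epsilon> \<ge> c * \<epsilon> powr (- 1 / (15.232 + \<eta>)))
    \<and> Sup R_F = sigma_F
    \<and> (\<forall>\<rho>. Re \<rho> = sigma_F \<longrightarrow> Z_F \<rho> \<noteq> 0)"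
proof (intro conjI allI impI)
  show "\<exists>!\<sigma>::real. \<sigma> \<in> {0.7<..<0.75} \<and> H_F \<sigma> = 0" by (rule sigma_F_properties(1))
  show "0.743163398726901648 \<le> sigma_F" "sigma_F < 0.743163398726901649"
    using sigma_F_properties(2,3) by (simp_all add: expo_def)
  show "Z_F s \<noteq> 0" if "Re s \<ge> sigma_F" for s using that by (rule no_zeros_right)
  show "closure R_F = {0..sigma_F}" by (rule closure_R_F)
  show "T_F \<epsilon> \<in> zero_heights \<epsilon>" if "0 < \<epsilon> \<and> \<epsilon> < sigma_F - 1/2" for \<epsilon> using T_F_is_least that by blast
  show "\<forall>t \<in> zero_heights \<epsilon>. T_F \<epsilon> \<le> t" if "0 < \<epsilon> \<and> \<epsilon> < sigma_F - 1/2" for \<epsilon> using T_F_is_least that by blast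
  show "Sup R_F = sigma_F" by (rule Sup_R_F)
  show "Z_F \<rho> \<noteq> 0" if "Re \<rho> = sigma_F" for \<rho> using that by (intro no_zeros_right) simp
  fix \<eta> :: real assume \<eta>: "\<eta> > 0"
  obtain c \<epsilon>\<^sub>0 where c: "c > 0" "\<epsilon>\<^sub>0 > 0" and low: "\<And>\<epsilon> \<rho>. 0 < \<epsilon> \<Longrightarrow> \<epsilon> < \<epsilon>\<^sub>0 \<Longrightarrow> Z_F \<rho> = 0 \<Longrightarrow> sigma_F - \<epsilon> < Re \<rho> \<Longrightarrow> Re \<rho> < sigma_F \<Longrightarrow>
     c \<le> \<epsilon> * \<bar>Im \<rho>\<bar>" using zero_height_lower_bound by blast
  define p where "p = 1 / (15.232 + \<eta>)"
  have p: "0 < p" "p \<le> 1" using \<eta> by (auto simp: p_def field_simps)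
  \<comment> \<open>1/5 is below sigma_F - 1/2, so the minimum is attained, and below 1, so that
    epsilon^(-p) <= epsilon^(-1) for p <= 1.\<close>
  have "T_F \<epsilon> \<ge> c * \<epsilon> powr (- 1 / (15.232 + \<eta>))" if \<epsilon>: "0 < \<epsilon>" "\<epsilon> < min \<epsilon>\<^sub>0 (1/5)" for \<epsilon>
  proof -
    have "T_F \<epsilon> \<in> zero_heights \<epsilon>" using T_F_is_least[of \<epsilon>] \<epsilon> sigma_F_bounds by auto
    then obtain \<rho> where \<rho>: "T_F \<epsilon> = \<bar>Im \<rho>\<bar>" "Z_F \<rho> = 0" "sigma_F - \<epsilon> < Re \<rho>" "Re \<rho> < sigma_F"
      by (auto simp: zero_heights_def)
    have "c \<le> \<epsilon> * T_F \<epsilon>" unfolding \<rho>(1) using \<epsilon> \<rho> by (intro low) auto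
    hence "c * \<epsilon> powr (- 1) \<le> T_F \<epsilon>" using \<epsilon> by (simp add: powr_minus field_simps)
    moreover have "\<epsilon> powr (- p) \<le> \<epsilon> powr (- 1)" using \<epsilon> p by (intro powr_mono') auto
    hence "c * \<epsilon> powr (- p) \<le> c * \<epsilon> powr (- 1)" using c by (intro mult_left_mono) auto
    ultimately show ?thesis by (simp add: p_def)
  qed
  moreover have "min \<epsilon>\<^sub>0 (1/5) > 0" using c by simp
  ultimately show "\<exists>c>0. \<exists>\<epsilon>\<^sub>0>0. \<forall>\<epsilon>. 0 < \<epsilon> \<and> \<epsilon> < \<epsilon>\<^sub>0 \<longrightarrow>
          T_F \<epsilon> \<ge> c * \<epsilon> powr (- 1 / (15.232 + \<eta>))" using c(1) by blast
qed

end
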